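(* Let $m$ be an odd prime and $q=2^m$. Then the association scheme $(\mathcal{E},\{\Delta_a\})$ on the set $\mathcal{E}$ of exterior lines to the conic $\mathcal{O}$ in $\mathrm{PG}(2,q)$, whose classes are the orbitals of $\mathrm{P\Gamma L}(2,q)$ on $\mathcal{E}$, is pseudocyclic.
   Context: A (symmetric) association scheme with $d$ classes on a finite set $X$ is a partition of $X\times X$ into relations $R_0,\ldots,R_d$ with $R_0$ the diagonal, each $R_i$ symmetric, and such that for all $i,j,k$ and all $(x,y)\in R_k$ the number $|\{z:(x,z)\in R_i,(z,y)\in R_j\}|$ depends only on $i,j,k$. The adjacency matrices $A_0,\ldots,A_d$ span a commutative algebra (the Bose–Mesner algebra), which has a basis of primitive idempotents $E_0=\frac{1}{|X|}J,E_1,\ldots,E_d$; the multiplicities are $m_i=\mathrm{rank}\,E_i$. The scheme is pseudocyclic if $m_1=m_2=\cdots=m_d$. Let $q=2^m$, $\mathrm{Tr}:\mathbb{F}_q\to\mathbb{F}_2$ the absolute trace, $\mathbf{T}_0^*=\{x\in\mathbb{F}_q^*:\mathrm{Tr}(x)=0\}$. Let $\mathcal{O}=\{(\xi,\xi^2,1):\xi\in\mathbb{F}_q\}\cup\{(0,1,0)\}\subset\mathrm{PG}(2,q)$, and let $\mathcal{E}$ be the set of lines missing $\mathcal{O}$; these are exactly the lines $(1,x,y)^\perp=\{(a_0,a_1,a_2):a_0+a_1x+a_2y=0\}$ with $\mathrm{Tr}(xy)=1$, so $|\mathcal{E}|=q(q-1)/2$. For $\ell=(1,x,y)^\perp$,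 $n=(1,z,u)^\perp$ define $\hat\rho(\ell,n)=x^2u^2+y^2z^2+(x+z)(y+u)$, and for $a\in\mathbf{T}_0^*$ let $\Gamma_a=\{(\ell,n)\in\mathcal{E}^2:\hat\rho(\ell,n)=a\}$; together with the diagonal $\Gamma_0$ these are the orbitals of $\mathrm{PGL}(2,q)$ (the stabilizer of $\mathcal{O}$ in $\mathrm{PGL}(3,q)$) on $\mathcal{E}$. For $a\in\mathbf{T}_0^*$ let $C_a=\{a,a^2,a^4,\ldots,a^{2^{m-1}}\}$ and $\Delta_a=\bigcup_{i\in C_a}\Gamma_i$; with $\Delta_0=\Gamma_0$, the distinct sets $\Delta_a$ are the orbitals of $\mathrm{P\Gamma L}(2,q)$ on $\mathcal{E}$ and form an association scheme $(\mathcal{E},\{\Delta_a\})$. *)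

theory Defs
  imports "HOL-Analysis.Analysis" "HOL-Computational_Algebra.Primes"
begin

section \<open>Symmetric association schemes\<close>

text \<open>The number of classes is the number of relations other than the diagonal; the relations
  form a set, hence are pairwise distinct, and they are nonempty by \<^const>\<open>partition_on\<close>.\<close>

definition association_scheme :: "'x set \<Rightarrow> ('x \<times> 'x) set set \<Rightarrow> bool" where
  "association_scheme X \<R> \<longleftrightarrow>
     finite X \<and> X \<noteq> {} \<and> partition_on (X \<times> X) \<R> \<and> Id_on X \<in> \<R> \<and> (\<forall>R\<in>\<R>. sym R) \<and>
     (\<forall>R\<in>\<R>. \<forall>S\<in>\<R>. \<forall>T\<in>\<R>. \<exists>p::nat. \<forall>(x, y)\<in>T. card {z. (x, z) \<in> R \<and> (z, y) \<in> S} = p)"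

text \<open>Matrices with rows and columns indexed by a subset \<open>X\<close> of a finite type are represented as
  matrices over the whole type that vanish outside \<open>X \<times> X\<close>. Ranks, sums and products are
  unaffected; the identity of the Bose-Mesner algebra is the adjacency matrix of the diagonal of
  \<open>X\<close>. As all relations are symmetric, the algebra is taken over the reals.\<close>

definition adjacency_matrix :: "('x::finite \<times> 'x) set \<Rightarrow> real^'x^'x" where
  "adjacency_matrix R = (\<chi> x y. if (x, y) \<in> R then 1 else 0)"

definition bose_mesner_algebra :: "('x::finite \<times> 'x) set set \<Rightarrow> (real^'x^'x) set" where
  "bose_mesner_algebra \<R> = span (adjacency_matrix ` \<R>)"

definition primitive_idempotent :: "(real^'x^'x) set \<Rightarrow> real^'x^'x::finite \<Rightarrow> bool" where
  "primitive_idempotent \<A> E \<longleftrightarrow>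
     E \<in> \<A> \<and> E \<noteq> 0 \<and> E ** E = E \<and>
     \<not> (\<exists>F\<in>\<A>. \<exists>G\<in>\<A>. F \<noteq> 0 \<and> G \<noteq> 0 \<and> F ** F = F \<and> G ** G = G \<and>
          F ** G = 0 \<and> G ** F = 0 \<and> E = F + G)"

definition trivial_idempotent :: "'x::finite set \<Rightarrow> real^'x^'x" where
  "trivial_idempotent X = (\<chi> x y. if x \<in> X \<and> y \<in> X then 1 / real (card X) else 0)"

definition pseudocyclic :: "'x::finite set \<Rightarrow> ('x \<times> 'x) set set \<Rightarrow> bool" where
  "pseudocyclic X \<R> \<longleftrightarrow>
     (\<exists>k. \<forall>E. primitive_idempotent (bose_mesner_algebra \<R>) E \<and> E \<noteq> trivial_idempotent X
              \<longrightarrow> rank E = k)"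

section \<open>The projective plane, the conic and its exterior lines\<close>

text \<open>Points and lines are the 1- and 2-dimensional subspaces of the coordinate space; the
  coordinates \<open>(a\<^sub>0, a\<^sub>1, a\<^sub>2)\<close> of a vector \<open>v\<close> are \<open>v $ 1\<close>, \<open>v $ 2\<close>, \<open>v $ 3\<close>.\<close>

definition proj_lines :: "('a::field^3) set set" where
  "proj_lines = {L. vec.subspace L \<and> vec.dim L = 2}"

definition conic :: "('a::field^3) set set" where
  "conic = {vec.span {vector [\<xi>, \<xi>\<^sup>2, 1]} | \<xi>. True} \<union> {vec.span {vector [0, 1, 0]}}"

definition exterior_lines :: "('a::field^3) set set" where
  "exterior_lines = {L \<in> proj_lines. \<forall>P\<in>conic. \<not> P \<subseteq> L}"

definition perp_line :: "'a::field \<Rightarrow> 'a \<Rightarrow> ('a^3) set" where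
  "perp_line x y = {v. v $ 1 + v $ 2 * x + v $ 3 * y = 0}"

section \<open>The relations\<close>

definition rho_hat :: "'a::field \<Rightarrow> 'a \<Rightarrow> 'a \<Rightarrow> 'a \<Rightarrow> 'a" where
  "rho_hat x y z u = x\<^sup>2 * u\<^sup>2 + y\<^sup>2 * z\<^sup>2 + (x + z) * (y + u)"

text \<open>Only used for nonzero \<open>a\<close>; the diagonal is a separate relation.\<close>

definition Gamma :: "'a::field \<Rightarrow> (('a^3) set \<times> ('a^3) set) set" where
  "Gamma a = {(l, n). l \<in> exterior_lines \<and> n \<in> exterior_lines \<and>
     (\<exists>x y z u. l = perp_line x y \<and> n = perp_line z u \<and> rho_hat x y z u = a)}"

text \<open>The absolute trace of the field with \<open>2 ^ m\<close> elements, its values 0 and 1 being regarded as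
  elements of that field.\<close>

definition abs_trace :: "nat \<Rightarrow> 'a::field \<Rightarrow> 'a" where
  "abs_trace m x = (\<Sum>i<m. x ^ (2 ^ i))"

definition trace0_star :: "nat \<Rightarrow> 'a::field set" where
  "trace0_star m = {x. x \<noteq> 0 \<and> abs_trace m x = 0}"

definition frob_class :: "nat \<Rightarrow> 'a::field \<Rightarrow> 'a set" where
  "frob_class m a = {a ^ (2 ^ i) | i. i < m}"

definition Delta :: "nat \<Rightarrow> 'a::field \<Rightarrow> (('a^3) set \<times> ('a^3) set) set" where
  "Delta m a = (\<Union>i\<in>frob_class m a. Gamma i)"

definition Delta_relations :: "nat \<Rightarrow> (('a::field^3) set \<times> ('a^3) set) set set" where
  "Delta_relations m = insert (Id_on exterior_lines) (Delta m ` trace0_star m)"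

section \<open>The group and its orbitals\<close>

definition field_automorphism :: "('a::field \<Rightarrow> 'a) \<Rightarrow> bool" where
  "field_automorphism \<sigma> \<longleftrightarrow>
     bij \<sigma> \<and> (\<forall>a b. \<sigma> (a + b) = \<sigma> a + \<sigma> b) \<and> (\<forall>a b. \<sigma> (a * b) = \<sigma> a * \<sigma> b)"

definition semilinear_bij :: "('a::field^3 \<Rightarrow> 'a^3) \<Rightarrow> bool" where
  "semilinear_bij f \<longleftrightarrow>
     bij f \<and> (\<forall>u v. f (u + v) = f u + f v) \<and>
     (\<exists>\<sigma>. field_automorphism \<sigma> \<and> (\<forall>c v. f (c *s v) = \<sigma> c *s f v))"

text \<open>The projective semilinear group of the plane, as the group of permutations of the set of
  subspaces induced by semilinear bijections (so that scalar maps act trivially).\<close>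

definition PGammaL3 :: "(('a::field^3) set \<Rightarrow> ('a^3) set) set" where
  "PGammaL3 = {restrict (image f) {U. vec.subspace U} | f. semilinear_bij f}"

text \<open>\<open>P\<Gamma>L(2,q)\<close> acts on the plane as the stabilizer of the conic in \<open>P\<Gamma>L(3,q)\<close>.\<close>

definition PGammaL2 :: "(('a::field^3) set \<Rightarrow> ('a^3) set) set" where
  "PGammaL2 = {g \<in> PGammaL3. g ` conic = conic}"

definition orbitals :: "('x \<Rightarrow> 'x) set \<Rightarrow> 'x set \<Rightarrow> ('x \<times> 'x) set set" where
  "orbitals G X = {{(g x, g y) | g. g \<in> G} | x y. x \<in> X \<and> y \<in> X}"

end

theory Submission
  imports Defs "HOL-Number_Theory.Cong"
begin

text \<open>The relations \<open>\<Gamma>\<^sub>a\<close> form a scheme with all valencies \<open>q + 1\<close>, and counting the \<open>n\<close> with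
  \<open>\<rho>(l, n) = \<rho>(n, l')\<close> gives \<open>q\<close> for all \<open>l \<noteq> l'\<close>; these two facts force every nontrivial primitive
  idempotent of its Bose-Mesner algebra to have trace \<open>q + 1\<close>. The Frobenius map \<open>\<pi>\<close> acts on that
  algebra with order \<open>m\<close>, and the algebra of the \<open>\<Delta>\<^sub>a\<close> consists of the fixed matrices. If a nontrivial
  primitive idempotent \<open>E\<close> were fixed by \<open>\<pi>\<close>, a 0-1 matrix \<open>U\<close> obtained by choosing one \<open>\<Gamma>\<^sub>a\<close> from
  each Frobenius orbit would satisfy \<open>m U E = - E\<close>, although \<open>det (1 + m U) \<equiv> 1 (mod m)\<close>. As \<open>m\<close> is prime,
  the nontrivial idempotents therefore fall into orbits of length \<open>m\<close>, and the orbit sums, of rank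
  \<open>m (q + 1)\<close>, are the nontrivial primitive idempotents of the fused algebra.

  The relations are handled through the form \<open>Q v = v\<^sub>1\<^sup>2 + v\<^sub>2 v\<^sub>3\<close> of the conic: \<open>\<rho>\<close> is the value of \<open>Q\<close> at
  the point of intersection of the two lines, in the scaling where the line equations take the value 1
  at the nucleus \<open>(1, 0, 0)\<close>.\<close>

section \<open>Real matrices\<close>

text \<open>The eigenvalues of the \<open>Gamma a\<close> are never computed; for a nontrivial
  primitive idempotent E only the sum of their squares is used. As all valencies are equal, the
  coefficients of E in the adjacency matrices are proportional to its eigenvalues, and E E = E
  becomes a linear equation for the trace. The same count for the relations \<open>Delta m a\<close>
  would compare the value at (l, n) with all conjugates of the value at (n, l'). Passing through the
  finer scheme avoids this, at the price of showing that no nontrivial idempotent stays fixed under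
  fusion. Both hypotheses on m give full orbits: the Frobenius map fixes only 0 and 1, and Tr 1 = 1
  for odd m, so it fixes nothing in \<open>trace0_star m\<close>, and for prime m every orbit there
  has m elements. Hence the m translates of U sum to J - I. J annihilates E, and on a fixed E all
  translates act alike; this is where m U E = - E comes from.\<close>

lemma matrix_diff_ldistrib: "A ** (B - C) = A ** B - A ** (C :: real^'n^'m)"
  by (simp add: matrix_matrix_mult_def vec_eq_iff sum_subtractf algebra_simps)

lemma matrix_diff_rdistrib: "(A - B) ** C = A ** C - B ** (C :: real^'n^'m)"
  by (simp add: matrix_matrix_mult_def vec_eq_iff sum_subtractf algebra_simps)

lemma matrix_add_rdistrib: "(A + B) ** C = A ** C + B ** (C :: real^'n^'m)"
  by (simp add: matrix_matrix_mult_def vec_eq_iff sum.distrib algebra_simps)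

lemma matrix_sum_rdistrib: "(\<Sum>i\<in>I. f i) ** C = (\<Sum>i\<in>I. f i ** (C :: real^'n^'m))"
  by (induction I rule: infinite_finite_induct) (auto simp: matrix_add_rdistrib)

lemma matrix_sum_ldistrib: "C ** (\<Sum>i\<in>I. f i) = (\<Sum>i\<in>I. C ** (f i :: real^'n^'m))"
  by (induction I rule: infinite_finite_induct) (auto simp: matrix_add_ldistrib)

text \<open>Multiplication by a symmetric matrix is self-adjoint for the entrywise inner product, so
  the matrix algebra itself can serve as the space in which eigenvectors are sought.\<close>

lemma inner_matrix_mult_symmetric:
  fixes A B C :: "real^'n^'n"
  assumes "transpose A = A"
  shows "(A ** B) \<bullet> C = B \<bullet> (A ** C)"
proof -
  have A: "A $ i $ j = A $ j $ i" for i j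
    using assms by (metis transpose_def vec_lambda_beta)
  have "(A ** B) \<bullet> C = (\<Sum>i\<in>UNIV. \<Sum>j\<in>UNIV. \<Sum>k\<in>UNIV. A$i$k * B$k$j * C$i$j)"
    by (simp add: inner_vec_def matrix_matrix_mult_def sum_distrib_right)
  also have "\<dots> = (\<Sum>k\<in>UNIV. \<Sum>j\<in>UNIV. \<Sum>i\<in>UNIV. A$i$k * B$k$j * C$i$j)"
    by (subst sum.swap, subst (2) sum.swap, subst (1) sum.swap) simp
  also have "\<dots> = B \<bullet> (A ** C)"
    by (simp add: inner_vec_def matrix_matrix_mult_def sum_distrib_left A mult_ac)
  finally show ?thesis .
qed

lemma trace_scaleR: "trace (c *\<^sub>R A) = c * trace (A :: real^'n^'n)"
  by (simp add: trace_def sum_distrib_left)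

lemma trace_matrix_mult_symmetric:
  fixes A B :: "real^'n^'n"
  assumes "transpose A = A"
  shows "trace (A ** B) = A \<bullet> B"
proof -
  have A: "A $ i $ j = A $ j $ i" for i j
    using assms by (metis transpose_def vec_lambda_beta)
  have "trace (A ** B) = (\<Sum>i\<in>UNIV. \<Sum>k\<in>UNIV. A$i$k * B$k$i)"
    by (simp add: trace_def matrix_matrix_mult_def)
  also have "\<dots> = (\<Sum>k\<in>UNIV. \<Sum>i\<in>UNIV. A$i$k * B$k$i)"
    by (rule sum.swap)
  also have "\<dots> = A \<bullet> B"
    by (simp add: inner_vec_def A)
  finally show ?thesis .
qed

text \<open>Such an E is the orthogonal projection onto its range: with an orthonormal basis B of
  the range, E is the sum of the b b^T, each of trace 1.\<close>

lemma rank_symmetric_idempotent: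
  fixes E :: "real^'n^'n"
  assumes sym: "transpose E = E" and idem: "E ** E = E"
  shows "real (rank E) = trace E"
proof -
  define S where "S = range (\<lambda>x. E *v x)"
  have "subspace S"
    unfolding S_def by (rule linear_subspace_image) (auto simp: matrix_vector_mul_linear)
  then obtain B where B: "B \<subseteq> S" "pairwise orthogonal B" "\<And>b. b \<in> B \<Longrightarrow> norm b = 1"
    "independent B" "card B = dim S" "span B = S"
    by (metis orthonormal_basis_subspace)
  have finB: "finite B"
    using B(4) finiteI_independent by blast
  have fixB: "E *v b = b" if "b \<in> S" for b
    using that idem by (auto simp: S_def matrix_vector_mul_assoc)
  have expand: "E *v x = (\<Sum>b\<in>B. (b \<bullet> x) *\<^sub>R b)" for x
  proof -
    let ?y = "\<Sum>b\<in>B. (b \<bullet> x) *\<^sub>R b"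
    have Ex: "E *v x \<in> S"
      by (auto simp: S_def)
    have y: "?y \<in> S"
      using \<open>subspace S\<close> B(1) by (intro subspace_sum subspace_scale) auto
    have "b \<bullet> (E *v x - ?y) = 0" if "b \<in> B" for b
    proof -
      have "b \<bullet> (E *v x) = (E *v b) \<bullet> x"
        by (metis dot_lmul_matrix sym transpose_matrix_vector)
      also have "\<dots> = b \<bullet> x"
        using fixB B(1) that by auto
      finally have 1: "b \<bullet> (E *v x) = b \<bullet> x" .
      have "b \<bullet> ?y = (\<Sum>c\<in>B. (c \<bullet> x) * (b \<bullet> c))"
        by (simp add: inner_sum_right)
      also have "\<dots> = (\<Sum>c\<in>B. if c = b then b \<bullet> x else 0)"
      proof (rule sum.cong)
        fix c assume c: "c \<in> B"
        show "(c \<bullet> x) * (b \<bullet> c) = (if c = b then b \<bullet> x else 0)"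
        proof (cases "c = b")
          case True
          then show ?thesis
            using B(3)[OF that] by (simp add: norm_eq_1)
        next
          case False
          then have "b \<bullet> c = 0"
            using B(2) c that unfolding pairwise_def orthogonal_def by auto
          with False show ?thesis by simp
        qed
      qed simp
      also have "\<dots> = b \<bullet> x"
        using finB that by simp
      finally show ?thesis
        using 1 by (simp add: inner_diff_right)
    qed
    then have orth: "orthogonal (E *v x - ?y) b" if "b \<in> B" for b
      using that by (simp add: orthogonal_def inner_commute)
    have "E *v x - ?y \<in> span B"
      using Ex y \<open>subspace S\<close> B(6) by (simp add: subspace_diff)
    then have "orthogonal (E *v x - ?y) (E *v x - ?y)"
      using orth orthogonal_to_span by blast
    then show ?thesis
      by (simp add: orthogonal_self)
  qed
  have diag: "E $ i $ i = (\<Sum>b\<in>B. b $ i * b $ i)" for i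
  proof -
    have "E $ i $ i = (E *v axis i 1) $ i"
      by (simp add: matrix_vector_mult_basis column_def)
    then show ?thesis
      by (simp add: expand inner_axis)
  qed
  have "trace E = (\<Sum>b\<in>B. \<Sum>i\<in>UNIV. b $ i * b $ i)"
    unfolding trace_def diag by (rule sum.swap)
  also have "\<dots> = (\<Sum>b\<in>B. b \<bullet> b)"
    by (simp add: inner_vec_def)
  also have "\<dots> = (\<Sum>b\<in>B. 1)"
    using B(3) by (intro sum.cong) (auto simp: norm_eq_1)
  also have "\<dots> = real (dim S)"
    using B(5) by simp
  finally show ?thesis
    by (simp add: rank_dim_range S_def)
qed

text \<open>A maximum of the Rayleigh quotient on \<open>S\<close> is attained at an eigenvector.\<close>

lemma self_adjoint_eigenvector:
  fixes f :: "'v::euclidean_space \<Rightarrow> 'v"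
  assumes "linear f" "subspace S" "S \<noteq> {0}" and S: "\<And>v. v \<in> S \<Longrightarrow> f v \<in> S"
    and adj: "\<And>v w. v \<in> S \<Longrightarrow> w \<in> S \<Longrightarrow> f v \<bullet> w = v \<bullet> f w"
  obtains v l where "v \<in> S" "v \<noteq> 0" "f v = l *\<^sub>R v"
proof -
  interpret f: linear f by fact
  let ?K = "S \<inter> sphere 0 1"
  have "compact ?K"
    using closed_subspace[OF \<open>subspace S\<close>] by (simp add: closed_Int_compact)
  moreover obtain u where "u \<in> S" "u \<noteq> 0"
    using \<open>S \<noteq> {0}\<close> subspace_0[OF \<open>subspace S\<close>] by blast
  then have "u /\<^sub>R norm u \<in> ?K"
    using \<open>subspace S\<close> by (simp add: subspace_scale)
  then have "?K \<noteq> {}" by blast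
  moreover have "continuous_on ?K (\<lambda>v. v \<bullet> f v)"
    using \<open>linear f\<close> by (intro continuous_intros linear_continuous_on) (simp add: linear_conv_bounded_linear)
  ultimately obtain v where v: "v \<in> ?K" and max: "\<And>w. w \<in> ?K \<Longrightarrow> w \<bullet> f w \<le> v \<bullet> f v"
    using continuous_attains_sup[of ?K "\<lambda>v. v \<bullet> f v"] by blast
  have vS: "v \<in> S" and vv: "v \<bullet> v = 1"
    using v by (auto simp: norm_eq_1)
  define l where "l = v \<bullet> f v"
  \<comment> \<open>By maximality the quadratic form of \<open>g\<close> is nonnegative on
    \<open>S\<close> and vanishes at \<open>v\<close>. Moving \<open>v\<close> along
    \<open>w = g v\<close> changes it to first order by 2 t |w|^2, which forces
    \<open>w = 0\<close>.\<close>
  define g where "g w = l *\<^sub>R w - f w" for w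
  have gS: "g w \<in> S" if "w \<in> S" for w
    using that S \<open>subspace S\<close> by (simp add: g_def subspace_diff subspace_scale)
  have nonneg: "w \<bullet> g w \<ge> 0" if "w \<in> S" for w
  proof (cases "w = 0")
    case False
    have "(w /\<^sub>R norm w) \<bullet> f (w /\<^sub>R norm w) \<le> l"
      unfolding l_def using that False \<open>subspace S\<close> by (intro max) (simp add: subspace_scale)
    then have "w \<bullet> f w / (norm w)\<^sup>2 \<le> l"
      by (simp add: f.scale power2_eq_square field_simps)
    then have "w \<bullet> f w \<le> l * (w \<bullet> w)"
      using False by (simp add: divide_le_eq power2_norm_eq_inner)
    then show ?thesis
      by (simp add: g_def inner_diff_right)
  qed simp
  define w where "w = g v"
  define b c where "b = w \<bullet> w" and "c = w \<bullet> g w"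
  have wS: "w \<in> S"
    using gS vS w_def by simp
  have vgv: "v \<bullet> g v = 0"
    by (simp add: g_def inner_diff_right vv l_def)
  have gw: "v \<bullet> g w = b"
  proof -
    have "v \<bullet> g w = g v \<bullet> w"
      using adj[OF vS wS] by (simp add: g_def inner_diff_right inner_diff_left)
    then show ?thesis by (simp add: w_def b_def)
  qed
  have quad: "0 \<le> 2 * t * b + t * t * c" for t
  proof -
    have "v + t *\<^sub>R w \<in> S"
      using vS wS \<open>subspace S\<close> by (simp add: subspace_add subspace_scale)
    then have "0 \<le> (v + t *\<^sub>R w) \<bullet> g (v + t *\<^sub>R w)"
      by (rule nonneg)
    also have "g (v + t *\<^sub>R w) = w + t *\<^sub>R g w"
      by (simp add: g_def w_def f.add f.diff f.scale algebra_simps)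
    also have "(v + t *\<^sub>R w) \<bullet> (w + t *\<^sub>R g w) = 2 * t * b + t * t * c"
      using vgv gw by (simp add: inner_add_left inner_add_right b_def c_def w_def[symmetric] algebra_simps)
    finally show ?thesis .
  qed
  have "b = 0"
  proof (rule ccontr)
    assume "b \<noteq> 0"
    then have "b > 0"
      by (simp add: b_def)
    have "c \<ge> 0"
      using nonneg[OF wS] by (simp add: c_def)
    \<comment> \<open>Chosen so that t c = b - t, which makes the form at -t equal to - t b - t^2.
      The denominator is c + 1 because c may be 0.\<close>
    define t where "t = b / (c + 1)"
    have "t > 0"
      using \<open>b > 0\<close> \<open>c \<ge> 0\<close> by (simp add: t_def)
    have "t * (c + 1) = b"
      using \<open>c \<ge> 0\<close> by (simp add: t_def)
    then have "t * c = b - t"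
      by (simp add: algebra_simps)
    have "0 \<le> 2 * (- t) * b + (- t) * (- t) * c"
      by (rule quad)
    also have "\<dots> = - 2 * t * b + t * (t * c)"
      by simp
    also have "\<dots> = - t * b - t * t"
      unfolding \<open>t * c = b - t\<close> by (simp add: algebra_simps)
    also have "\<dots> < 0"
      using mult_pos_pos[OF \<open>t > 0\<close> \<open>b > 0\<close>] mult_pos_pos[OF \<open>t > 0\<close> \<open>t > 0\<close>] by linarith
    finally show False by simp
  qed
  then have "f v = l *\<^sub>R v"
    by (simp add: b_def w_def g_def)
  with that vS vv show thesis
    by (metis inner_zero_left zero_neq_one)
qed

lemma det_1_plus_multiple:
  fixes U :: "real^'n^'n" and m :: nat
  assumes "m > 1" and "\<And>i j. U $ i $ j \<in> \<int>"
  shows "det (mat 1 + real m *\<^sub>R U) \<noteq> 0"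
proof -
  \<comment> \<open>The congruence modulo m needs integers, so the determinant is expanded for the
    integer matrix \<open>V\<close> and carried back by \<open>of_int\<close>.\<close>
  define u :: "int^'n^'n" where "u = (\<chi> i j. \<lfloor>U $ i $ j\<rfloor>)"
  define V :: "int^'n^'n" where "V = (\<chi> i j. (mat 1 :: int^'n^'n) $ i $ j + int m * u $ i $ j)"
  have U: "U $ i $ j = of_int (u $ i $ j)" for i j
    using assms(2)[of i j] by (auto simp: u_def elim!: Ints_cases)
  have "mat 1 + real m *\<^sub>R U = (\<chi> i j. of_int (V $ i $ j))"
    by (auto simp: vec_eq_iff V_def mat_def U)
  then have "det (mat 1 + real m *\<^sub>R U) = of_int (det V)"
    by (simp add: det_def)
  moreover have "[det V = det (mat 1 :: int^'n^'n)] (mod int m)"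
    unfolding det_def V_def
    by (intro cong_sum cong_mult cong_prod cong_refl) (auto simp: cong_iff_dvd_diff)
  then have "[det V = 1] (mod int m)"
    by (simp add: det_I)
  then have "det V \<noteq> 0"
    using \<open>m > 1\<close> by (auto simp: cong_iff_dvd_diff)
  ultimately show ?thesis by simp
qed

text \<open>The last hypothesis says that 1 + m U annihilates \<open>E\<close>, and this matrix is
  invertible.\<close>

lemma sum_scaled_integer_matrix_eigen:
  fixes U E :: "real^'n^'n" and m :: nat
  assumes "m > 1" and "\<And>i j. U $ i $ j \<in> \<int>" and "real m *\<^sub>R (U ** E) = - E"
  shows "E = 0"
proof -
  have "invertible (mat 1 + real m *\<^sub>R U)"
    using det_1_plus_multiple[OF assms(1,2)] by (simp add: invertible_det_nz)
  then obtain B where B: "B ** (mat 1 + real m *\<^sub>R U) = mat 1"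
    by (auto simp: invertible_def)
  have "(mat 1 + real m *\<^sub>R U) ** E = 0"
    using assms(3) by (simp add: matrix_add_rdistrib scalar_matrix_assoc[symmetric])
  then have "B ** (mat 1 + real m *\<^sub>R U) ** E = 0"
    by (simp add: matrix_mul_assoc[symmetric])
  then show ?thesis
    using B by simp
qed

section \<open>The Bose-Mesner algebra\<close>

lemma subspace_bose_mesner: "subspace (bose_mesner_algebra \<R>)"
  by (simp add: bose_mesner_algebra_def)

lemma adjacency_in_bose_mesner: "R \<in> \<R> \<Longrightarrow> adjacency_matrix R \<in> bose_mesner_algebra \<R>"
  by (simp add: bose_mesner_algebra_def span_base)

lemma bose_mesner_expansion:
  fixes M :: "real^'x^'x::finite"
  assumes part: "partition_on A \<R>"
    and const: "\<And>R p p'. R \<in> \<R> \<Longrightarrow> p \<in> R \<Longrightarrow> p' \<in> R \<Longrightarrow> M $ fst p $ snd p = M $ fst p' $ snd p'"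
    and zero: "\<And>x y. (x, y) \<notin> A \<Longrightarrow> M $ x $ y = 0"
    and c: "\<And>R x y. R \<in> \<R> \<Longrightarrow> (x, y) \<in> R \<Longrightarrow> c R = M $ x $ y"
  shows "M = (\<Sum>R\<in>\<R>. c R *\<^sub>R adjacency_matrix R)"
proof -
  have A: "A = \<Union>\<R>" and dis: "disjoint \<R>"
    using part by (auto simp: partition_on_def)
  show ?thesis
  proof (clarsimp simp: vec_eq_iff adjacency_matrix_def)
    fix x y
    show "M $ x $ y = (\<Sum>R\<in>\<R>. c R * (if (x, y) \<in> R then 1 else 0))"
    proof (cases "(x, y) \<in> A")
      case True
      then obtain R where R: "R \<in> \<R>" "(x, y) \<in> R"
        using A by blast
      have "(x, y) \<in> S \<longleftrightarrow> S = R" if "S \<in> \<R>" for S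
        using R that dis by (auto simp: pairwise_def disjnt_def)
      then have "(\<Sum>S\<in>\<R>. c S * (if (x, y) \<in> S then 1 else 0)) = (\<Sum>S\<in>\<R>. if S = R then c R else 0)"
        by (intro sum.cong) auto
      also have "\<dots> = c R"
        using R by simp
      finally show ?thesis
        using c[OF R] by simp
    next
      case False
      then have "(\<Sum>S\<in>\<R>. c S * (if (x, y) \<in> S then 1 else 0)) = 0"
        using A by (intro sum.neutral) auto
      with zero False show ?thesis by simp
    qed
  qed
qed

text \<open>Replaces membership in a span by a test on entries, which is how products, permuted
  matrices and the transversal are shown to lie in the algebra.\<close>

lemma bose_mesner_iff:
  fixes M :: "real^'x^'x::finite"
  assumes part: "partition_on A \<R>"
  shows "M \<in> bose_mesner_algebra \<R> \<longleftrightarrow>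
    (\<forall>R\<in>\<R>. \<forall>p\<in>R. \<forall>p'\<in>R. M $ fst p $ snd p = M $ fst p' $ snd p') \<and>
    (\<forall>x y. (x, y) \<notin> A \<longrightarrow> M $ x $ y = 0)" (is "_ \<longleftrightarrow> ?P M")
proof
  have A: "A = \<Union>\<R>" and dis: "disjoint \<R>"
    using part by (auto simp: partition_on_def)
  assume M: "M \<in> bose_mesner_algebra \<R>"
  have sub: "subspace {M. ?P M}"
  proof (rule subspaceI; unfold mem_Collect_eq)
    show "?P 0" by simp
  next
    fix M N assume M: "?P M" and N: "?P N"
    show "?P (M + N)"
    proof (intro conjI ballI allI impI)
      fix R p p' assume R: "R \<in> \<R>" "p \<in> R" "p' \<in> R"
      show "(M + N) $ fst p $ snd p = (M + N) $ fst p' $ snd p'"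
        using conjunct1[OF M, rule_format, OF R] conjunct1[OF N, rule_format, OF R] by simp
    qed (use M N in simp)
  next
    fix c M assume M: "?P M"
    show "?P (c *\<^sub>R M)"
    proof (intro conjI ballI allI impI)
      fix R p p' assume R: "R \<in> \<R>" "p \<in> R" "p' \<in> R"
      show "(c *\<^sub>R M) $ fst p $ snd p = (c *\<^sub>R M) $ fst p' $ snd p'"
        using conjunct1[OF M, rule_format, OF R] by simp
    qed (use M in simp)
  qed
  have gen: "?P (adjacency_matrix S)" if "S \<in> \<R>" for S
  proof (intro conjI ballI allI impI)
    fix R p p' assume R: "R \<in> \<R>" "p \<in> R" "p' \<in> R"
    have "(p \<in> S) = (p' \<in> S)"
      using R that dis unfolding pairwise_def disjnt_def by blast
    then show "adjacency_matrix S $ fst p $ snd p = adjacency_matrix S $ fst p' $ snd p'"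
      by (simp add: adjacency_matrix_def)
  next
    fix x y assume "(x, y) \<notin> A"
    then have "(x, y) \<notin> S"
      using A that by blast
    then show "adjacency_matrix S $ x $ y = 0"
      by (simp add: adjacency_matrix_def)
  qed
  have "span (adjacency_matrix ` \<R>) \<subseteq> {M. ?P M}"
    by (intro span_minimal image_subsetI CollectI gen sub)
  then show "?P M"
    using M unfolding bose_mesner_algebra_def by (rule subsetD[THEN CollectD])
next
  assume P: "?P M"
  define c where "c R = (let p = (SOME p. p \<in> R) in M $ fst p $ snd p)" for R
  have "c R = M $ x $ y" if "R \<in> \<R>" "(x, y) \<in> R" for R x y
  proof -
    have "(SOME p. p \<in> R) \<in> R"
      using that(2) by (rule someI)
    with P that show ?thesis
      by (metis c_def fst_conv snd_conv)
  qed
  then have "M = (\<Sum>R\<in>\<R>. c R *\<^sub>R adjacency_matrix R)"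
    using P by (intro bose_mesner_expansion[OF part]) blast+
  also have "\<dots> \<in> bose_mesner_algebra \<R>"
    by (intro subspace_sum subspace_scale subspace_bose_mesner adjacency_in_bose_mesner)
  finally show "M \<in> bose_mesner_algebra \<R>" .
qed

lemma adjacency_matrix_mult:
  "(adjacency_matrix R ** adjacency_matrix S) $ x $ y = real (card {z. (x, z) \<in> R \<and> (z, y) \<in> S})"
proof -
  have "(adjacency_matrix R ** adjacency_matrix S) $ x $ y =
      (\<Sum>z\<in>UNIV. if (x, z) \<in> R \<and> (z, y) \<in> S then 1 else 0)"
    unfolding matrix_matrix_mult_def adjacency_matrix_def by (auto intro!: sum.cong)
  also have "\<dots> = real (card {z. (x, z) \<in> R \<and> (z, y) \<in> S})"
    by (simp flip: sum.inter_filter)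
  finally show ?thesis .
qed

section \<open>The algebra of a scheme: closure under products and commutativity\<close>

locale scheme =
  fixes X :: "'x::finite set" and \<R> :: "('x \<times> 'x) set set"
  assumes scheme: "association_scheme X \<R>"
begin

abbreviation "\<A> \<equiv> bose_mesner_algebra \<R>"
abbreviation "I \<equiv> adjacency_matrix (Id_on X)"
abbreviation "E0 \<equiv> trivial_idempotent X"

lemma X_nonempty: "X \<noteq> {}"
  and part: "partition_on (X \<times> X) \<R>"
  and Id_mem: "Id_on X \<in> \<R>"
  and rel_sym: "R \<in> \<R> \<Longrightarrow> sym R"
  using scheme by (auto simp: association_scheme_def)

lemma rel_subset: "R \<in> \<R> \<Longrightarrow> R \<subseteq> X \<times> X"
  using part by (auto simp: partition_on_def)

lemma zero_outside: "M \<in> \<A> \<Longrightarrow> (x, y) \<notin> X \<times> X \<Longrightarrow> M $ x $ y = 0"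
  using bose_mesner_iff[OF part] by blast

lemma const_on_rel: "M \<in> \<A> \<Longrightarrow> R \<in> \<R> \<Longrightarrow> (x, y) \<in> R \<Longrightarrow> (x', y') \<in> R \<Longrightarrow> M $ x $ y = M $ x' $ y'"
  using bose_mesner_iff[OF part] by (metis fst_conv snd_conv)

lemma sum_closed: "(\<And>i. i \<in> J \<Longrightarrow> f i \<in> \<A>) \<Longrightarrow> (\<Sum>i\<in>J. f i) \<in> \<A>"
  and scale_closed: "M \<in> \<A> \<Longrightarrow> c *\<^sub>R M \<in> \<A>"
  and diff_closed: "M \<in> \<A> \<Longrightarrow> N \<in> \<A> \<Longrightarrow> M - N \<in> \<A>"
  and add_closed: "M \<in> \<A> \<Longrightarrow> N \<in> \<A> \<Longrightarrow> M + N \<in> \<A>"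
  and zero_closed: "0 \<in> \<A>"
  by (simp_all add: subspace_sum subspace_scale subspace_diff subspace_add subspace_0 subspace_bose_mesner)

lemma transpose_eq: assumes "M \<in> \<A>" shows "transpose M = M"
proof -
  have "M $ x $ y = M $ y $ x" for x y
  proof (cases "(x, y) \<in> X \<times> X")
    case True
    then obtain R where "R \<in> \<R>" "(x, y) \<in> R"
      using part by (auto simp: partition_on_def)
    then show ?thesis
      using const_on_rel[OF assms] rel_sym by (meson symD)
  next
    case False
    then show ?thesis
      using zero_outside[OF assms] by (metis mem_Sigma_iff)
  qed
  then show ?thesis
    by (simp add: transpose_def vec_eq_iff)
qed

lemma adjacency_mult_closed:
  assumes "R \<in> \<R>" "S \<in> \<R>"
  shows "adjacency_matrix R ** adjacency_matrix S \<in> \<A>"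
  unfolding bose_mesner_iff[OF part]
proof (intro conjI allI ballI impI)
  fix T p p' assume T: "T \<in> \<R>" "p \<in> T" "p' \<in> T"
  obtain k where "\<forall>(x, y)\<in>T. card {z. (x, z) \<in> R \<and> (z, y) \<in> S} = k"
    using scheme assms T unfolding association_scheme_def by blast
  with T show "(adjacency_matrix R ** adjacency_matrix S) $ fst p $ snd p =
      (adjacency_matrix R ** adjacency_matrix S) $ fst p' $ snd p'"
    by (auto simp: adjacency_matrix_mult split: prod.splits)
next
  fix x y assume "(x, y) \<notin> X \<times> X"
  then have "{z. (x, z) \<in> R \<and> (z, y) \<in> S} = {}"
    using rel_subset assms by blast
  then show "(adjacency_matrix R ** adjacency_matrix S) $ x $ y = 0"
    by (simp only: adjacency_matrix_mult) simp
qed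

lemma mult_closed:
  assumes "M \<in> \<A>" "N \<in> \<A>"
  shows "M ** N \<in> \<A>"
proof -
  have 1: "adjacency_matrix R ** N \<in> \<A>" if "R \<in> \<R>" for R
  proof -
    have "N \<in> span (adjacency_matrix ` \<R>)"
      using assms(2) by (simp add: bose_mesner_algebra_def)
    then show ?thesis
    proof (induction rule: span_induct_alt)
      case (step c x y)
      then show ?case
        using adjacency_mult_closed[OF that]
        by (auto simp: matrix_add_ldistrib matrix_scalar_ac scalar_matrix_assoc[symmetric]
            intro!: add_closed scale_closed)
    qed (simp add: zero_closed)
  qed
  have "M \<in> span (adjacency_matrix ` \<R>)"
    using assms(1) by (simp add: bose_mesner_algebra_def)
  then show ?thesis
  proof (induction rule: span_induct_alt)
    case (step c x y)
    then show ?case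
      using 1 by (auto simp: matrix_add_rdistrib scalar_matrix_assoc[symmetric]
          intro!: add_closed scale_closed)
  qed (simp add: zero_closed)
qed

text \<open>Products stay in the algebra and are therefore symmetric, while transposition reverses
  the factors.\<close>

lemma mult_commute:
  assumes "M \<in> \<A>" "N \<in> \<A>"
  shows "M ** N = N ** M"
proof -
  have "M ** N = transpose (M ** N)"
    using mult_closed[OF assms] transpose_eq by simp
  also have "\<dots> = N ** M"
    using assms by (simp add: matrix_transpose_mul transpose_eq)
  finally show ?thesis .
qed

lemma E0_mem: "E0 \<in> \<A>"
  unfolding bose_mesner_iff[OF part]
proof (intro conjI allI ballI impI)
  fix R p p' assume "R \<in> \<R>" "p \<in> R" "p' \<in> R"
  then have "p \<in> X \<times> X" "p' \<in> X \<times> X"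
    using rel_subset by blast+
  then show "E0 $ fst p $ snd p = E0 $ fst p' $ snd p'"
    by (simp add: trivial_idempotent_def mem_Times_iff)
qed (auto simp: trivial_idempotent_def)

lemma I_mult: assumes "M \<in> \<A>" shows "I ** M = M"
proof -
  have "(I ** M) $ x $ y = M $ x $ y" for x y
  proof -
    have "(I ** M) $ x $ y = (\<Sum>z\<in>UNIV. I $ x $ z * M $ z $ y)"
      by (simp add: matrix_matrix_mult_def)
    also have "\<dots> = (\<Sum>z\<in>UNIV. if z = x then (if x \<in> X then M $ x $ y else 0) else 0)"
      by (intro sum.cong) (auto simp: adjacency_matrix_def)
    also have "\<dots> = M $ x $ y"
      using zero_outside[OF assms, of x y] by auto
    finally show ?thesis .
  qed
  then show ?thesis by (simp add: vec_eq_iff)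
qed

lemma E0_idem: "E0 ** E0 = E0"
proof -
  have "(E0 ** E0) $ x $ y = E0 $ x $ y" for x y
  proof -
    have "(E0 ** E0) $ x $ y =
      (\<Sum>z\<in>UNIV. if z \<in> X then (if x \<in> X \<and> y \<in> X then 1 / (real (card X))\<^sup>2 else 0) else 0)"
      unfolding matrix_matrix_mult_def trivial_idempotent_def
      by (auto intro!: sum.cong simp: power2_eq_square)
    also have "\<dots> = E0 $ x $ y"
      using X_nonempty by (simp add: trivial_idempotent_def power2_eq_square card_gt_0_iff flip: sum.inter_filter)
    finally show ?thesis .
  qed
  then show ?thesis by (simp add: vec_eq_iff)
qed

lemma E0_nonzero: "E0 \<noteq> 0"
proof
  obtain x where "x \<in> X"
    using X_nonempty by blast
  assume "E0 = 0"
  then have "E0 $ x $ x = 0" by simp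
  with \<open>x \<in> X\<close> show False
    by (auto simp: trivial_idempotent_def)
qed

text \<open>On \<open>X\<close> the entries of \<open>E0 ** M\<close> depend only on the column,
  those of \<open>M ** E0\<close> only on the row. The two products agree, so they are constant
  there.\<close>

lemma E0_mult:
  assumes "M \<in> \<A>"
  obtains c where "E0 ** M = c *\<^sub>R E0"
proof -
  have l: "(E0 ** M) $ x $ y = (\<Sum>z\<in>X. M $ z $ y) / card X" if "x \<in> X" "y \<in> X" for x y
  proof -
    have "(E0 ** M) $ x $ y = (\<Sum>z\<in>UNIV. if z \<in> X then M $ z $ y / card X else 0)"
      unfolding matrix_matrix_mult_def trivial_idempotent_def using that by (auto intro!: sum.cong)
    then show ?thesis
      by (simp add: sum_divide_distrib flip: sum.inter_filter)
  qed
  have r: "(M ** E0) $ x $ y = (\<Sum>z\<in>X. M $ x $ z) / card X" if "x \<in> X" "y \<in> X" for x y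
  proof -
    have "(M ** E0) $ x $ y = (\<Sum>z\<in>UNIV. if z \<in> X then M $ x $ z / card X else 0)"
      unfolding matrix_matrix_mult_def trivial_idempotent_def using that by (auto intro!: sum.cong)
    then show ?thesis
      by (simp add: sum_divide_distrib flip: sum.inter_filter)
  qed
  obtain a where "a \<in> X"
    using X_nonempty by blast
  have "(E0 ** M) $ x $ y = (E0 ** M) $ a $ a" if "x \<in> X" "y \<in> X" for x y
  proof -
    have "(E0 ** M) $ x $ y = (E0 ** M) $ a $ y"
      using l[OF that] l[OF \<open>a \<in> X\<close> that(2)] by simp
    also have "\<dots> = (M ** E0) $ a $ y"
      by (simp add: mult_commute[OF E0_mem assms])
    also have "\<dots> = (M ** E0) $ a $ a"
      using r[OF \<open>a \<in> X\<close> that(2)] r[OF \<open>a \<in> X\<close> \<open>a \<in> X\<close>] by simp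
    also have "\<dots> = (E0 ** M) $ a $ a"
      by (simp add: mult_commute[OF E0_mem assms])
    finally show ?thesis .
  qed
  moreover have "(E0 ** M) $ x $ y = 0" if "\<not> (x \<in> X \<and> y \<in> X)" for x y
    using zero_outside[OF mult_closed[OF E0_mem assms]] that by auto
  ultimately have "E0 ** M = (card X * (E0 ** M) $ a $ a) *\<^sub>R E0"
    using X_nonempty by (auto simp: vec_eq_iff trivial_idempotent_def card_gt_0_iff)
  then show thesis by (rule that)
qed

section \<open>Primitive idempotents: splitting, eigenvalues, traces\<close>

abbreviation "primitive \<equiv> primitive_idempotent \<A>"

lemma primitiveD:
  assumes "primitive E"
  shows "E \<in> \<A>" "E \<noteq> 0" "E ** E = E"
  using assms by (auto simp: primitive_idempotent_def)

lemma primitive_split: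
  assumes "primitive E" "F \<in> \<A>" "G \<in> \<A>" "F ** F = F" "G ** G = G" "F ** G = 0" "E = F + G"
  shows "F = 0 \<or> G = 0"
  using assms mult_commute[of F G] unfolding primitive_idempotent_def by metis

text \<open>By commutativity \<open>G ** E\<close> and \<open>E - G ** E\<close> are orthogonal
  idempotents with sum \<open>E\<close>, so one of them is zero.\<close>

lemma primitive_mult_idempotent:
  assumes E: "primitive E" and G: "G \<in> \<A>" "G ** G = G"
  shows "G ** E = 0 \<or> G ** E = E"
proof -
  note E' = primitiveD[OF E]
  let ?F = "G ** E"
  have comm: "E ** G = G ** E"
    by (rule mult_commute) (use E' G in auto)
  have F: "?F \<in> \<A>"
    using E' G by (simp add: mult_closed)
  have idem: "?F ** ?F = ?F"
    by (metis E'(3) G(2) comm matrix_mul_assoc)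
  have EF: "E ** ?F = ?F" and FE: "?F ** E = ?F"
    by (metis E'(3) comm matrix_mul_assoc)+
  have "?F = 0 \<or> E - ?F = 0"
    by (rule primitive_split[OF E F])
      (use E' F in \<open>auto intro!: diff_closed simp: matrix_diff_ldistrib matrix_diff_rdistrib idem EF FE\<close>)
  then show ?thesis by auto
qed

lemma primitive_mult_E0:
  assumes E: "primitive E" and "E \<noteq> E0"
  shows "E0 ** E = 0"
proof (rule ccontr)
  assume "E0 ** E \<noteq> 0"
  then have 1: "E0 ** E = E"
    using primitive_mult_idempotent[OF E E0_mem E0_idem] by blast
  obtain c where "E0 ** E = c *\<^sub>R E0"
    by (rule E0_mult[OF primitiveD(1)[OF E]])
  with 1 have c: "E = c *\<^sub>R E0" by simp
  then have "(c * c) *\<^sub>R E0 = c *\<^sub>R E0"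
    using primitiveD(3)[OF E] by (simp add: matrix_scalar_ac scalar_matrix_assoc[symmetric] E0_idem)
  then have "c * c = c"
    using E0_nonzero by (metis scaleR_cancel_right)
  then have "c = 0 \<or> c = 1" by simp
  with c \<open>E \<noteq> E0\<close> primitiveD(2)[OF E] show False by auto
qed

text \<open>The Y with \<open>E ** Y = Y\<close> form an ideal on which multiplication by
  \<open>M\<close> is self-adjoint, so it has an eigenvector there. The eigenspace K is again an
  ideal, and the orthogonal projection of \<open>E\<close> to K is an idempotent; by primitivity it
  is \<open>E\<close> itself.\<close>

lemma primitive_eigenvalue:
  assumes E: "primitive E" and M: "M \<in> \<A>"
  obtains l where "M ** E = l *\<^sub>R E"
proof -
  note E' = primitiveD[OF E]
  define S where "S = {Y \<in> \<A>. E ** Y = Y}"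
  have "subspace S"
    unfolding S_def subspace_def
    by (auto simp: zero_closed matrix_add_ldistrib matrix_scalar_ac scalar_matrix_assoc[symmetric]
        intro!: add_closed scale_closed)
  moreover have "S \<noteq> {0}"
    using E' by (auto simp: S_def)
  moreover have "M ** Y \<in> S" if "Y \<in> S" for Y
  proof -
    have "Y \<in> \<A>" and Y: "E ** Y = Y"
      using that by (auto simp: S_def)
    moreover have "E ** (M ** Y) = M ** (E ** Y)"
      by (simp only: matrix_mul_assoc mult_commute[OF E'(1) M])
    ultimately show ?thesis
      using M by (simp add: S_def mult_closed)
  qed
  moreover have "linear (\<lambda>Y. M ** Y)"
    by (rule linearI) (auto simp: matrix_add_ldistrib matrix_scalar_ac scalar_matrix_assoc)
  ultimately obtain V l where V: "V \<in> S" "V \<noteq> 0" "M ** V = l *\<^sub>R V"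
    using self_adjoint_eigenvector[of "\<lambda>Y. M ** Y" S]
      inner_matrix_mult_symmetric[OF transpose_eq[OF M]] by metis
  define N where "N = M - l *\<^sub>R E"
  have N: "N \<in> \<A>"
    using E' M by (simp add: N_def diff_closed scale_closed)
  have NV: "N ** V = 0"
    using V(1,3) by (simp add: N_def matrix_diff_rdistrib scalar_matrix_assoc[symmetric] S_def)
  define K where "K = {Y \<in> S. N ** Y = 0}"
  have subK: "subspace K"
    using \<open>subspace S\<close> unfolding K_def subspace_def
    by (auto simp: matrix_add_ldistrib matrix_scalar_ac scalar_matrix_assoc[symmetric])
  have ideal: "Y ** Z \<in> K" if "Y \<in> K" "Z \<in> \<A>" for Y Z
    using that by (auto simp: K_def S_def mult_closed matrix_mul_assoc)
  obtain e f where ef: "e \<in> span K" "\<And>w. w \<in> span K \<Longrightarrow> orthogonal f w" "E = e + f"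
    by (metis orthogonal_subspace_decomp_exists)
  have spanK: "span K = K"
    using subK by (simp add: span_eq_iff)
  have e: "e \<in> K"
    using ef(1) unfolding spanK .
  have orth: "f \<bullet> w = 0" if "w \<in> K" for w
    using ef(2) that unfolding spanK orthogonal_def .
  from e have eA: "e \<in> \<A>" and Ee: "E ** e = e"
    by (auto simp: K_def S_def)
  have f_eq: "f = E - e"
    using ef(3) by simp
  then have fA: "f \<in> \<A>"
    using E' eA by (simp add: diff_closed)
  have fE: "E ** f = f"
    using f_eq E' Ee by (simp add: matrix_diff_ldistrib)
  have fK: "f ** Y = 0" if "Y \<in> K" for Y
  proof -
    have YA: "Y \<in> \<A>"
      using that by (simp add: K_def S_def)
    have "f ** Y = Y ** f"
      using fA YA by (rule mult_commute)
    then have inK: "f ** Y \<in> K"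
      by (rule ssubst) (rule ideal[OF that fA])
    \<comment> \<open>Self-adjointness moves one factor \<open>Y\<close> to the right, producing an
      element of the ideal \<open>K\<close>, to which \<open>f\<close> is orthogonal; so the norm of
      \<open>f ** Y\<close> is 0.\<close>
    have "(f ** Y) \<bullet> (f ** Y) = f \<bullet> (Y ** (f ** Y))"
      unfolding \<open>f ** Y = Y ** f\<close>
      by (rule inner_matrix_mult_symmetric[OF transpose_eq[OF YA]])
    also have "Y ** (f ** Y) \<in> K"
      using ideal[OF that mult_closed[OF fA YA]] .
    then have "f \<bullet> (Y ** (f ** Y)) = 0"
      by (rule orth)
    finally show ?thesis by simp
  qed
  have fe: "f ** e = 0" "e ** f = 0"
    using fK[OF e] mult_commute[OF eA fA] by auto
  have "e ** e = E ** e - f ** e"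
    by (simp add: f_eq matrix_diff_rdistrib)
  then have ee: "e ** e = e"
    by (simp add: Ee fe)
  have "f ** f = E ** f - e ** f"
    by (simp add: f_eq matrix_diff_rdistrib)
  then have ff: "f ** f = f"
    by (simp add: fE fe)
  have "e = 0 \<or> f = 0"
    by (rule primitive_split[OF E eA fA ee ff fe(2) ef(3)])
  moreover have "e \<noteq> 0"
  proof
    assume "e = 0"
    then have "E ** V = f ** V"
      using ef(3) by simp
    also have "\<dots> = 0"
      using V(1) NV by (intro fK) (simp add: K_def)
    finally show False
      using V by (simp add: S_def)
  qed
  ultimately have "E \<in> K"
    using ef(3) e by auto
  then have "M ** E = l *\<^sub>R E"
    using E' by (simp add: K_def N_def matrix_diff_rdistrib scalar_matrix_assoc[symmetric])
  then show thesis by (rule that)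
qed

lemma primitive_orthogonal:
  assumes "primitive E" "primitive F" "E \<noteq> F"
  shows "E ** F = 0"
proof (rule ccontr)
  assume "E ** F \<noteq> 0"
  moreover have "E ** F = 0 \<or> E ** F = F"
    using assms by (simp add: primitive_mult_idempotent primitiveD)
  moreover have "F ** E = 0 \<or> F ** E = E"
    using assms by (simp add: primitive_mult_idempotent primitiveD)
  moreover have "E ** F = F ** E"
    using assms by (simp add: mult_commute primitiveD)
  ultimately show False
    using assms by simp
qed

lemma idempotent_trace:
  assumes "E \<in> \<A>" "E ** E = E"
  shows "real (rank E) = trace E" "trace E = E \<bullet> E"
  using assms rank_symmetric_idempotent[of E] trace_matrix_mult_symmetric[of E E]
  by (auto simp: transpose_eq)

text \<open>Splitting a non-primitive idempotent into G + H lowers the rank, because on idempotents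
  rank is trace, and the trace of H is its squared norm.\<close>

lemma primitive_below_idempotent:
  assumes "F \<in> \<A>" "F \<noteq> 0" "F ** F = F"
  shows "\<exists>E. primitive E \<and> E ** F = E"
  using assms
proof (induction "rank F" arbitrary: F rule: less_induct)
  case less
  show ?case
  proof (cases "primitive F")
    case True
    with less.prems show ?thesis by blast
  next
    case False
    then obtain G H where GH: "G \<in> \<A>" "H \<in> \<A>" "G \<noteq> 0" "H \<noteq> 0" "G ** G = G" "H ** H = H"
      "G ** H = 0" "H ** G = 0" "F = G + H"
      using less.prems unfolding primitive_idempotent_def by metis
    have "trace F = trace G + H \<bullet> H"
      using GH by (simp add: trace_add idempotent_trace)
    also have "\<dots> > trace G"
      using GH by simp
    finally have "rank G < rank F"
      using idempotent_trace(1)[of G] idempotent_trace(1)[of F] GH less.prems by linarith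
    then obtain E where E: "primitive E" "E ** G = E"
      using less.hyps GH by blast
    have "E ** H = E ** (G ** H)"
      by (simp add: matrix_mul_assoc E)
    then have "E ** F = E"
      using GH E by (simp add: matrix_add_ldistrib)
    then show ?thesis
      using E by blast
  qed
qed

end

section \<open>Multiplicities\<close>

context scheme
begin

text \<open>If all valencies equal \<open>k\<close>, the second hypothesis says that the squares of the nontrivial
  adjacency matrices sum to \<open>(k - 1) J + (n - k) I\<close>; comparing its eigenvalue on \<open>E\<close> with the
  expansion of \<open>E\<close> in adjacency matrices determines the trace of \<open>E\<close>.\<close>

lemma primitive_trace:
  assumes "k > 0"
    and val: "\<And>R x. R \<in> \<R> \<Longrightarrow> R \<noteq> Id_on X \<Longrightarrow> x \<in> X \<Longrightarrow> card {z. (x, z) \<in> R} = k"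
    and count: "\<And>x y. x \<in> X \<Longrightarrow> y \<in> X \<Longrightarrow> x \<noteq> y \<Longrightarrow>
      (\<Sum>R\<in>\<R> - {Id_on X}. card {z. (x, z) \<in> R \<and> (z, y) \<in> R}) = k - 1"
    and E: "primitive E" "E \<noteq> E0"
  shows "trace E = real k"
proof -
  note E' = primitiveD[OF E(1)]
  define n where "n = card X"
  have "n > 0"
    using X_nonempty by (simp add: n_def card_gt_0_iff)
  let ?R' = "\<R> - {Id_on X}"
  define Q where "Q = (\<Sum>R\<in>?R'. adjacency_matrix R ** adjacency_matrix R)"
  have disj: "R = S" if "R \<in> \<R>" "S \<in> \<R>" "p \<in> R" "p \<in> S" for R S p
    using that part unfolding partition_on_def pairwise_def disjnt_def by blast
  have Q: "Q $ x $ y = real (\<Sum>R\<in>?R'. card {z. (x, z) \<in> R \<and> (z, y) \<in> R})" for x y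
    by (simp add: Q_def adjacency_matrix_mult)
  have diag: "(\<Sum>R\<in>?R'. card {z. (x, z) \<in> R \<and> (z, x) \<in> R}) = n - 1" if "x \<in> X" for x
  proof -
    have "(\<Sum>R\<in>?R'. card {z. (x, z) \<in> R \<and> (z, x) \<in> R}) = (\<Sum>R\<in>?R'. card {z. (x, z) \<in> R})"
      using rel_sym by (intro sum.cong refl arg_cong[where f = card]) (auto dest: symD)
    also have "\<dots> = card (\<Union>R\<in>?R'. {z. (x, z) \<in> R})"
      using disj by (intro card_UN_disjoint[symmetric]) auto
    also have "(\<Union>R\<in>?R'. {z. (x, z) \<in> R}) = X - {x}"
    proof (intro equalityI subsetI)
      fix z assume "z \<in> (\<Union>R\<in>?R'. {z. (x, z) \<in> R})"
      then obtain R where R: "R \<in> \<R>" "R \<noteq> Id_on X" "(x, z) \<in> R" by auto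
      then have "z \<noteq> x"
        using disj[OF R(1) Id_mem R(3)] that by auto
      with R rel_subset show "z \<in> X - {x}" by blast
    next
      fix z assume z: "z \<in> X - {x}"
      then obtain R where R: "R \<in> \<R>" "(x, z) \<in> R"
        using part \<open>x \<in> X\<close> unfolding partition_on_def by (metis DiffD1 SigmaI UnionE)
      moreover have "R \<noteq> Id_on X"
        using R z by auto
      ultimately show "z \<in> (\<Union>R\<in>?R'. {z. (x, z) \<in> R})" by auto
    qed
    finally show ?thesis
      using that by (simp add: n_def)
  qed
  \<comment> \<open>n times \<open>E0\<close> is the all-ones matrix on \<open>X\<close>. Off the
    diagonal the entries are k - 1, on it n - 1 = (k - 1) + (n - k).\<close>
  have "Q = ((real k - 1) * real n) *\<^sub>R E0 + (real n - real k) *\<^sub>R I"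
  proof (simp only: vec_eq_iff, intro allI)
    fix x y
    consider "x \<in> X" "y = x" | "x \<in> X" "y \<in> X" "x \<noteq> y" | "(x, y) \<notin> X \<times> X" by blast
    then show "Q $ x $ y = (((real k - 1) * real n) *\<^sub>R E0 + (real n - real k) *\<^sub>R I) $ x $ y"
    proof cases
      case 1
      then have "Q $ x $ y = real (n - 1)"
        by (simp only: Q diag)
      then show ?thesis
        using 1 \<open>n > 0\<close> by (simp add: adjacency_matrix_def trivial_idempotent_def n_def[symmetric] of_nat_diff Suc_leI Id_on_iff)
    next
      case 2
      have "Q $ x $ y = real (k - 1)"
        unfolding Q count[OF 2] ..
      then show ?thesis
        using 2 \<open>n > 0\<close> \<open>k > 0\<close> by (simp add: adjacency_matrix_def trivial_idempotent_def n_def[symmetric] of_nat_diff Suc_leI Id_on_iff)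
    next
      case 3
      then have "{z. (x, z) \<in> R \<and> (z, y) \<in> R} = {}" if "R \<in> ?R'" for R
        using rel_subset that by blast
      then have "(\<Sum>R\<in>?R'. card {z. (x, z) \<in> R \<and> (z, y) \<in> R}) = 0"
        by simp
      then have "Q $ x $ y = 0"
        by (simp only: Q of_nat_0)
      moreover have "E0 $ x $ y = 0" "I $ x $ y = 0"
        using 3 by (auto simp: adjacency_matrix_def trivial_idempotent_def)
      ultimately show ?thesis by simp
    qed
  qed
  then have QE: "Q ** E = (real n - real k) *\<^sub>R E"
    using primitive_mult_E0[OF E] I_mult[OF E'(1)]
    by (simp add: matrix_add_rdistrib scalar_matrix_assoc[symmetric])
  have "\<forall>R\<in>\<R>. \<exists>l. adjacency_matrix R ** E = l *\<^sub>R E"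
    using primitive_eigenvalue[OF E(1)] adjacency_in_bose_mesner by metis
  then obtain P where P: "\<And>R. R \<in> \<R> \<Longrightarrow> adjacency_matrix R ** E = P R *\<^sub>R E"
    by metis
  have "Q ** E = (\<Sum>R\<in>?R'. adjacency_matrix R ** (adjacency_matrix R ** E))"
    by (simp add: Q_def matrix_sum_rdistrib matrix_mul_assoc)
  also have "\<dots> = (\<Sum>R\<in>?R'. (P R * P R) *\<^sub>R E)"
    by (intro sum.cong) (auto simp: P matrix_scalar_ac scalar_matrix_assoc[symmetric])
  finally have "(\<Sum>R\<in>?R'. P R * P R) *\<^sub>R E = (real n - real k) *\<^sub>R E"
    using QE by (simp add: scaleR_sum_left)
  then have sumP: "(\<Sum>R\<in>?R'. P R * P R) = real n - real k"
    using E'(2) by (simp only: scaleR_cancel_right) auto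
  define c where "c R = (let p = (SOME p. p \<in> R) in E $ fst p $ snd p)" for R
  have c: "c R = E $ x $ y" if "R \<in> \<R>" "(x, y) \<in> R" for R x y
  proof -
    have "(SOME p. p \<in> R) \<in> R"
      using that(2) by (rule someI)
    with that show ?thesis
      unfolding c_def Let_def by (intro const_on_rel[OF E'(1)]) auto
  qed
  define t where "t = trace E"
  have c0: "real n * c (Id_on X) = t"
  proof -
    have "t = (\<Sum>x\<in>UNIV. if x \<in> X then c (Id_on X) else 0)"
      unfolding t_def trace_def using c[OF Id_mem Id_onI] zero_outside[OF E'(1)] by (intro sum.cong) auto
    then show ?thesis
      by (simp add: n_def flip: sum.inter_filter)
  qed
  \<comment> \<open>Two evaluations of the trace of A_R E: the eigenvalue \<open>P R\<close> times
    \<open>t\<close>, and the entry \<open>c R\<close> summed over the n k pairs in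
    \<open>R\<close>.\<close>
  have cR: "real n * real k * c R = P R * t" if "R \<in> ?R'" for R
  proof -
    have R: "R \<in> \<R>" "R \<noteq> Id_on X"
      using that by auto
    have "P R * t = trace (adjacency_matrix R ** E)"
      by (simp add: P R trace_scaleR t_def)
    also have "\<dots> = adjacency_matrix R \<bullet> E"
      using R by (intro trace_matrix_mult_symmetric transpose_eq adjacency_in_bose_mesner)
    also have "\<dots> = (\<Sum>x\<in>UNIV. if x \<in> X then real k * c R else 0)"
      unfolding inner_vec_def
    proof (intro sum.cong refl)
      fix x
      have "(\<Sum>y\<in>UNIV. adjacency_matrix R $ x $ y \<bullet> E $ x $ y) = (\<Sum>y\<in>{y. (x, y) \<in> R}. c R)"
        using c[OF R(1)] by (intro sum.mono_neutral_cong_right) (auto simp: adjacency_matrix_def)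
      also have "\<dots> = (if x \<in> X then real k * c R else 0)"
        using val[OF R] rel_subset[OF R(1)] by (auto simp: subset_iff)
      finally show "(\<Sum>y\<in>UNIV. adjacency_matrix R $ x $ y \<bullet> E $ x $ y) = (if x \<in> X then real k * c R else 0)" .
    qed
    also have "\<dots> = real n * real k * c R"
      by (simp add: n_def flip: sum.inter_filter)
    finally show ?thesis by simp
  qed
  have "E = (\<Sum>R\<in>\<R>. c R *\<^sub>R adjacency_matrix R)"
    by (rule bose_mesner_expansion[OF part]) (auto intro: const_on_rel[OF E'(1)] zero_outside[OF E'(1)] c)
  also have "\<dots> = c (Id_on X) *\<^sub>R I + (\<Sum>R\<in>?R'. c R *\<^sub>R adjacency_matrix R)"
    using Id_mem by (simp add: sum.remove)
  finally have "E ** E = (c (Id_on X) *\<^sub>R I + (\<Sum>R\<in>?R'. c R *\<^sub>R adjacency_matrix R)) ** E"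
    by (rule arg_cong)
  also have "\<dots> = c (Id_on X) *\<^sub>R E + (\<Sum>R\<in>?R'. (c R * P R) *\<^sub>R E)"
    using P by (simp add: matrix_add_rdistrib matrix_sum_rdistrib scalar_matrix_assoc[symmetric] I_mult E'(1))
  finally have "(c (Id_on X) + (\<Sum>R\<in>?R'. c R * P R)) *\<^sub>R E = 1 *\<^sub>R E"
    using E'(3) by (simp add: scaleR_add_left scaleR_sum_left)
  then have "c (Id_on X) + (\<Sum>R\<in>?R'. c R * P R) = 1"
    using E'(2) by (simp only: scaleR_cancel_right) auto
  \<comment> \<open>The factor n k turns each \<open>c R\<close> into \<open>P R * t\<close> by
    \<open>cR\<close>, so that \<open>sumP\<close> applies; the result is k t + t (n - k) = n
    k.\<close>
  then have "(real n * real k) * (c (Id_on X) + (\<Sum>R\<in>?R'. c R * P R)) = real n * real k"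
    by simp
  then have "real n * real k * c (Id_on X) + (\<Sum>R\<in>?R'. (real n * real k * c R) * P R) = real n * real k"
    by (simp only: distrib_left sum_distrib_left mult.assoc)
  moreover have "real n * real k * c (Id_on X) = real k * t"
    using c0 by (simp add: algebra_simps)
  moreover have "(\<Sum>R\<in>?R'. (real n * real k * c R) * P R) = (\<Sum>R\<in>?R'. t * (P R * P R))"
    by (intro sum.cong refl) (simp add: cR)
  then have "(\<Sum>R\<in>?R'. (real n * real k * c R) * P R) = t * (real n - real k)"
    by (simp only: sumP flip: sum_distrib_left)
  ultimately have "real k * t + t * (real n - real k) = real n * real k"
    by (simp only:)
  then have "t * real n = real k * real n"
    by (simp add: algebra_simps)
  then show ?thesis
    using \<open>n > 0\<close> by (simp add: t_def)
qed

end

text \<open>Conjugation by a permutation matrix, hence an algebra automorphism when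
  \<open>\<pi>\<close> is bijective. Composition is contravariant, as
  \<open>permute_matrix_permute\<close> shows.\<close>

definition permute_matrix :: "('x \<Rightarrow> 'x) \<Rightarrow> real^'x^'x \<Rightarrow> real^'x^'x::finite" where
  "permute_matrix \<pi> M = (\<chi> x y. M $ \<pi> x $ \<pi> y)"

lemma permute_matrix_simps [simp]:
  "permute_matrix \<pi> (M + N) = permute_matrix \<pi> M + permute_matrix \<pi> N"
  "permute_matrix \<pi> (c *\<^sub>R M) = c *\<^sub>R permute_matrix \<pi> M"
  "permute_matrix \<pi> 0 = 0"
  "permute_matrix id M = M"
  "permute_matrix (\<lambda>x. x) M = M"
  by (simp_all add: permute_matrix_def vec_eq_iff)

lemma permute_matrix_sum: "permute_matrix \<pi> (\<Sum>i\<in>J. f i) = (\<Sum>i\<in>J. permute_matrix \<pi> (f i))"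
  by (induction J rule: infinite_finite_induct) auto

lemma permute_matrix_permute: "permute_matrix \<pi> (permute_matrix \<tau> M) = permute_matrix (\<tau> \<circ> \<pi>) M"
  by (simp add: permute_matrix_def vec_eq_iff)

lemma permute_matrix_mult:
  assumes "bij \<pi>"
  shows "permute_matrix \<pi> (M ** N) = permute_matrix \<pi> M ** permute_matrix \<pi> N"
proof -
  have "(\<Sum>z\<in>UNIV. M $ \<pi> x $ z * N $ z $ \<pi> y) = (\<Sum>z\<in>UNIV. M $ \<pi> x $ \<pi> z * N $ \<pi> z $ \<pi> y)" for x y
    by (rule sum.reindex_bij_betw[OF assms, symmetric])
  then show ?thesis
    by (simp add: permute_matrix_def matrix_matrix_mult_def vec_eq_iff)
qed

lemma trace_permute_matrix:
  assumes "bij \<pi>"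
  shows "trace (permute_matrix \<pi> M) = trace M"
  unfolding trace_def permute_matrix_def using sum.reindex_bij_betw[OF assms, of "\<lambda>x. M $ x $ x"] by simp

text \<open>\<open>\<S>\<close> is the fusion of \<open>\<R>\<close> under a permutation \<open>\<pi>\<close> of prime order, and \<open>W\<close> is a union of
  relations of \<open>\<R>\<close> that meets each orbit of \<open>\<pi>\<close> on the nontrivial relations once.\<close>

locale prime_fusion = R: scheme X \<R> + S: scheme X \<S>
  for X :: "'x::finite set" and \<R> \<S> +
  fixes \<pi> :: "'x \<Rightarrow> 'x" and m k :: nat and W :: "('x \<times> 'x) set"
  assumes bij: "bij \<pi>" and pow: "\<pi> ^^ m = id" and prime: "prime m"
    and X_inv: "\<pi> x \<in> X \<longleftrightarrow> x \<in> X"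
    and closed: "M \<in> R.\<A> \<Longrightarrow> permute_matrix \<pi> M \<in> R.\<A>"
    and fixed: "S.\<A> = {M \<in> R.\<A>. permute_matrix \<pi> M = M}"
    and W: "adjacency_matrix W \<in> R.\<A>"
    and transversal: "x \<in> X \<Longrightarrow> y \<in> X \<Longrightarrow> x \<noteq> y \<Longrightarrow> \<exists>!i. i < m \<and> ((\<pi> ^^ i) x, (\<pi> ^^ i) y) \<in> W"
    and irrefl: "(x, x) \<notin> W"
    and k_pos: "k > 0"
    and valency: "R \<in> \<R> \<Longrightarrow> R \<noteq> Id_on X \<Longrightarrow> x \<in> X \<Longrightarrow> card {z. (x, z) \<in> R} = k"
    and count: "x \<in> X \<Longrightarrow> y \<in> X \<Longrightarrow> x \<noteq> y \<Longrightarrow>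
      (\<Sum>R\<in>\<R> - {Id_on X}. card {z. (x, z) \<in> R \<and> (z, y) \<in> R}) = k - 1"
begin

abbreviation "P i \<equiv> permute_matrix (\<pi> ^^ i)"

lemma bij_pow: "bij (\<pi> ^^ i)"
  using bij by (rule bij_betw_funpow)

lemma X_inv_pow: "(\<pi> ^^ i) x \<in> X \<longleftrightarrow> x \<in> X"
  by (induction i) (auto simp: X_inv)

lemma P_add: "P i (P j M) = P (j + i) M"
  by (simp add: permute_matrix_permute funpow_add)

lemma P_Suc: "P (Suc i) M = permute_matrix \<pi> (P i M)"
  by (simp add: permute_matrix_permute funpow_Suc_right del: funpow.simps)

lemma P_closed: "M \<in> R.\<A> \<Longrightarrow> P i M \<in> R.\<A>"
proof (induction i)
  case (Suc i)
  then show ?case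
    using closed by (simp only: P_Suc)
qed simp

lemma P_mult_m: "P (m * i) M = M"
  by (simp add: funpow_mult[symmetric] pow)

lemma P_mod: "P (i mod m) M = P i M"
proof -
  have "P i M = P (i mod m + m * (i div m)) M" by simp
  also have "\<dots> = P (m * (i div m)) (P (i mod m) M)"
    by (simp only: P_add)
  finally show ?thesis
    by (simp only: P_mult_m)
qed

lemma P_fixed: "P i M = M" if "permute_matrix \<pi> M = M"
proof (induction i)
  case (Suc i)
  then show ?case
    using that by (simp only: P_Suc)
qed simp

text \<open>Exponents are natural numbers, so \<open>m - i mod m\<close> stands in for -i. It lies
  between 1 and m, and \<open>P m\<close> is the identity.\<close>

lemma P_cancel: "P (m - i mod m) (P i M) = M"
proof -
  have "i mod m < m"
    using prime prime_gt_0_nat by simp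
  have "P (m - i mod m) (P i M) = P (m - i mod m) (P (i mod m) M)"
    by (simp only: P_mod)
  also have "\<dots> = P (m * 1) M"
    using \<open>i mod m < m\<close> by (simp add: P_add)
  finally show ?thesis
    by (simp only: P_mult_m)
qed

lemma P_eq_0: "P i M = 0 \<longleftrightarrow> M = 0"
  using P_cancel[of i M] by (metis permute_matrix_simps(3))

text \<open>A splitting of \<open>P i E\<close> is carried back by the inverse power to a splitting
  of \<open>E\<close>.\<close>

lemma primitive_P:
  assumes "R.primitive E"
  shows "R.primitive (P i E)"
proof -
  note E = R.primitiveD[OF assms]
  note mult = permute_matrix_mult[OF bij_pow]
  have "P i E \<in> R.\<A>" "P i E \<noteq> 0" "P i E ** P i E = P i E"
    using E P_closed P_eq_0 by (auto simp flip: mult)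
  moreover have False if F: "F \<in> R.\<A>" "G \<in> R.\<A>" "F \<noteq> 0" "G \<noteq> 0" "F ** F = F" "G ** G = G"
    "F ** G = 0" "G ** F = 0" "P i E = F + G" for F G
  proof -
    define j where "j = m - i mod m"
    have "E = P j F + P j G"
      using P_cancel[of i E] F(9) by (simp add: j_def)
    moreover have "P j F ** P j F = P j F" "P j G ** P j G = P j G" "P j F ** P j G = 0"
      using F by (simp_all flip: mult)
    ultimately have "P j F = 0 \<or> P j G = 0"
      using R.primitive_split[OF assms P_closed[OF F(1)] P_closed[OF F(2)]] by blast
    with F show False
      by (simp add: P_eq_0)
  qed
  ultimately show ?thesis
    unfolding primitive_idempotent_def by blast
qed

text \<open>Each off-diagonal pair of points of \<open>X\<close> lies in exactly one of the m
  translates of \<open>W\<close>, and no other pair lies in any; the right side is J - I.\<close>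

lemma sum_transversal: "(\<Sum>i<m. P i (adjacency_matrix W)) = real (card X) *\<^sub>R R.E0 - R.I"
proof (simp only: vec_eq_iff, intro allI)
  fix x y
  have WX: "p \<in> X \<times> X" if "p \<in> W" for p
    using R.zero_outside[OF W, of "fst p" "snd p"] that by (auto simp: adjacency_matrix_def)
  let ?J = "{i \<in> {..<m}. ((\<pi> ^^ i) x, (\<pi> ^^ i) y) \<in> W}"
  have "(\<Sum>i<m. P i (adjacency_matrix W)) $ x $ y = (\<Sum>i<m. if ((\<pi> ^^ i) x, (\<pi> ^^ i) y) \<in> W then 1 else 0)"
    by (simp add: permute_matrix_def adjacency_matrix_def)
  also have "\<dots> = real (card ?J)"
    by (simp flip: sum.inter_filter)
  also have "\<dots> = (if x \<in> X \<and> y \<in> X \<and> x \<noteq> y then 1 else 0)"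
  proof (cases "x \<in> X \<and> y \<in> X \<and> x \<noteq> y")
    case True
    then obtain i where i: "i < m" "((\<pi> ^^ i) x, (\<pi> ^^ i) y) \<in> W"
      and uniq: "\<And>j. j < m \<Longrightarrow> ((\<pi> ^^ j) x, (\<pi> ^^ j) y) \<in> W \<Longrightarrow> j = i"
      using transversal[of x y] by metis
    then have "?J = {i}" by blast
    with True show ?thesis by simp
  next
    case False
    have "?J = {}"
    proof (rule ccontr)
      assume "?J \<noteq> {}"
      then obtain i where i: "((\<pi> ^^ i) x, (\<pi> ^^ i) y) \<in> W" by blast
      then have "x \<in> X" "y \<in> X"
        using WX[OF i] X_inv_pow by auto
      moreover have "x \<noteq> y"
        using i irrefl by auto
      ultimately show False
        using False by blast
    qed
    then show ?thesis
      using False by (simp only: card.empty of_nat_0 if_False)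
  qed
  also have "\<dots> = (real (card X) *\<^sub>R R.E0 - R.I) $ x $ y"
    by (auto simp: trivial_idempotent_def adjacency_matrix_def card_eq_0_iff)
  finally show "(\<Sum>i<m. P i (adjacency_matrix W)) $ x $ y = (real (card X) *\<^sub>R R.E0 - R.I) $ x $ y" .
qed

text \<open>On a \<open>\<pi>\<close>-invariant \<open>E\<close> all translates of \<open>W\<close> have the same eigenvalue \<open>s\<close>, so \<open>m s = -1\<close>;
  but \<open>-1/m\<close> is not an algebraic integer.\<close>

lemma not_invariant:
  assumes E: "R.primitive E" "E \<noteq> R.E0"
  shows "permute_matrix \<pi> E \<noteq> E"
proof
  assume inv: "permute_matrix \<pi> E = E"
  note E' = R.primitiveD[OF E(1)]
  let ?U = "adjacency_matrix W"
  obtain s where s: "?U ** E = s *\<^sub>R E"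
    by (rule R.primitive_eigenvalue[OF E(1) W])
  have "P i ?U ** E = s *\<^sub>R E" for i
  proof -
    have "P i ?U ** E = P i ?U ** P i E"
      using P_fixed[OF inv] by simp
    also have "\<dots> = P i (s *\<^sub>R E)"
      by (simp flip: permute_matrix_mult[OF bij_pow] add: s)
    finally show ?thesis
      using P_fixed[OF inv] by simp
  qed
  then have "(\<Sum>i<m. P i ?U) ** E = real m *\<^sub>R (?U ** E)"
    by (simp only: matrix_sum_rdistrib s sum_constant_scaleR card_lessThan)
  moreover have "(\<Sum>i<m. P i ?U) ** E = - E"
    unfolding sum_transversal
    using R.primitive_mult_E0[OF E] R.I_mult[OF E'(1)]
    by (simp add: matrix_diff_rdistrib scalar_matrix_assoc[symmetric])
  ultimately have "E = 0"
    using prime prime_gt_1_nat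
    by (intro sum_scaled_integer_matrix_eigen[of m ?U E]) (auto simp: adjacency_matrix_def)
  with E'(2) show False ..
qed

text \<open>If two translates agree, the power with exponent \<open>j + (m - i)\<close> fixes
  \<open>E\<close>. This exponent is j - i modulo m, hence prime to m, so a multiple of it is 1
  modulo m and \<open>\<pi>\<close> itself would fix \<open>E\<close>, against
  \<open>not_invariant\<close>.\<close>

lemma P_inj:
  assumes E: "R.primitive E" "E \<noteq> R.E0" and "i < j" "j < m"
  shows "P i E \<noteq> P j E"
proof
  assume "P i E = P j E"
  then have "P (m - i mod m) (P j E) = E"
    using P_cancel[of i E] by simp
  then have *: "P (j + (m - i)) E = E"
    using assms by (simp add: P_add)
  have "\<not> m dvd (j - i)"
    using assms by (auto dest: dvd_imp_le)
  moreover have "j + (m - i) = m + (j - i)"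
    using assms by simp
  ultimately have "\<not> m dvd (j + (m - i))" by simp
  then have "coprime (j + (m - i)) m"
    using prime prime_imp_coprime coprime_commute by blast
  then obtain c where c: "[(j + (m - i)) * c = 1] (mod m)"
    using cong_solve_coprime_nat by auto
  have "P ((j + (m - i)) * c) E = E"
  proof (induction c)
    case (Suc c)
    then show ?case
      using * P_add[of "(j + (m - i)) * c" "j + (m - i)" E] by simp
  qed simp
  then have "P 1 E = E"
    using c by (metis P_mod cong_def)
  with not_invariant[OF E] show False by simp
qed

text \<open>A primitive \<open>E\<close> of the finer algebra below \<open>F\<close> has m pairwise
  orthogonal translates, all below \<open>F\<close>. Their sum \<open>G\<close> is an invariant
  idempotent, so it lies in the fused algebra, where \<open>G ** F\<close> must be 0 or
  \<open>F\<close>; it is \<open>G\<close>, which is nonzero.\<close>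

lemma S_primitive_trace:
  assumes F: "S.primitive F" "F \<noteq> S.E0"
  shows "trace F = real (m * k)"
proof -
  note F' = S.primitiveD[OF F(1)]
  have FR: "F \<in> R.\<A>" and Finv: "permute_matrix \<pi> F = F"
    using F'(1) fixed by auto
  obtain E where E: "R.primitive E" "E ** F = E"
    using R.primitive_below_idempotent[OF FR F'(2,3)] by blast
  note E' = R.primitiveD[OF E(1)]
  have "E \<noteq> R.E0"
  proof
    assume "E = R.E0"
    with E have "S.E0 ** F = S.E0" by simp
    with S.primitive_mult_E0[OF F] S.E0_nonzero show False by simp
  qed
  note EE0 = E(1) this
  define G where "G = (\<Sum>i<m. P i E)"
  have GR: "G \<in> R.\<A>"
    using E' P_closed by (auto simp: G_def intro: R.sum_closed)
  have Ginv: "permute_matrix \<pi> G = G"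
  proof -
    have "permute_matrix \<pi> G = (\<Sum>i<m. P (Suc i) E)"
      by (simp only: G_def permute_matrix_sum P_Suc)
    \<comment> \<open>The shifted sum loses the term 0 and gains the term m, and these coincide
      because \<open>\<pi> ^^ m = id\<close>.\<close>
    moreover have "(\<Sum>i<m. P (Suc i) E) + P 0 E = (\<Sum>i<m. P i E) + P m E"
      using sum.lessThan_Suc_shift[of "\<lambda>i. P i E" m] by (simp add: add.commute)
    moreover have "P m E = P 0 E"
      by (simp only: pow funpow.simps(1))
    ultimately show ?thesis
      by (simp add: G_def)
  qed
  have GS: "G \<in> S.\<A>"
    using GR Ginv fixed by simp
  have orth: "P i E ** P j E = (if i = j then P i E else 0)" if "i < m" "j < m" for i j
  proof (cases "i = j")
    case True
    then show ?thesis
      by (simp add: E'(3) flip: permute_matrix_mult[OF bij_pow])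
  next
    case False
    then have "P i E \<noteq> P j E"
      using P_inj[OF EE0] that by (metis nat_neq_iff)
    with False show ?thesis
      using R.primitive_orthogonal primitive_P[OF E(1)] by simp
  qed
  have Gi: "G ** P j E = P j E" if "j < m" for j
    using orth that by (simp add: G_def matrix_sum_rdistrib)
  have "G ** G = (\<Sum>i<m. G ** P i E)"
    by (simp only: G_def matrix_sum_ldistrib)
  also have "\<dots> = G"
    using Gi by (simp add: G_def)
  finally have GG: "G ** G = G" .
  have "P i E ** F = P i E" for i
    using E(2) P_fixed[OF Finv] permute_matrix_mult[OF bij_pow, of i E F] by simp
  then have GF: "G ** F = G"
    by (simp add: G_def matrix_sum_rdistrib)
  have "G \<noteq> 0"
  proof
    assume "G = 0"
    then have "P 0 E = 0"
      using Gi[of 0] prime prime_gt_0_nat by simp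
    with E'(2) P_eq_0 show False by blast
  qed
  then have "F = G"
    using S.primitive_mult_idempotent[OF F(1) GS GG] GF by simp
  then have "trace F = (\<Sum>i<m. trace (P i E))"
    by (simp add: G_def trace_def sum.swap[of _ _ "UNIV"])
  also have "\<dots> = (\<Sum>i<m. real k)"
    using R.primitive_trace[OF k_pos valency count EE0] by (simp add: trace_permute_matrix[OF bij_pow])
  finally show ?thesis by simp
qed

theorem pseudocyclic_fusion: "pseudocyclic X \<S>"
  unfolding pseudocyclic_def
proof (intro exI allI impI)
  fix F assume F: "S.primitive F \<and> F \<noteq> S.E0"
  then have "real (rank F) = real (m * k)"
    using S.idempotent_trace(1) S_primitive_trace S.primitiveD by metis
  then show "rank F = m * k"
    by (simp only: of_nat_eq_iff)
qed

end

section \<open>Fields with \<open>2 ^ m\<close> elements, \<open>m\<close> odd\<close>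

locale binary_field =
  fixes m :: nat and F :: "'a::{finite,field} itself"
  assumes card: "CARD('a) = 2 ^ m" and odd: "odd m" and m_gt: "m > 1"
begin

text \<open>Translation by 1 permutes the field, so it does not change the sum of all elements,
  although it adds 2^m to it.\<close>

lemma two_zero: "(2::'a) = 0"
proof -
  have "(\<Sum>x\<in>UNIV. x + (1::'a)) = (\<Sum>x\<in>UNIV. x)"
    by (rule sum.reindex_bij_witness[of _ "\<lambda>x. x - 1" "\<lambda>x. x + 1"]) auto
  then have "of_nat CARD('a) = (0::'a)"
    by (simp add: sum.distrib)
  then show ?thesis
    by (simp add: card)
qed

lemma add_self: "x + x = (0::'a)"
  using two_zero by (metis mult_2 mult_zero_left)

lemma add_self_left: "x + (x + y) = (y::'a)"
  by (simp add: add_self flip: add.assoc)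

lemma uminus_self: "- x = (x::'a)"
  using add_self[of x] by (rule add.inverse_unique)

lemma minus_eq_add: "x - y = x + (y::'a)"
  by (metis diff_conv_add_uminus uminus_self)

text \<open>With \<open>algebra_simps\<close> these rules prove the polynomial identities below:
  differences become sums and repeated terms cancel.\<close>

lemmas char2 = add_self add_self_left uminus_self minus_eq_add two_zero

lemma add_eq_0: "x + y = 0 \<longleftrightarrow> x = (y::'a)"
  by (metis add_self add_self_left add.right_neutral)

lemma square_add: "(x + y)\<^sup>2 = x\<^sup>2 + (y::'a)\<^sup>2"
  by (simp add: power2_sum two_zero)

lemma power_add_pow2: "(x + y) ^ (2 ^ i) = x ^ (2 ^ i) + (y::'a) ^ (2 ^ i)"
proof (induction i)
  case (Suc i)
  have "(x + y) ^ (2 ^ Suc i) = ((x + y) ^ (2 ^ i))\<^sup>2"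
    by (simp add: power_mult mult.commute flip: power_mult)
  then show ?case
    by (simp add: Suc square_add mult.commute flip: power_mult)
qed simp

text \<open>Multiplication by a nonzero x permutes the nonzero elements; comparing their products
  gives x^(q - 1) = 1.\<close>

lemma power_card_eq: "(x::'a) ^ (2 ^ m) = x"
proof (cases "x = 0")
  case False
  have "(\<Prod>y\<in>UNIV - {0}. x * y) = (\<Prod>y\<in>UNIV - {0}. y)"
    by (rule prod.reindex_bij_witness[of _ "\<lambda>y. y / x" "\<lambda>y. x * y"]) (use False in auto)
  then have "x ^ (CARD('a) - 1) * (\<Prod>y\<in>UNIV - {0::'a}. y) = (\<Prod>y\<in>UNIV - {0}. y)"
    by (simp add: prod.distrib card_Diff_singleton)
  moreover have "(\<Prod>y\<in>UNIV - {0::'a}. y) \<noteq> 0"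
    by (simp add: prod_zero_iff)
  ultimately have "x ^ (2 ^ m - 1) = 1"
    by (simp add: card)
  then have "x * x ^ (2 ^ m - 1) = x" by simp
  then show ?thesis
    by (metis power_eq_if pos2 zero_less_power less_numeral_extra(3))
qed simp

text \<open>The square root, not the square: the inverse of the Frobenius map is its power m -
  1.\<close>

definition sqr :: "'a \<Rightarrow> 'a" where
  "sqr x = x ^ (2 ^ (m - 1))"

lemma sqr_square [simp]: "(sqr x)\<^sup>2 = x"
proof -
  have "(sqr x)\<^sup>2 = x ^ (2 ^ Suc (m - 1))"
    by (simp add: sqr_def mult.commute flip: power_mult)
  then show ?thesis
    using m_gt power_card_eq by simp
qed

lemma square_inj: "x\<^sup>2 = y\<^sup>2 \<longleftrightarrow> x = (y::'a)"
  by (metis add_eq_0 square_add zero_eq_power2)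

lemma sqr_eq_iff: "sqr x = y \<longleftrightarrow> x = y\<^sup>2"
  using square_inj sqr_square by metis

lemma sqr_simps [simp]: "sqr (x * y) = sqr x * sqr y" "sqr (x + y) = sqr x + sqr y" "sqr 0 = 0" "sqr 1 = 1"
  "sqr x = 0 \<longleftrightarrow> x = 0"
  by (simp_all add: sqr_eq_iff square_add power_mult_distrib)

abbreviation tr :: "'a \<Rightarrow> 'a" where "tr \<equiv> abs_trace m"

lemma tr_add: "tr (x + y) = tr x + tr y"
  by (simp add: abs_trace_def power_add_pow2 sum.distrib)

lemma tr_pow_shift: "tr (x\<^sup>2) = (\<Sum>i<m. x ^ (2 ^ Suc i))"
  by (simp add: abs_trace_def power_mult)

lemma tr_square: "tr (x\<^sup>2) = tr x"
proof -
  have "tr (x\<^sup>2) + x ^ (2 ^ 0) = tr x + x ^ (2 ^ m)"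
    unfolding tr_pow_shift unfolding abs_trace_def
    using sum.lessThan_Suc_shift[of "\<lambda>i. x ^ (2 ^ i)" m] by (simp add: add.commute)
  then show ?thesis
    by (simp add: power_card_eq)
qed

lemma sum_square: "(\<Sum>i\<in>A. f i)\<^sup>2 = (\<Sum>i\<in>A. (f i :: 'a)\<^sup>2)"
  by (induction A rule: infinite_finite_induct) (auto simp: square_add)

lemma tr_0_or_1: "tr x = 0 \<or> tr x = 1"
proof -
  have "(tr x)\<^sup>2 = tr (x\<^sup>2)"
    by (simp add: abs_trace_def sum_square mult.commute flip: power_mult)
  then have "(tr x)\<^sup>2 = tr x"
    by (simp only: tr_square)
  then have "tr x * (tr x - 1) = 0"
    by (simp add: power2_eq_square right_diff_distrib)
  then show ?thesis by auto
qed

lemma tr_0 [simp]: "tr 0 = 0"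
  by (simp add: abs_trace_def power_0_left)

lemma tr_1 [simp]: "tr 1 = 1"
proof -
  obtain n where "m = 2 * n + 1"
    using odd by (rule oddE)
  then show ?thesis
    by (simp add: abs_trace_def two_zero)
qed

text \<open>The half trace; it exists because \<open>m\<close> is odd.\<close>

lemma artin_schreier:
  assumes "tr c = 0"
  obtains h where "h\<^sup>2 + h = c"
proof -
  obtain n where m: "m = 2 * n + 1"
    using odd by (rule oddE)
  \<comment> \<open>The sum takes every second conjugate of \<open>c\<close>, and its square
    supplies the conjugates in between.\<close>
  have *: "(\<Sum>i<k. c ^ (2 ^ (2 * i)))\<^sup>2 + (\<Sum>i<k. c ^ (2 ^ (2 * i))) = (\<Sum>i<2 * k. c ^ (2 ^ i))" for k
  proof (induction k)
    case (Suc k)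
    have "(\<Sum>i<Suc k. c ^ (2 ^ (2 * i)))\<^sup>2 + (\<Sum>i<Suc k. c ^ (2 ^ (2 * i))) =
      ((\<Sum>i<k. c ^ (2 ^ (2 * i)))\<^sup>2 + (\<Sum>i<k. c ^ (2 ^ (2 * i)))) + (c ^ (2 ^ (2 * k)) + (c ^ (2 ^ (2 * k)))\<^sup>2)"
      by (simp only: sum.lessThan_Suc square_add add_ac)
    also have "(c ^ (2 ^ (2 * k)))\<^sup>2 = c ^ (2 ^ Suc (2 * k))"
      by (simp add: mult.commute flip: power_mult)
    finally have eq: "(\<Sum>i<Suc k. c ^ (2 ^ (2 * i)))\<^sup>2 + (\<Sum>i<Suc k. c ^ (2 ^ (2 * i))) =
        (\<Sum>i<2 * k. c ^ (2 ^ i)) + (c ^ (2 ^ (2 * k)) + c ^ (2 ^ Suc (2 * k)))"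
      unfolding Suc .
    show ?case
      unfolding eq by simp
  qed simp
  \<comment> \<open>n + 1 terms yield the exponents 0 to m: the trace, which is 0, and the further
    term \<open>c ^ (2 ^ m)\<close>, which is \<open>c\<close>.\<close>
  have "(\<Sum>i<n+1. c ^ (2 ^ (2 * i)))\<^sup>2 + (\<Sum>i<n+1. c ^ (2 ^ (2 * i))) = (\<Sum>i<Suc m. c ^ (2 ^ i))"
    unfolding * by (simp add: m)
  also have "\<dots> = c"
    using assms by (simp add: abs_trace_def power_card_eq)
  finally show thesis by (rule that)
qed

lemma tr_artin_schreier: "tr (h\<^sup>2 + h) = 0"
  by (simp add: tr_add tr_square char2)

text \<open>Adding 1 exchanges trace 0 and trace 1, because Tr 1 = 1.\<close>

lemma card_tr_1: "card {x. tr x = 1} = 2 ^ (m - 1)"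
proof -
  have "card {x. tr x = 1} = card {x. tr x = 0}"
    by (rule bij_betw_same_card[of "\<lambda>x. x + 1"], rule bij_betwI[where g = "\<lambda>x. x + 1"])
      (auto simp: tr_add char2 add.assoc)
  moreover have "card {x. tr x = 0} + card {x. tr x = 1} = CARD('a)"
  proof -
    have "UNIV = {x. tr x = 0} \<union> {x. tr x = 1}"
      using tr_0_or_1 by auto
    moreover have "{x. tr x = 0} \<inter> {x. tr x = 1} = {}"
      by auto
    ultimately show ?thesis
      by (metis card_Un_disjoint finite)
  qed
  moreover have "(2::nat) ^ m = 2 * 2 ^ (m - 1)"
    using m_gt by (metis One_nat_def Suc_lessD power_eq_if not_less_eq zero_less_Suc)
  ultimately show ?thesis
    by (simp add: card)
qed

lemma card_tr_mult_1:
  assumes "w \<noteq> 0"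
  shows "card {x. tr (w * x) = 1} = 2 ^ (m - 1)"
proof -
  have "card {x. tr (w * x) = 1} = card {x. tr x = 1}"
    by (rule bij_betw_same_card[of "\<lambda>x. w * x"], rule bij_betwI[where g = "\<lambda>x. x / w"])
      (use assms in auto)
  then show ?thesis
    by (simp add: card_tr_1)
qed

section \<open>Coordinates of the exterior lines\<close>

text \<open>With the first line fixed, this is a quadratic form x^2 t^2 + s t + y^2 s^2 in the
  displacement s = x + z, t = y + u. The intersection point of the lines is (x u + y z, y + u, x +
  z).\<close>

lemma rho_form: "rho_hat x y z u = x\<^sup>2 * (y + u)\<^sup>2 + (x + z) * (y + u) + y\<^sup>2 * (x + z)\<^sup>2" for x :: 'a
  unfolding rho_hat_def power2_eq_square by (simp add: algebra_simps char2)

lemma rho_commute: "rho_hat x y z u = rho_hat z u x (y::'a)"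
  unfolding rho_hat_def by (simp add: algebra_simps)

text \<open>Up to x y + z u the value is a sum of two terms h^2 + h, which have trace 0. Hence two
  exterior lines have a value of trace 0, and a value of trace 0 makes the second line exterior if
  the first is.\<close>

lemma tr_rho: "tr (rho_hat x y z u) = tr (x * y) + tr (z * u)"
proof -
  have "rho_hat x y z u = ((x * u)\<^sup>2 + x * u) + ((y * z)\<^sup>2 + y * z) + x * y + z * u"
    unfolding rho_hat_def by (simp add: algebra_simps)
  then show ?thesis
    using tr_artin_schreier by (simp add: tr_add)
qed

text \<open>Multiplied by x^2, a zero would give h^2 + h = (x y)^2 with h = x^2 \<tau>, but the
  right side has trace 1. So the form in \<open>rho_form\<close> is anisotropic for exterior
  lines.\<close>

lemma norm_form_nonzero:
  assumes "tr (x * y) = 1"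
  shows "x\<^sup>2 * \<tau>\<^sup>2 + \<tau> + y\<^sup>2 \<noteq> 0"
proof
  assume "x\<^sup>2 * \<tau>\<^sup>2 + \<tau> + y\<^sup>2 = 0"
  then have "x\<^sup>2 * (x\<^sup>2 * \<tau>\<^sup>2 + \<tau> + y\<^sup>2) = 0" by simp
  then have "((x\<^sup>2 * \<tau>)\<^sup>2 + x\<^sup>2 * \<tau>) + (x * y)\<^sup>2 = 0"
    by (simp add: algebra_simps power2_eq_square)
  then have "tr (((x\<^sup>2 * \<tau>)\<^sup>2 + x\<^sup>2 * \<tau>) + (x * y)\<^sup>2) = 0" by simp
  then show False
    using assms by (simp add: tr_add[of _ "(x * y)\<^sup>2"] tr_artin_schreier tr_square)
qed

lemma rho_eq_0:
  assumes "tr (x * y) = 1"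
  shows "rho_hat x y z u = 0 \<longleftrightarrow> x = z \<and> y = u"
proof
  assume 0: "rho_hat x y z u = 0"
  show "x = z \<and> y = u"
  proof (cases "x = z")
    case True
    with 0 assms show ?thesis
      by (auto simp: rho_form char2 add_eq_0)
  next
    case False
    then have s: "x + z \<noteq> 0"
      by (simp add: add_eq_0)
    define \<tau> where "\<tau> = (y + u) / (x + z)"
    have t: "y + u = (x + z) * \<tau>"
      using s by (simp add: \<tau>_def)
    have "rho_hat x y z u = (x + z)\<^sup>2 * (x\<^sup>2 * \<tau>\<^sup>2 + \<tau> + y\<^sup>2)"
      unfolding rho_form t by (simp add: algebra_simps power2_eq_square)
    with 0 s norm_form_nonzero[OF assms] show ?thesis by simp
  qed
qed (simp add: rho_form char2)

text \<open>For each of the q + 1 directions \<tau> = (y + u) / (x + z), infinity included, the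
  equation says that a square times a nonzero constant is \<open>a\<close>; it has one solution
  since squaring is bijective. By \<open>tr_rho\<close> the line found is exterior.\<close>

lemma card_rho_eq:
  assumes ext: "tr (x * y) = 1" and a: "a \<noteq> 0" "tr a = 0"
  shows "card {(z, u). tr (z * u) = 1 \<and> rho_hat x y z u = a} = 2 ^ m + 1"
proof -
  have x: "x \<noteq> 0"
    using ext by auto
  define f where "f \<tau> = x\<^sup>2 * \<tau>\<^sup>2 + \<tau> + y\<^sup>2" for \<tau>
  define s where "s \<tau> = sqr (a / f \<tau>)" for \<tau>
  have f: "f \<tau> \<noteq> 0" for \<tau>
    using norm_form_nonzero[OF ext] by (simp add: f_def)
  have s0: "s \<tau> \<noteq> 0" and sf: "(s \<tau>)\<^sup>2 * f \<tau> = a" for \<tau>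
    using f a by (auto simp: s_def)
  \<comment> \<open>\<open>None\<close> is the direction z = x, where the equation is (x t)^2 = a;
    in direction \<tau> it is (s \<tau>)^2 * f \<tau> = a.\<close>
  define g where "g \<tau> = (case \<tau> of None \<Rightarrow> (x, y + sqr a / x) | Some \<tau> \<Rightarrow> (x + s \<tau>, y + s \<tau> * \<tau>))" for \<tau>
  have rho: "rho_hat x y (x + s) (y + s * \<tau>) = s\<^sup>2 * f \<tau>" for s \<tau>
    unfolding rho_form f_def by (simp add: char2) (simp add: algebra_simps power2_eq_square)
  have rho0: "rho_hat x y x (y + t) = (x * t)\<^sup>2" for t
    unfolding rho_form by (simp add: char2 power_mult_distrib)
  have "inj g"
  proof (rule injI)
    fix p p' assume "g p = g p'"
    then show "p = p'"
      using s0 by (cases p; cases p') (auto simp: g_def)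
  qed
  moreover have "range g = {(z, u). tr (z * u) = 1 \<and> rho_hat x y z u = a}"
  proof (intro equalityI subsetI)
    fix p assume "p \<in> range g"
    then obtain \<tau> where p: "p = g \<tau>" by blast
    obtain z u where zu: "g \<tau> = (z, u)" by force
    have "rho_hat x y z u = a"
    proof (cases \<tau>)
      case None
      then have "z = x" "u = y + sqr a / x"
        using zu by (auto simp: g_def)
      then show ?thesis
        using x by (simp only: rho0) simp
    next
      case (Some t)
      then show ?thesis
        using zu by (auto simp: g_def rho sf)
    qed
    moreover from this have "tr (z * u) = 1"
      using tr_rho[of x y z u] a ext by (metis add_eq_0)
    ultimately show "p \<in> {(z, u). tr (z * u) = 1 \<and> rho_hat x y z u = a}"
      using p zu by auto
  next
    fix p assume "p \<in> {(z, u). tr (z * u) = 1 \<and> rho_hat x y z u = a}"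
    then obtain z u where p: "p = (z, u)" and zu: "rho_hat x y z u = a" by auto
    show "p \<in> range g"
    proof (cases "x = z")
      case True
      have u: "u = y + (y + u)"
        by (simp add: char2)
      have "(x * (y + u))\<^sup>2 = a"
        using zu True rho0[of "y + u"] u by simp
      then have "sqr a = x * (y + u)"
        by (simp add: sqr_eq_iff)
      then have "p = g None"
        using x p True by (simp add: g_def char2)
      then show ?thesis by blast
    next
      case False
      then have s: "x + z \<noteq> 0"
        by (simp add: add_eq_0)
      define \<tau> where "\<tau> = (y + u) / (x + z)"
      have z: "z = x + (x + z)" and u: "u = y + (x + z) * \<tau>"
        using s by (auto simp: \<tau>_def char2)
      have "(x + z)\<^sup>2 * f \<tau> = a"
        using zu rho[of "x + z" \<tau>] z u by simp
      then have "x + z = s \<tau>"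
        using f[of \<tau>] by (simp add: s_def field_simps eq_commute[of "x + z"] sqr_eq_iff)
      then have "p = g (Some \<tau>)"
        using p z u by (simp add: g_def)
      then show ?thesis by blast
    qed
  qed
  ultimately have "card {(z, u). tr (z * u) = 1 \<and> rho_hat x y z u = a} = CARD('a option)"
    by (metis card_image)
  then show ?thesis
    by (simp add: card card_UNIV_option)
qed

text \<open>The two values add up to z^2 + z + x. Since Tr x = 0, x = w^2 + w and the sum factors as
  (z + w) (z + w + 1). Both roots are nonzero, and for each of them half of the field is admissible
  as u.\<close>

lemma card_rho_equal:
  assumes "tr (x * y) = 1" "tr (x * (y + 1)) = 1"
  shows "card {(z, u). tr (z * u) = 1 \<and> rho_hat x y z u = rho_hat x (y + 1) z u} = 2 ^ m"
proof -
  have x: "x \<noteq> 0"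
    using assms by auto
  have "tr x = 0"
    using assms by (simp add: distrib_left tr_add)
  then obtain w where w: "w\<^sup>2 + w = x"
    by (rule artin_schreier)
  have w0: "w \<noteq> 0" "w + 1 \<noteq> 0"
    using w x by (auto simp: add_eq_0 char2)
  have "rho_hat x y z u + rho_hat x (y + 1) z u = (z + w) * (z + (w + 1))" for z u
    unfolding w[symmetric] rho_hat_def power2_eq_square by (simp add: algebra_simps char2)
  then have "rho_hat x y z u = rho_hat x (y + 1) z u \<longleftrightarrow> z = w \<or> z = w + 1" for z u
    by (metis add_eq_0 mult_eq_0_iff)
  then have "{(z, u). tr (z * u) = 1 \<and> rho_hat x y z u = rho_hat x (y + 1) z u} =
      {w} \<times> {u. tr (w * u) = 1} \<union> {w + 1} \<times> {u. tr ((w + 1) * u) = 1}" (is "?A = ?B \<union> ?C")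
    by auto
  then have "card ?A = card ?B + card ?C"
    by (simp only:) (rule card_Un_disjoint; auto)
  also have "card ?B = 2 ^ (m - 1)"
    by (simp only: card_cartesian_product_singleton card_tr_mult_1[OF w0(1)])
  also have "card ?C = 2 ^ (m - 1)"
    by (simp only: card_cartesian_product_singleton card_tr_mult_1[OF w0(2)])
  also have "2 ^ (m - 1) + 2 ^ (m - 1) = (2::nat) ^ Suc (m - 1)"
    by simp
  finally show ?thesis
    using m_gt by simp
qed

end

section \<open>Lines as kernels of linear forms with first coefficient 1\<close>

lemma vector_3_eq_iff: "(v :: 'b^3) = w \<longleftrightarrow> v $ 1 = w $ 1 \<and> v $ 2 = w $ 2 \<and> v $ 3 = w $ 3"
  by (simp add: vec_eq_iff forall_3)

lemma perp_line_inj: "perp_line x y = perp_line z (u :: 'b::field) \<longleftrightarrow> x = z \<and> y = u"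
proof
  assume eq: "perp_line x y = perp_line z u"
  have "vector [- x, 1, 0] \<in> perp_line x y" "vector [- y, 0, 1] \<in> perp_line x y"
    by (simp_all add: perp_line_def)
  then show "x = z \<and> y = u"
    unfolding eq by (auto simp: perp_line_def add_eq_0_iff)
qed simp

lemma perp_line_span: "perp_line x y = vec.span {vector [- x, 1, 0], vector [- y, 0, 1 :: 'b::field]}"
proof (intro equalityI subsetI)
  fix v :: "'b^3" assume "v \<in> perp_line x y"
  then have v: "v = v $ 2 *s vector [- x, 1, 0] + v $ 3 *s vector [- y, 0, 1]"
    by (simp add: perp_line_def vector_3_eq_iff eq_neg_iff_add_eq_0 algebra_simps)
  show "v \<in> vec.span {vector [- x, 1, 0], vector [- y, 0, 1]}"
    by (subst v) (intro vec.span_add vec.span_scale vec.span_base; simp)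
next
  have "vec.subspace (perp_line x y)"
  proof (rule vec.subspaceI)
    fix v w :: "'b^3" assume "v \<in> perp_line x y" "w \<in> perp_line x y"
    moreover have "(v + w) $ 1 + (v + w) $ 2 * x + (v + w) $ 3 * y =
        (v $ 1 + v $ 2 * x + v $ 3 * y) + (w $ 1 + w $ 2 * x + w $ 3 * y)"
      by (simp add: algebra_simps)
    ultimately show "v + w \<in> perp_line x y"
      by (simp add: perp_line_def)
  next
    fix c and v :: "'b^3" assume "v \<in> perp_line x y"
    moreover have "(c *s v) $ 1 + (c *s v) $ 2 * x + (c *s v) $ 3 * y = c * (v $ 1 + v $ 2 * x + v $ 3 * y)"
      by (simp add: algebra_simps)
    ultimately show "c *s v \<in> perp_line x y"
      by (simp add: perp_line_def)
  qed (simp add: perp_line_def)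
  moreover have "{vector [- x, 1, 0], vector [- y, 0, 1]} \<subseteq> perp_line x y"
    by (simp add: perp_line_def)
  moreover fix v :: "'b^3" assume "v \<in> vec.span {vector [- x, 1, 0], vector [- y, 0, 1]}"
  ultimately show "v \<in> perp_line x y"
    using vec.span_minimal by blast
qed

lemma perp_line_in_proj_lines: "perp_line x (y :: 'b::field) \<in> proj_lines"
proof -
  let ?a = "vector [- x, 1, 0] :: 'b^3" and ?b = "vector [- y, 0, 1] :: 'b^3"
  have "?b \<noteq> 0"
    by (simp add: vector_3_eq_iff)
  moreover have "?a \<notin> vec.span {?b}"
    by (auto simp: vec.span_singleton vector_3_eq_iff)
  moreover have "?a \<noteq> ?b"
    by (simp add: vector_3_eq_iff)
  ultimately have "vec.independent {?a, ?b}"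
    by (simp add: vec.independent_insert)
  then have "vec.dim {?a, ?b} = 2"
    using \<open>?a \<noteq> ?b\<close> by (simp add: vec.dim_eq_card_independent)
  then show ?thesis
    by (simp add: proj_lines_def perp_line_span vec.dim_span)
qed

text \<open>\<open>L\<close> and (1, 0, 0) together span the space, so each of the other two unit
  vectors can be moved along (1, 0, 0) into \<open>L\<close>; the moved vectors span a
  \<open>perp_line\<close>.\<close>

lemma proj_line_is_perp_line:
  fixes L :: "('b::field^3) set"
  assumes L: "L \<in> proj_lines" and e: "vector [1, 0, 0] \<notin> L"
  obtains x y where "L = perp_line x y"
proof -
  let ?e = "vector [1, 0, 0] :: 'b^3"
  have sub: "vec.subspace L" and dim: "vec.dim L = 2"
    using L by (auto simp: proj_lines_def)
  have spanL: "vec.span L = L"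
    using sub by (simp add: vec.span_eq_iff)
  have "vec.dim (insert ?e L) = 3"
    using e dim unfolding vec.dim_insert spanL by simp
  then have "vec.span (insert ?e L) = UNIV"
    by (simp add: vec.dim_eq_full[symmetric] vec.dimension_def card_cart_basis)
  then have ex: "\<exists>k. v - k *s ?e \<in> L" for v
    unfolding vec.span_insert spanL by blast
  obtain k where k: "vector [0, 1, 0] - k *s ?e \<in> L"
    using ex by blast
  obtain l where l: "vector [0, 0, 1] - l *s ?e \<in> L"
    using ex by blast
  have "vector [- k, 1, 0] \<in> L"
    using k by (rule back_subst[of "\<lambda>v. v \<in> L"]) (simp add: vector_3_eq_iff)
  moreover have "vector [- l, 0, 1] \<in> L"
    using l by (rule back_subst[of "\<lambda>v. v \<in> L"]) (simp add: vector_3_eq_iff)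
  ultimately have "perp_line k l \<subseteq> L"
    unfolding perp_line_span using sub by (intro vec.span_minimal) auto
  moreover have "vec.subspace (perp_line k l)" "vec.dim (perp_line k l) = 2"
    using perp_line_in_proj_lines[of k l] by (auto simp: proj_lines_def)
  ultimately have "perp_line k l = L"
    using sub dim by (intro vec.subspace_dim_equal) auto
  then show thesis
    using that by blast
qed

text \<open>In characteristic 2 the plus sign is also a minus, and the nonzero zeros are the vectors
  on the conic.\<close>

definition quad :: "'b::field^3 \<Rightarrow> 'b" where
  "quad v = (v $ 1)\<^sup>2 + v $ 2 * v $ 3"

context binary_field
begin

lemma conic_iff: "P \<in> conic \<longleftrightarrow> (\<exists>v. P = vec.span {v} \<and> v \<noteq> 0 \<and> quad (v::'a^3) = 0)"
proof
  assume "P \<in> conic"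
  then consider \<xi> where "P = vec.span {vector [\<xi>, \<xi>\<^sup>2, 1]}" | "P = vec.span {vector [0, 1, 0]}"
    by (auto simp: conic_def)
  then show "\<exists>v. P = vec.span {v} \<and> v \<noteq> 0 \<and> quad v = 0"
  proof cases
    case (1 \<xi>)
    then show ?thesis
      by (intro exI[of _ "vector [\<xi>, \<xi>\<^sup>2, 1]"]) (simp add: vector_3_eq_iff quad_def char2)
  next
    case 2
    then show ?thesis
      by (intro exI[of _ "vector [0, 1, 0]"]) (simp add: vector_3_eq_iff quad_def)
  qed
next
  assume "\<exists>v. P = vec.span {v} \<and> v \<noteq> 0 \<and> quad v = 0"
  then obtain v :: "'a^3" where v: "P = vec.span {v}" "v \<noteq> 0" "quad v = 0" by blast
  have eq: "vec.span {v} = vec.span {w}" if "v = c *s w" "c \<noteq> 0" for c w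
    using that by (simp add: vec.span_image_scale[of "{w}" "\<lambda>_. c", simplified])
  from v have sq: "(v $ 1)\<^sup>2 = v $ 2 * v $ 3"
    by (simp add: quad_def add_eq_0)
  show "P \<in> conic"
  proof (cases "v $ 3 = 0")
    case True
    with sq have "v = v $ 2 *s vector [0, 1, 0]"
      by (simp add: vector_3_eq_iff)
    moreover from this have "v $ 2 \<noteq> 0"
      using v(2) by (metis vector_smult_lzero)
    ultimately show ?thesis
      unfolding v(1) conic_def using eq by blast
  next
    case False
    then have "v = v $ 3 *s vector [v $ 1 / v $ 3, (v $ 1 / v $ 3)\<^sup>2, 1]"
      using sq by (simp add: vector_3_eq_iff power_divide) (simp add: power2_eq_square)
    with False show ?thesis
      unfolding v(1) conic_def using eq by blast
  qed
qed

lemma span_subset_subspace: "vec.subspace L \<Longrightarrow> vec.span {v} \<subseteq> L \<longleftrightarrow> (v::'b::field^3) \<in> L"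
  using vec.span_minimal[of "{v}" L] vec.span_base[of v "{v}"] by auto

lemma exterior_iff:
  "L \<in> exterior_lines \<longleftrightarrow> L \<in> proj_lines \<and> (\<forall>v. v \<noteq> 0 \<longrightarrow> quad v = 0 \<longrightarrow> v \<notin> (L :: ('a^3) set))"
proof -
  have "(\<forall>P\<in>conic. \<not> P \<subseteq> L) \<longleftrightarrow> (\<forall>v. v \<noteq> 0 \<longrightarrow> quad v = 0 \<longrightarrow> v \<notin> L)" if "L \<in> proj_lines"
  proof -
    have "vec.span {v} \<subseteq> L \<longleftrightarrow> v \<in> L" for v
      using that by (simp add: proj_lines_def span_subset_subspace)
    then show ?thesis
      unfolding Ball_def conic_iff by metis
  qed
  then show ?thesis
    unfolding exterior_lines_def by blast
qed

text \<open>Putting the point (h / x, (h / x)^2, 1) into the line equation and multiplying by x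
  gives h^2 + h = x y, which is solvable exactly when x y has trace 0. For x = 0 the line contains
  (0, 1, 0).\<close>

lemma perp_line_exterior: "perp_line x y \<in> exterior_lines \<longleftrightarrow> tr (x * y) = 1"
proof
  assume ext: "perp_line x y \<in> exterior_lines"
  then have no: "v \<notin> perp_line x y" if "v \<noteq> 0" "quad v = 0" for v
    using that by (simp add: exterior_iff)
  show "tr (x * y) = 1"
  proof (rule ccontr)
    assume "tr (x * y) \<noteq> 1"
    then have "tr (x * y) = 0"
      using tr_0_or_1 by blast
    then obtain h where h: "h\<^sup>2 + h = x * y"
      by (rule artin_schreier)
    show False
    proof (cases "x = 0")
      case True
      then show False
        using no[of "vector [0, 1, 0]"] by (simp add: vector_3_eq_iff quad_def perp_line_def)
    next
      case False
      have "x * (h / x + (h / x)\<^sup>2 * x + y) = h + h\<^sup>2 + x * y"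
        using False by (simp add: power2_eq_square algebra_simps)
      also have "\<dots> = 0"
        unfolding h[symmetric] by (simp add: add_ac char2)
      finally have "h / x + (h / x)\<^sup>2 * x + y = 0"
        using False by simp
      then show False
        using no[of "vector [h / x, (h / x)\<^sup>2, 1]"] by (simp add: vector_3_eq_iff quad_def perp_line_def char2)
    qed
  qed
next
  assume tr: "tr (x * y) = 1"
  have "v \<notin> perp_line x y" if "v \<noteq> 0" "quad v = 0" for v :: "'a^3"
  proof
    assume "v \<in> perp_line x y"
    then have 0: "v $ 1 + v $ 2 * x + v $ 3 * y = 0"
      by (simp add: perp_line_def)
    have sq: "v $ 2 * v $ 3 = (v $ 1)\<^sup>2"
      using that by (simp add: quad_def add_eq_0)
    show False
    proof (cases "v $ 3 = 0")
      case True
      with sq 0 have "v $ 2 * x = 0" "v $ 1 = 0" by auto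
      with True that tr show False
        by (auto simp: vector_3_eq_iff)
    next
      case False
      define h where "h = v $ 1 / v $ 3"
      have 1: "v $ 1 = v $ 3 * h"
        using False by (simp add: h_def)
      have 2: "v $ 2 = v $ 3 * h\<^sup>2"
        using False sq by (simp add: h_def power_divide) (simp add: power2_eq_square field_simps)
      have "v $ 3 * (h + h\<^sup>2 * x + y) = 0"
        using 0 unfolding 1 2 by (simp add: algebra_simps)
      then have "x * (h + h\<^sup>2 * x + y) = 0"
        using False by simp
      then have "(x * h)\<^sup>2 + x * h + x * y = 0"
        by (simp add: algebra_simps power2_eq_square)
      then have "(x * h)\<^sup>2 + x * h = x * y"
        by (simp only: add_eq_0)
      then show False
        using tr tr_artin_schreier[of "x * h"] by simp
    qed
  qed
  then show "perp_line x y \<in> exterior_lines"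
    by (simp add: exterior_iff perp_line_in_proj_lines)
qed

text \<open>A line through the nucleus meets the conic: adding multiples of (1, 0, 0) to another
  vector of the line changes only the first coordinate, which can be made the square root of the
  product of the other two. So an exterior line misses the nucleus.\<close>

lemma exterior_line_coords:
  assumes "(L :: ('a^3) set) \<in> exterior_lines"
  obtains x y where "L = perp_line x y" "tr (x * y) = 1"
proof -
  have L: "L \<in> proj_lines" "\<And>v. v \<noteq> 0 \<Longrightarrow> quad v = 0 \<Longrightarrow> v \<notin> L"
    using assms by (auto simp: exterior_iff)
  then have sub: "vec.subspace L" and dim: "vec.dim L = 2"
    by (auto simp: proj_lines_def)
  have "vector [1, 0, 0] \<notin> L"
  proof
    let ?e = "vector [1, 0, 0] :: 'a^3"
    assume e: "?e \<in> L"
    have "\<not> L \<subseteq> vec.span {?e}"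
    proof
      assume "L \<subseteq> vec.span {?e}"
      then have "vec.dim L \<le> card {?e}"
        by (intro vec.dim_le_card) auto
      then show False
        using dim by simp
    qed
    then obtain w where w: "w \<in> L" "w \<notin> vec.span {?e}" by blast
    have wsh: "w + k *s ?e \<in> L" for k
      using w e sub by (simp add: vec.subspace_add vec.subspace_scale)
    define v where "v = w + (w $ 1 + sqr (w $ 2 * w $ 3)) *s ?e"
    have v: "v $ 1 = sqr (w $ 2 * w $ 3)" "v $ 2 = w $ 2" "v $ 3 = w $ 3"
      by (simp_all add: v_def char2)
    have "quad v = 0"
      by (simp add: quad_def v power_mult_distrib char2)
    moreover have "v \<noteq> 0"
    proof
      assume "v = 0"
      then have "w $ 2 = 0" "w $ 3 = 0"
        using v by simp_all
      then have "w = w $ 1 *s ?e"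
        by (simp add: vector_3_eq_iff)
      then have "w \<in> vec.span {?e}"
        by (metis insertI1 vec.span_base vec.span_scale)
      with w show False by simp
    qed
    moreover have "v \<in> L"
      unfolding v_def by (rule wsh)
    ultimately show False
      using L(2) by blast
  qed
  then obtain x y where xy: "L = perp_line x y"
    using proj_line_is_perp_line[OF L(1)] by blast
  with assms that show thesis
    by (simp add: perp_line_exterior)
qed

lemma Gamma_iff:
  "(l, n) \<in> Gamma a \<longleftrightarrow> (\<exists>x y z u. l = perp_line x y \<and> n = perp_line z u \<and>
     tr (x * y) = 1 \<and> tr (z * u) = 1 \<and> rho_hat x y z u = a)"
  by (auto simp: Gamma_def perp_line_exterior) blast

lemma Gamma_perp_line_iff:
  "(perp_line x y, perp_line z u) \<in> Gamma a \<longleftrightarrow> tr (x * y) = 1 \<and> tr (z * u) = 1 \<and> rho_hat x y z u = a"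
  unfolding Gamma_iff perp_line_inj by blast

section \<open>The group\<close>

text \<open>Maps of vectors are easier to compose and invert than the permutations of subspaces they
  induce; \<open>PGammaL2_eq\<close> makes the passage.\<close>

definition G :: "('a^3 \<Rightarrow> 'a^3) set" where
  "G = {f. semilinear_bij f \<and> image f ` conic = conic}"

text \<open>Elements of \<open>GL\<close> preserve every \<open>Gamma a\<close>, whereas those of
  \<open>G\<close> preserve only every \<open>Delta m a\<close>.\<close>

definition GL :: "('a^3 \<Rightarrow> 'a^3) set" where
  "GL = {f \<in> G. \<forall>c v. f (c *s v) = c *s f v}"

end

section \<open>Field automorphisms and semilinear bijections\<close>

lemma field_automorphism_simps:
  assumes "field_automorphism \<sigma>"
  shows "\<sigma> (a + b) = \<sigma> a + \<sigma> b" "\<sigma> (a * b) = \<sigma> a * \<sigma> b" "\<sigma> 0 = 0" "\<sigma> 1 = (1::'b::field)"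
    "\<sigma> (a ^ n) = \<sigma> a ^ n" "\<sigma> a = \<sigma> b \<longleftrightarrow> a = b"
proof -
  show add: "\<sigma> (a + b) = \<sigma> a + \<sigma> b" for a b
    using assms by (simp add: field_automorphism_def)
  show mult: "\<sigma> (a * b) = \<sigma> a * \<sigma> b" for a b
    using assms by (simp add: field_automorphism_def)
  show zero: "\<sigma> 0 = 0"
    using add[of 0 0] by (metis add.right_neutral add_left_cancel)
  show inj: "\<sigma> a = \<sigma> b \<longleftrightarrow> a = b" for a b
    using assms by (metis bij_pointE field_automorphism_def)
  have "\<sigma> 1 \<noteq> 0"
    using inj[of 1 0] zero by simp
  then show one: "\<sigma> 1 = 1"
    using mult[of 1 1] by simp
  show "\<sigma> (a ^ n) = \<sigma> a ^ n"
    by (induction n) (simp_all add: one mult)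
qed

lemma field_automorphism_id: "field_automorphism id"
  by (simp add: field_automorphism_def)

lemma field_automorphism_inv:
  assumes "field_automorphism \<sigma>"
  shows "field_automorphism (inv \<sigma>)"
proof -
  have b: "bij \<sigma>"
    using assms by (simp add: field_automorphism_def)
  have s: "\<sigma> (inv \<sigma> a) = a" for a
    using b by (simp add: bij_is_surj surj_f_inv_f)
  have "inv \<sigma> (a + b) = inv \<sigma> a + inv \<sigma> b" "inv \<sigma> (a * b) = inv \<sigma> a * inv \<sigma> b" for a b
    by (simp_all add: inv_f_eq[OF bij_is_inj[OF b]] field_automorphism_simps[OF assms] s)
  with b show ?thesis
    by (simp add: field_automorphism_def bij_imp_bij_inv)
qed

lemma field_automorphism_comp:
  "field_automorphism \<sigma> \<Longrightarrow> field_automorphism \<tau> \<Longrightarrow> field_automorphism (\<sigma> \<circ> \<tau>)"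
  unfolding field_automorphism_def by (simp add: bij_comp)

lemma semilinear_bijE:
  assumes "semilinear_bij f"
  obtains \<sigma> where "bij f" "\<And>u v. f (u + v) = f u + f v" "field_automorphism \<sigma>" "\<And>c v. f (c *s v) = \<sigma> c *s f v"
  using assms by (auto simp: semilinear_bij_def)

text \<open>The automorphism stays explicit here because \<open>image_Gamma\<close> has to know that
  the inverse map is twisted by \<open>inv \<sigma>\<close>.\<close>

lemma semilinear_inv:
  assumes "bij f" "\<And>u v. f (u + v) = f u + f v" "field_automorphism \<sigma>" "\<And>c v. f (c *s v) = \<sigma> c *s f v"
  shows "inv f (u + v) = inv f u + inv f v" "inv f (c *s v) = inv \<sigma> c *s inv f v"
proof -
  have s: "f (inv f v) = v" for v
    using assms(1) by (simp add: bij_is_surj surj_f_inv_f)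
  have "\<sigma> (inv \<sigma> c) = c" for c
    using assms(3) by (simp add: field_automorphism_def bij_is_surj surj_f_inv_f)
  then show "inv f (u + v) = inv f u + inv f v" "inv f (c *s v) = inv \<sigma> c *s inv f v"
    by (simp_all add: inv_f_eq[OF bij_is_inj[OF assms(1)]] assms s)
qed

lemma semilinear_bij_inv:
  assumes "semilinear_bij f"
  shows "semilinear_bij (inv f)"
proof -
  obtain \<sigma> where f: "bij f" "\<And>u v. f (u + v) = f u + f v" "field_automorphism \<sigma>" "\<And>c v. f (c *s v) = \<sigma> c *s f v"
    using assms by (rule semilinear_bijE) blast
  show ?thesis
    unfolding semilinear_bij_def
    using bij_imp_bij_inv[OF f(1)] semilinear_inv[OF f] field_automorphism_inv[OF f(3)] by blast
qed

lemma semilinear_bij_comp: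
  assumes "semilinear_bij f" "semilinear_bij g"
  shows "semilinear_bij (f \<circ> g)"
proof -
  obtain \<sigma> where f: "bij f" "\<And>u v. f (u + v) = f u + f v" "field_automorphism \<sigma>" "\<And>c v. f (c *s v) = \<sigma> c *s f v"
    using assms(1) by (rule semilinear_bijE) blast
  obtain \<tau> where g: "bij g" "\<And>u v. g (u + v) = g u + g v" "field_automorphism \<tau>" "\<And>c v. g (c *s v) = \<tau> c *s g v"
    using assms(2) by (rule semilinear_bijE) blast
  have "\<forall>c v. (f \<circ> g) (c *s v) = (\<sigma> \<circ> \<tau>) c *s (f \<circ> g) v"
    by (simp add: f g)
  with f g show ?thesis
    unfolding semilinear_bij_def by (metis bij_comp comp_apply field_automorphism_comp)
qed

lemma semilinear_image_span:
  assumes "semilinear_bij f"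
  shows "f ` vec.span {v} = vec.span {f v}"
proof -
  obtain \<sigma> where f: "bij f" "\<And>u v. f (u + v) = f u + f v" "field_automorphism \<sigma>" "\<And>c v. f (c *s v) = \<sigma> c *s f v"
    using assms by (rule semilinear_bijE) blast
  have "\<exists>x. c = \<sigma> x" for c
    using f(3) by (metis field_automorphism_def bij_pointE)
  then show ?thesis
    using f(4) by (auto simp: vec.span_singleton image_iff)
qed

context binary_field
begin

lemma quad_image_eq_0:
  assumes "f \<in> G" "v \<noteq> 0" "quad v = 0"
  shows "quad (f v) = 0"
proof -
  have f: "semilinear_bij f" "image f ` conic = conic"
    using assms by (auto simp: G_def)
  have "vec.span {v} \<in> conic"
    using assms conic_iff by blast
  then have "vec.span {f v} \<in> conic"
    using f semilinear_image_span by blast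
  then obtain w where w: "vec.span {f v} = vec.span {w}" "quad w = 0"
    using conic_iff by blast
  then have "f v \<in> vec.span {w}"
    by (metis insertI1 vec.span_base)
  then obtain c where "f v = c *s w"
    by (auto simp: vec.span_singleton)
  then have "quad (f v) = c\<^sup>2 * quad w"
    by (simp add: quad_def power2_eq_square algebra_simps)
  with w show ?thesis by simp
qed

lemma G_inv:
  assumes "f \<in> G"
  shows "inv f \<in> G"
proof -
  have f: "semilinear_bij f" "image f ` conic = conic"
    using assms by (auto simp: G_def)
  have "bij f"
    using f by (simp add: semilinear_bij_def)
  have "image (inv f) ` conic = image (inv f) ` image f ` conic"
    by (simp only: f(2))
  also have "\<dots> = conic"
    using \<open>bij f\<close> by (simp add: image_comp comp_def image_inv_f_f bij_is_inj)
  finally show ?thesis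
    using f semilinear_bij_inv by (auto simp: G_def)
qed

lemma G_comp:
  assumes "f \<in> G" "g \<in> G"
  shows "f \<circ> g \<in> G"
proof -
  have "image (f \<circ> g) ` conic = image f ` image g ` conic"
    by (simp add: image_comp comp_def)
  then show ?thesis
    using assms semilinear_bij_comp by (auto simp: G_def)
qed

lemma GL_inv: "f \<in> GL \<Longrightarrow> inv f \<in> GL"
proof -
  assume f: "f \<in> GL"
  then have "bij f" "\<And>u v. f (u + v) = f u + f v" "\<And>c v. f (c *s v) = id c *s f v"
    by (auto simp: GL_def G_def semilinear_bij_def)
  then have "inv f (c *s v) = c *s inv f v" for c v
    using semilinear_inv[of f id] field_automorphism_id by (simp add: inv_id)
  then show ?thesis
    using f G_inv by (auto simp: GL_def)
qed

lemma GL_comp: "f \<in> GL \<Longrightarrow> g \<in> GL \<Longrightarrow> f \<circ> g \<in> GL"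
  using G_comp by (auto simp: GL_def)

text \<open>m is odd and greater than 1, so q is at least 8 and the q - 1 nonzero elements are too
  many roots for degree 2.\<close>

lemma quadratic_vanishes:
  assumes "\<And>t. t \<noteq> 0 \<Longrightarrow> A + t * B + t\<^sup>2 * C = (0::'a)"
  shows "A = 0" "B = 0" "C = 0"
proof -
  have "[:A, B, C:] = 0"
  proof (rule ccontr)
    assume p: "[:A, B, C:] \<noteq> 0"
    have "m \<ge> 3"
      using m_gt odd by (cases "m = 2") auto
    then have "(2::nat) ^ 3 \<le> 2 ^ m"
      by (intro power_increasing) auto
    then have "8 \<le> CARD('a)"
      by (simp add: card)
    moreover have "card (UNIV - {0::'a}) \<le> card {t. poly [:A, B, C:] t = 0}"
      using assms poly_roots_finite[OF p]
      by (intro card_mono) (auto simp: algebra_simps power2_eq_square)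
    moreover have "card {t. poly [:A, B, C:] t = 0} \<le> degree [:A, B, C:]"
      using p by (rule card_poly_roots_bound)
    moreover have "degree [:A, B, C:] \<le> 2"
      by (simp add: degree_pCons_eq_if)
    ultimately show False
      by (simp add: card_Diff_singleton)
  qed
  then show "A = 0" "B = 0" "C = 0" by auto
qed

text \<open>This is the pullback on line coordinates by the linear map with columns (l, 0, 0), (p,
  \<alpha>, \<gamma>), (r, \<beta>, \<delta>). The hypotheses say that the last two columns are
  zeros of \<open>quad\<close> and that the map scales \<open>quad\<close> by l^2. In
  \<open>rho_form\<close> the translations p and r drop out of the displacements.\<close>

lemma rho_transform:
  fixes l :: 'a
  assumes p: "p\<^sup>2 = \<alpha> * \<gamma>" and r: "r\<^sup>2 = \<beta> * \<delta>" and l: "\<alpha> * \<delta> + \<beta> * \<gamma> = l\<^sup>2" "l \<noteq> 0"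
  shows "rho_hat ((p + \<alpha> * x + \<gamma> * y) / l) ((r + \<beta> * x + \<delta> * y) / l)
     ((p + \<alpha> * z + \<gamma> * u) / l) ((r + \<beta> * z + \<delta> * u) / l) = rho_hat x y z u"
proof -
  define X Y Z U where "X = (p + \<alpha> * x + \<gamma> * y) / l" and "Y = (r + \<beta> * x + \<delta> * y) / l"
    and "Z = (p + \<alpha> * z + \<gamma> * u) / l" and "U = (r + \<beta> * z + \<delta> * u) / l"
  have lX: "l * X = p + \<alpha> * x + \<gamma> * y" and lY: "l * Y = r + \<beta> * x + \<delta> * y"
    and lZ: "l * Z = p + \<alpha> * z + \<gamma> * u" and lU: "l * U = r + \<beta> * z + \<delta> * u"
    using l by (simp_all add: X_def Y_def Z_def U_def)
  define s t where "s = x + z" and "t = y + u"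
  define P R where "P = \<alpha> * s + \<gamma> * t" and "R = \<beta> * s + \<delta> * t"
  have P: "l * X + l * Z = P" and R: "l * Y + l * U = R"
    unfolding lX lY lZ lU P_def R_def s_def t_def by (simp_all add: algebra_simps char2)
  \<comment> \<open>Cramer's rule for the displacements, whose matrix has determinant l^2. The
    factor l^4 in the next computation clears all denominators.\<close>
  have 1: "\<alpha> * R + \<beta> * P = l\<^sup>2 * t" and 2: "\<gamma> * R + \<delta> * P = l\<^sup>2 * s"
    unfolding P_def R_def l(1)[symmetric] by (simp_all add: algebra_simps char2)
  have "l\<^sup>2 * l\<^sup>2 * rho_hat X Y Z U = (l * X)\<^sup>2 * (l * Y + l * U)\<^sup>2 + l\<^sup>2 * ((l * X + l * Z) * (l * Y + l * U)) + (l * Y)\<^sup>2 * (l * X + l * Z)\<^sup>2"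
    unfolding rho_form by (simp add: algebra_simps power2_eq_square)
  also have "\<dots> = (l * X)\<^sup>2 * R\<^sup>2 + l\<^sup>2 * (P * R) + (l * Y)\<^sup>2 * P\<^sup>2"
    by (simp only: P R)
  also have "\<dots> = (\<alpha> * \<gamma> + (\<alpha> * x + \<gamma> * y)\<^sup>2) * R\<^sup>2 + (\<alpha> * \<delta> + \<beta> * \<gamma>) * (P * R) + (\<beta> * \<delta> + (\<beta> * x + \<delta> * y)\<^sup>2) * P\<^sup>2"
    by (simp only: lX lY square_add p r add.assoc l(1))
  also have "\<dots> = (\<alpha> * R + \<beta> * P) * (\<gamma> * R + \<delta> * P) + (x * (\<alpha> * R + \<beta> * P) + y * (\<gamma> * R + \<delta> * P))\<^sup>2"
    by (simp add: algebra_simps power2_eq_square char2)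
  also have "\<dots> = l\<^sup>2 * l\<^sup>2 * rho_hat x y z u"
    unfolding 1 2 rho_form s_def[symmetric] t_def[symmetric] by (simp add: algebra_simps power2_eq_square char2)
  finally have "rho_hat X Y Z U = rho_hat x y z u"
    using l by simp
  then show ?thesis
    by (simp only: X_def Y_def Z_def U_def)
qed

lemma field_automorphism_rho:
  assumes "field_automorphism \<sigma>"
  shows "\<sigma> (rho_hat x y z u) = rho_hat (\<sigma> x) (\<sigma> y) (\<sigma> z) (\<sigma> (u::'a))"
  by (simp add: rho_hat_def field_automorphism_simps[OF assms])

text \<open>The quartic polynomial \<open>quad (f (t, t\<^sup>2, 1))\<close> vanishes identically, which forces \<open>f\<close> to fix the
  nucleus \<open>(1, 0, 0)\<close> and to preserve \<open>quad\<close> up to a factor.\<close>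

lemma stabilizer_coords:
  assumes f: "f \<in> G" and \<sigma>: "field_automorphism \<sigma>" and scale: "\<And>c v. f (c *s v) = \<sigma> c *s f v"
  obtains T1 T2 where
    "\<And>x y v. f v \<in> perp_line x y \<longleftrightarrow> v \<in> perp_line (T1 x y) (T2 x y)"
    "\<And>x y z u. \<sigma> (rho_hat (T1 x y) (T2 x y) (T1 z u) (T2 z u)) = rho_hat x y z u"
proof -
  note \<sigma>s = field_automorphism_simps[OF \<sigma>]
  have \<sigma>inv: "\<sigma> (inv \<sigma> c) = c" for c
    using \<sigma> by (simp add: field_automorphism_def bij_is_surj surj_f_inv_f)
  have bij: "bij f" and add: "\<And>u v. f (u + v) = f u + f v"
    using f by (auto simp: G_def semilinear_bij_def)
  define h1 h2 h3 where "h1 = f (vector [1, 0, 0])" and "h2 = f (vector [0, 1, 0])" and "h3 = f (vector [0, 0, 1])"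
  have fv: "f v = \<sigma> (v $ 1) *s h1 + \<sigma> (v $ 2) *s h2 + \<sigma> (v $ 3) *s h3" for v
  proof -
    have "v = v $ 1 *s vector [1, 0, 0] + v $ 2 *s vector [0, 1, 0] + v $ 3 *s vector [0, 0, 1]"
      by (simp add: vector_3_eq_iff)
    then have "f v = f (v $ 1 *s vector [1, 0, 0] + v $ 2 *s vector [0, 1, 0] + v $ 3 *s vector [0, 0, 1])"
      by simp
    then show ?thesis
      by (simp only: add scale h1_def h2_def h3_def)
  qed
  have q2: "quad h2 = 0" and q3: "quad h3 = 0"
    unfolding h2_def h3_def by (rule quad_image_eq_0[OF f]; simp add: vector_3_eq_iff quad_def)+
  have z1: "quad (t *s h1 + t\<^sup>2 *s h2 + h3) = 0" for t
  proof -
    let ?v = "vector [inv \<sigma> t, (inv \<sigma> t)\<^sup>2, 1] :: 'a^3"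
    have "f ?v = t *s h1 + t\<^sup>2 *s h2 + h3"
      by (simp add: fv \<sigma>s \<sigma>inv)
    moreover have "quad (f ?v) = 0"
      by (rule quad_image_eq_0[OF f]) (simp_all add: vector_3_eq_iff quad_def char2)
    ultimately show ?thesis by simp
  qed
  \<comment> \<open>\<open>quad h2\<close> and \<open>quad h3\<close> are 0 because (0, 1, 0) and
    (0, 0, 1) lie on the conic. Cancelling one \<open>t\<close> leaves a quadratic.\<close>
  have z2: "quad (t *s h1 + t\<^sup>2 *s h2 + h3) = t * ((h1$2 * h3$3 + h1$3 * h3$2) +
      t * (quad h1 + (h2$2 * h3$3 + h2$3 * h3$2)) + t\<^sup>2 * (h1$2 * h2$3 + h1$3 * h2$2)) +
      t\<^sup>2 * t\<^sup>2 * quad h2 + quad h3" for t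
    unfolding quad_def by (simp add: algebra_simps power2_eq_square char2)
  have van: "(h1$2 * h3$3 + h1$3 * h3$2) +
      t * (quad h1 + (h2$2 * h3$3 + h2$3 * h3$2)) + t\<^sup>2 * (h1$2 * h2$3 + h1$3 * h2$2) = 0" if "t \<noteq> 0" for t
    using z1[of t, unfolded z2 q2 q3] that by simp
  note v = quadratic_vanishes[OF van]
  \<comment> \<open>The left side is the polar form of \<open>quad\<close> at \<open>h1\<close> and
    \<open>w\<close>. The vanishing coefficients make \<open>h1\<close> orthogonal to
    \<open>h2\<close> and \<open>h3\<close>, hence to every image under \<open>f\<close>; so
    \<open>h1\<close> lies in the radical, spanned by (1, 0, 0).\<close>
  have "h1$3 * w$2 + h1$2 * w$3 = 0" for w :: "'a^3"
  proof -
    obtain u where u: "w = f u"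
      using bij by (metis bij_pointE)
    have "h1$3 * w$2 + h1$2 * w$3 = \<sigma> (u$2) * (h1$2 * h2$3 + h1$3 * h2$2) + \<sigma> (u$3) * (h1$2 * h3$3 + h1$3 * h3$2)"
      unfolding u fv by (simp add: algebra_simps char2)
    then show ?thesis
      by (simp add: v)
  qed
  from this[of "vector [0, 1, 0]"] this[of "vector [0, 0, 1]"] have h1: "h1$3 = 0" "h1$2 = 0"
    by simp_all
  define l where "l = h1 $ 1"
  have "f 0 = 0"
    using add[of 0 0] by simp
  then have "h1 \<noteq> 0"
    using bij unfolding h1_def by (metis bij_pointE one_neq_zero vector_3(1) zero_index)
  then have l0: "l \<noteq> 0"
    using h1 by (simp add: vector_3_eq_iff l_def)
  have l: "h2$2 * h3$3 + h3$2 * h2$3 = l\<^sup>2"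
    using v(2) h1 by (simp add: quad_def add_eq_0 l_def mult.commute)
  have p: "(h2$1)\<^sup>2 = h2$2 * h2$3" and r: "(h3$1)\<^sup>2 = h3$2 * h3$3"
    using q2 q3 by (simp_all add: quad_def add_eq_0)
  \<comment> \<open>The line equation pulled back along \<open>f\<close> has first coefficient
    \<open>l\<close>; dividing by it restores the form of \<open>perp_line\<close>.\<close>
  define X Y where "X x y = (h2$1 + h2$2 * x + h2$3 * y) / l" and "Y x y = (h3$1 + h3$2 * x + h3$3 * y) / l" for x y
  have lX: "l * X x y = h2$1 + h2$2 * x + h2$3 * y" and lY: "l * Y x y = h3$1 + h3$2 * x + h3$3 * y" for x y
    using l0 by (simp_all add: X_def Y_def)
  show thesis
  proof (rule that[of "\<lambda>x y. inv \<sigma> (X x y)" "\<lambda>x y. inv \<sigma> (Y x y)"])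
    fix x y v
    have "f v \<in> perp_line x y \<longleftrightarrow> l * \<sigma> (v$1) + \<sigma> (v$2) * (l * X x y) + \<sigma> (v$3) * (l * Y x y) = 0"
      unfolding perp_line_def fv lX lY by (simp add: h1 l_def algebra_simps)
    also have "\<dots> \<longleftrightarrow> l * \<sigma> (v$1 + v$2 * inv \<sigma> (X x y) + v$3 * inv \<sigma> (Y x y)) = 0"
      by (simp add: \<sigma>s \<sigma>inv algebra_simps)
    also have "\<dots> \<longleftrightarrow> \<sigma> (v$1 + v$2 * inv \<sigma> (X x y) + v$3 * inv \<sigma> (Y x y)) = \<sigma> 0"
      using l0 by (simp add: \<sigma>s(3))
    also have "\<dots> \<longleftrightarrow> v \<in> perp_line (inv \<sigma> (X x y)) (inv \<sigma> (Y x y))"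
      unfolding \<sigma>s(6) by (simp add: perp_line_def)
    finally show "f v \<in> perp_line x y \<longleftrightarrow> v \<in> perp_line (inv \<sigma> (X x y)) (inv \<sigma> (Y x y))" .
  next
    fix x y z u
    show "\<sigma> (rho_hat (inv \<sigma> (X x y)) (inv \<sigma> (Y x y)) (inv \<sigma> (X z u)) (inv \<sigma> (Y z u))) = rho_hat x y z u"
      unfolding field_automorphism_rho[OF \<sigma>] \<sigma>inv X_def Y_def
      by (rule rho_transform[OF p r l l0])
  qed
qed

lemma image_exterior_line:
  assumes f: "f \<in> G" and L: "perp_line x y \<in> exterior_lines" "f ` perp_line x y = perp_line x' y'"
  shows "perp_line x' y' \<in> exterior_lines"
  unfolding exterior_iff
proof (intro conjI allI impI)
  fix v :: "'a^3" assume v: "v \<noteq> 0" "quad v = 0"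
  have bij: "bij f" "bij (inv f)"
    using f by (auto simp: G_def semilinear_bij_def bij_imp_bij_inv)
  have "quad (inv f v) = 0"
    by (rule quad_image_eq_0[OF G_inv[OF f] v])
  moreover have "f 0 = 0"
    using f by (metis (no_types, lifting) G_def add_0 add_cancel_left_left mem_Collect_eq semilinear_bij_def)
  then have "inv f v \<noteq> 0"
    using v bij by (metis bij_inv_eq_iff)
  ultimately have "inv f v \<notin> perp_line x y"
    using L(1) by (simp add: exterior_iff)
  then show "v \<notin> perp_line x' y'"
    unfolding L(2)[symmetric] using bij(1) by (auto simp: bij_is_inj)
qed (rule perp_line_in_proj_lines)

text \<open>\<open>stabilizer_coords\<close> describes preimages of lines, so it is applied to
  \<open>inv f\<close>; its twist by \<open>inv \<sigma>\<close> turns \<open>a\<close> into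
  \<open>\<sigma> a\<close>.\<close>

lemma image_Gamma:
  assumes f: "f \<in> G" and \<sigma>: "field_automorphism \<sigma>" and scale: "\<And>c v. f (c *s v) = \<sigma> c *s f v"
    and ln: "(l, n) \<in> Gamma a"
  shows "(f ` l, f ` n) \<in> Gamma (\<sigma> a)"
proof -
  have bij: "bij f" and add: "\<And>u v. f (u + v) = f u + f v"
    using f by (auto simp: G_def semilinear_bij_def)
  have \<sigma>': "field_automorphism (inv \<sigma>)"
    using \<sigma> by (rule field_automorphism_inv)
  have \<sigma>inv: "\<sigma> (inv \<sigma> c) = c" for c
    using \<sigma> by (simp add: field_automorphism_def bij_is_surj surj_f_inv_f)
  obtain T1 T2 where T:
    "\<And>x y v. inv f v \<in> perp_line x y \<longleftrightarrow> v \<in> perp_line (T1 x y) (T2 x y)"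
    "\<And>x y z u. inv \<sigma> (rho_hat (T1 x y) (T2 x y) (T1 z u) (T2 z u)) = rho_hat x y z u"
    using stabilizer_coords[OF G_inv[OF f] \<sigma>' semilinear_inv(2)[OF bij add \<sigma> scale]] by metis
  have im: "f ` perp_line x y = perp_line (T1 x y) (T2 x y)" for x y
    using T(1) bij by (simp add: set_eq_iff bij_image_Collect_eq) (metis bij_image_Collect_eq Collect_mem_eq mem_Collect_eq)
  obtain x y z u where c: "l = perp_line x y" "n = perp_line z u" "tr (x * y) = 1" "tr (z * u) = 1" "rho_hat x y z u = a"
    using ln by (auto simp: Gamma_iff)
  have "tr (T1 x y * T2 x y) = 1" "tr (T1 z u * T2 z u) = 1"
    using image_exterior_line[OF f _ im] c by (simp_all add: perp_line_exterior)
  moreover have "rho_hat (T1 x y) (T2 x y) (T1 z u) (T2 z u) = \<sigma> a"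
    using T(2)[of x y z u] \<sigma>inv c by metis
  ultimately show ?thesis
    by (simp add: c im Gamma_perp_line_iff)
qed

section \<open>Frobenius classes\<close>

lemma pow2_pow2: "((a::'a) ^ (2 ^ i)) ^ (2 ^ j) = a ^ (2 ^ (i + j))"
  by (simp add: power_add flip: power_mult)

lemma pow2_add_mult_m: "(a::'a) ^ (2 ^ (i + m * j)) = a ^ (2 ^ i)"
proof (induction j)
  case (Suc j)
  have "a ^ (2 ^ (i + m * Suc j)) = (a ^ (2 ^ (i + m * j))) ^ (2 ^ m)"
    unfolding pow2_pow2 by (simp add: algebra_simps)
  then show ?case
    by (simp only: power_card_eq Suc)
qed simp

lemma pow2_mod: "(a::'a) ^ (2 ^ (i mod m)) = a ^ (2 ^ i)"
  by (metis mult_div_mod_eq add.commute pow2_add_mult_m)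

lemma pow2_inj: "x ^ (2 ^ i) = y ^ (2 ^ i) \<longleftrightarrow> x = (y::'a)"
proof (induction i)
  case (Suc i)
  have "x ^ (2 ^ Suc i) = (x ^ (2 ^ i))\<^sup>2" for x :: 'a
    by (simp add: mult.commute flip: power_mult)
  then show ?case
    using Suc by (simp only: square_inj)
qed simp

lemma frob_class_pow: "a ^ (2 ^ i) \<in> frob_class m (a::'a)"
proof -
  have "i mod m < m"
    using m_gt by simp
  then show ?thesis
    unfolding frob_class_def using pow2_mod[of a i] by (intro CollectI exI[of _ "i mod m"]) simp
qed

lemma frob_class_iff: "b \<in> frob_class m a \<longleftrightarrow> (\<exists>i. b = a ^ (2 ^ i))" for a :: 'a
  using frob_class_pow by (auto simp: frob_class_def)

lemma frob_class_refl: "a \<in> frob_class m (a::'a)"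
  using frob_class_pow[of a 0] by simp

lemma frob_class_eq:
  assumes "b \<in> frob_class m (a::'a)"
  shows "frob_class m b = frob_class m a"
proof -
  have sub: "frob_class m b \<subseteq> frob_class m a" if "b \<in> frob_class m a" for a b :: 'a
    using that by (auto simp: frob_class_iff pow2_pow2)
  obtain i where i: "i < m" "b = a ^ (2 ^ i)"
    using assms by (auto simp: frob_class_def)
  have "b ^ (2 ^ (m - i)) = a"
    using i power_card_eq by (simp add: pow2_pow2)
  then have "a \<in> frob_class m b"
    using frob_class_iff by metis
  with assms sub show ?thesis by blast
qed

lemma tr_pow2: "tr (a ^ (2 ^ i)) = tr a"
proof (induction i)
  case (Suc i)
  have "a ^ (2 ^ Suc i) = (a ^ (2 ^ i))\<^sup>2"
    by (simp add: mult.commute flip: power_mult)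
  then show ?case
    by (simp only: tr_square Suc)
qed simp

lemma trace0_star_pow2: "a ^ (2 ^ i) \<in> trace0_star m \<longleftrightarrow> (a::'a) \<in> trace0_star m"
  by (simp add: trace0_star_def tr_pow2)

lemma trace0_star_frob_class: "b \<in> frob_class m a \<Longrightarrow> b \<in> trace0_star m \<longleftrightarrow> (a::'a) \<in> trace0_star m"
  using trace0_star_pow2 by (auto simp: frob_class_iff)

text \<open>If two conjugates agree, the Frobenius power with exponent j - i fixes \<open>a\<close>.
  As m is prime, a multiple of j - i is 1 modulo m, so a^2 = a; but neither 0 nor 1 is in
  \<open>trace0_star m\<close>.\<close>

lemma frob_distinct:
  assumes "prime m" and a: "a \<in> trace0_star m" and eq: "a ^ (2 ^ i) = (a::'a) ^ (2 ^ j)" and ij: "i < m" "j < m"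
  shows "i = j"
proof -
  have False if "a ^ (2 ^ i) = a ^ (2 ^ j)" "i < j" "j < m" for i j
  proof -
    have "(a ^ (2 ^ (j - i))) ^ (2 ^ i) = a ^ (2 ^ i)"
      using that by (simp add: pow2_pow2)
    then have d: "a ^ (2 ^ (j - i)) = a"
      by (simp only: pow2_inj)
    have "\<not> m dvd (j - i)"
      using that by (auto dest: dvd_imp_le)
    then have "coprime (j - i) m"
      using \<open>prime m\<close> prime_imp_coprime coprime_commute by blast
    then obtain c where c: "[(j - i) * c = 1] (mod m)"
      using cong_solve_coprime_nat by auto
    have "a ^ (2 ^ ((j - i) * c)) = a"
    proof (induction c)
      case (Suc c)
      have "a ^ (2 ^ ((j - i) * Suc c)) = (a ^ (2 ^ (j - i))) ^ (2 ^ ((j - i) * c))"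
        by (simp add: pow2_pow2)
      then show ?case
        by (simp only: d Suc)
    qed simp
    then have "a ^ (2 ^ 1) = a"
      using c by (metis cong_def pow2_mod)
    then have "a * a = a * 1"
      by (simp add: power2_eq_square)
    with a have "a = 1"
      by (auto simp: trace0_star_def)
    with a show False
      by (simp add: trace0_star_def)
  qed
  with eq ij show ?thesis
    by (metis nat_neq_iff)
qed

text \<open>The polynomial with roots \<open>a ^ (2 ^ i)\<close> has coefficients in the prime field, which every
  automorphism fixes.\<close>

lemma automorphism_frob_class:
  assumes \<sigma>: "field_automorphism \<sigma>"
  shows "\<sigma> (a::'a) \<in> frob_class m a"
proof -
  note \<sigma>s = field_automorphism_simps[OF \<sigma>]
  define p where "p = (\<Prod>i<m. [:a ^ (2 ^ i), 1:])"
  have p: "poly p x = (\<Prod>i<m. x + a ^ (2 ^ i))" for x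
    by (simp add: p_def poly_prod add.commute)
  have "degree p \<le> sum (degree \<circ> (\<lambda>i. [:a ^ (2 ^ i), 1:])) {..<m}"
    unfolding p_def by (rule degree_prod_sum_le) simp
  also have "\<dots> = m" by simp
  finally have deg: "degree p < CARD('a)"
    unfolding card by (rule le_less_trans[OF _ less_exp])
  have sq: "(poly p x)\<^sup>2 = poly p (x\<^sup>2)" for x
  proof -
    have "(poly p x)\<^sup>2 = (\<Prod>i<m. x\<^sup>2 + a ^ (2 ^ Suc i))"
      by (simp add: p prod_power_distrib square_add mult.commute flip: power_mult)
    moreover have "(\<Prod>i<m. x\<^sup>2 + a ^ (2 ^ Suc i)) * (x\<^sup>2 + a ^ (2 ^ 0)) = (\<Prod>i<m. x\<^sup>2 + a ^ (2 ^ i)) * (x\<^sup>2 + a ^ (2 ^ m))"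
      using prod.lessThan_Suc_shift[of "\<lambda>i. x\<^sup>2 + a ^ (2 ^ i)" m] by (simp add: mult.commute)
    ultimately have *: "(poly p x)\<^sup>2 * (x\<^sup>2 + a) = poly p (x\<^sup>2) * (x\<^sup>2 + a)"
      by (simp add: p power_card_eq)
    show ?thesis
    \<comment> \<open>Squaring shifts the product over the conjugates by one step, so comparison
      leaves the factor x^2 + a on both sides. Where it vanishes, x and x^2 are both roots of
      \<open>p\<close>.\<close>
    proof (cases "x\<^sup>2 + a = 0")
      case True
      then have "x\<^sup>2 = a"
        by (simp add: add_eq_0)
      then have "a ^ (2 ^ (m - 1)) = x"
        using sqr_eq_iff[of a x] by (simp add: sqr_def)
      then have "poly p x = 0"
        unfolding p using m_gt by (auto simp: add_eq_0 intro!: bexI[of _ "m - 1"])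
      moreover have "poly p (x\<^sup>2) = 0"
        unfolding p using m_gt \<open>x\<^sup>2 = a\<close> by (auto simp: add_eq_0 intro!: bexI[of _ 0])
      ultimately show ?thesis by simp
    qed (use * in simp)
  qed
  \<comment> \<open>\<open>q\<close> at x^2 is p(x)^2 + p(x^2), so it vanishes everywhere. Its
    degree is at most m < 2^m, hence c^2 + c = 0 for every coefficient c of
    \<open>p\<close>.\<close>
  define q where "q = (\<Sum>k\<le>degree p. monom ((coeff p k)\<^sup>2 + coeff p k) k)"
  have "poly q (x\<^sup>2) = 0" for x
  proof -
    have "poly q (x\<^sup>2) = (\<Sum>k\<le>degree p. (coeff p k * x ^ k)\<^sup>2 + coeff p k * (x\<^sup>2) ^ k)"
      unfolding q_def poly_sum poly_monom
      by (intro sum.cong refl) (simp add: distrib_right power_mult_distrib flip: power_mult, simp add: mult.commute)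
    also have "\<dots> = (poly p x)\<^sup>2 + poly p (x\<^sup>2)"
      by (simp add: sum.distrib poly_altdef sum_square)
    finally show ?thesis
      by (simp add: sq add_self)
  qed
  then have "poly q x = 0" for x
    by (metis sqr_square)
  then have roots: "{x. poly q x = 0} = UNIV" by auto
  have "q = 0"
  proof (rule ccontr)
    assume "q \<noteq> 0"
    then have "CARD('a) \<le> degree q"
      using card_poly_roots_bound[of q] roots by simp
    also have "degree q \<le> degree p"
      unfolding q_def by (intro degree_sum_le) (auto intro: order.trans[OF degree_monom_le])
    finally show False
      using deg by simp
  qed
  have "coeff p k = 0 \<or> coeff p k = 1" for k
  proof (cases "k \<le> degree p")
    case True
    have "coeff q k = (coeff p k)\<^sup>2 + coeff p k"
      using True by (simp add: q_def coeff_sum)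
    then have "coeff p k * (coeff p k + 1) = 0"
      using \<open>q = 0\<close> by (simp add: power2_eq_square algebra_simps)
    then show ?thesis
      by (simp add: add_eq_0)
  qed (simp add: coeff_eq_0)
  then have coeff: "\<sigma> (coeff p k) = coeff p k" for k
    by (metis \<sigma>s(3,4))
  have \<sigma>sum: "\<sigma> (\<Sum>i\<in>A. f i) = (\<Sum>i\<in>A. \<sigma> (f i))" for A :: "nat set" and f
    by (induction A rule: infinite_finite_induct) (auto simp: \<sigma>s)
  have "poly p a = 0"
    unfolding p using m_gt by (auto simp: add_self intro!: bexI[of _ 0])
  then have "\<sigma> (poly p a) = 0"
    by (simp add: \<sigma>s)
  then have "poly p (\<sigma> a) = 0"
    by (simp add: poly_altdef \<sigma>sum \<sigma>s coeff)
  then obtain i where "\<sigma> a + a ^ (2 ^ i) = 0"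
    unfolding p by auto
  then show ?thesis
    by (simp add: add_eq_0 frob_class_pow)
qed

section \<open>Transitivity\<close>

text \<open>The space and the conic are finite, so injectivity and one inclusion suffice.\<close>

lemma G_I:
  assumes add: "\<And>u v. f (u + v) = f u + f v" and \<sigma>: "field_automorphism \<sigma>"
    and scale: "\<And>c v. f (c *s v) = \<sigma> c *s f v" and "inj f"
    and quad: "\<And>v. quad v = 0 \<Longrightarrow> quad (f v) = 0"
  shows "f \<in> G"
proof -
  have "bij f"
    using \<open>inj f\<close> by (simp add: bij_def finite_UNIV_inj_surj)
  then have f: "semilinear_bij f"
    using add \<sigma> scale by (auto simp: semilinear_bij_def)
  have "f 0 = 0"
    using add[of 0 0] by (metis add.right_neutral add_left_cancel)
  then have "f v \<noteq> 0" if "v \<noteq> 0" for v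
    using that \<open>inj f\<close> by (metis injD)
  then have "image f ` conic \<subseteq> conic"
    using quad semilinear_image_span[OF f] by (auto simp: conic_iff) metis
  moreover have "inj_on (image f) conic"
    using \<open>inj f\<close> by (auto simp: inj_on_def inj_image_eq_iff)
  ultimately have "image f ` conic = conic"
    by (intro endo_inj_surj) auto
  with f show ?thesis
    by (simp add: G_def)
qed

text \<open>The embedding of SL(2,q) in the orthogonal group of \<open>quad\<close> when the
  determinant is 1. The matrix acts modulo the nucleus, and the square roots are forced: the images
  of (0, 1, 0) and (0, 0, 1) must be zeros of \<open>quad\<close>.\<close>

definition lin :: "'a \<Rightarrow> 'a \<Rightarrow> 'a \<Rightarrow> 'a \<Rightarrow> 'a^3 \<Rightarrow> 'a^3" where
  "lin \<alpha> \<beta> \<gamma> \<delta> v = vector [v$1 + sqr (\<alpha> * \<gamma>) * v$2 + sqr (\<beta> * \<delta>) * v$3, \<alpha> * v$2 + \<beta> * v$3, \<gamma> * v$2 + \<delta> * v$3]"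

lemma lin_nth [simp]:
  "lin \<alpha> \<beta> \<gamma> \<delta> v $ 1 = v$1 + sqr (\<alpha> * \<gamma>) * v$2 + sqr (\<beta> * \<delta>) * v$3"
  "lin \<alpha> \<beta> \<gamma> \<delta> v $ 2 = \<alpha> * v$2 + \<beta> * v$3"
  "lin \<alpha> \<beta> \<gamma> \<delta> v $ 3 = \<gamma> * v$2 + \<delta> * v$3"
  by (simp_all add: lin_def)

lemma lin_GL:
  assumes det: "\<alpha> * \<delta> + \<beta> * \<gamma> = 1"
  shows "lin \<alpha> \<beta> \<gamma> \<delta> \<in> GL"
proof -
  let ?f = "lin \<alpha> \<beta> \<gamma> \<delta>"
  have scale: "?f (c *s v) = c *s ?f v" for c v
    by (simp add: vector_3_eq_iff algebra_simps)
  have 2: "\<delta> * ?f v $ 2 + \<beta> * ?f v $ 3 = v $ 2" for v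
  proof -
    have "\<delta> * ?f v $ 2 + \<beta> * ?f v $ 3 = (\<alpha> * \<delta> + \<beta> * \<gamma>) * v $ 2"
      by (simp add: algebra_simps char2)
    then show ?thesis by (simp add: det)
  qed
  have 3: "\<gamma> * ?f v $ 2 + \<alpha> * ?f v $ 3 = v $ 3" for v
  proof -
    have "\<gamma> * ?f v $ 2 + \<alpha> * ?f v $ 3 = (\<alpha> * \<delta> + \<beta> * \<gamma>) * v $ 3"
      by (simp add: algebra_simps char2)
    then show ?thesis by (simp add: det)
  qed
  have "inj ?f"
  proof (rule injI)
    fix v w assume eq: "?f v = ?f w"
    then have "v $ 2 = w $ 2" "v $ 3 = w $ 3"
      by (metis 2, metis 3)
    moreover from this have "v $ 1 = w $ 1"
      using arg_cong[OF eq, of "\<lambda>v. v $ 1"] by simp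
    ultimately show "v = w"
      by (simp add: vector_3_eq_iff)
  qed
  moreover have "quad (?f v) = quad v" for v
  proof -
    have "quad (?f v) = (v$1)\<^sup>2 + \<alpha> * \<gamma> * (v$2)\<^sup>2 + \<beta> * \<delta> * (v$3)\<^sup>2 + (\<alpha> * v$2 + \<beta> * v$3) * (\<gamma> * v$2 + \<delta> * v$3)"
      unfolding quad_def lin_nth by (simp only: square_add power_mult_distrib sqr_square)
    also have "\<dots> = (v$1)\<^sup>2 + (\<alpha> * \<delta> + \<beta> * \<gamma>) * (v$2 * v$3)"
      by (simp add: algebra_simps power2_eq_square char2)
    finally show ?thesis
      by (simp add: det quad_def)
  qed
  ultimately have "?f \<in> G"
    using field_automorphism_id scale
    by (intro G_I[where \<sigma> = id]) (auto simp: vector_3_eq_iff algebra_simps)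
  then show ?thesis
    using scale by (simp add: GL_def)
qed

text \<open>The witness is the inverse of \<open>lin\<close>: its images of lines are preimages
  under \<open>lin\<close>, found by substitution into the equation.\<close>

lemma GL_move:
  assumes "\<alpha> * \<delta> + \<beta> * \<gamma> = 1"
  obtains g where "g \<in> GL" "\<And>x y. g ` perp_line x y =
    perp_line (sqr (\<alpha> * \<gamma>) + \<alpha> * x + \<gamma> * y) (sqr (\<beta> * \<delta>) + \<beta> * x + \<delta> * y)"
proof (rule that)
  let ?f = "lin \<alpha> \<beta> \<gamma> \<delta>"
  have f: "?f \<in> GL"
    using assms by (rule lin_GL)
  then show "inv ?f \<in> GL"
    by (rule GL_inv)
  have "bij ?f"
    using f by (auto simp: GL_def G_def semilinear_bij_def)
  fix x y
  have "inv ?f ` perp_line x y = {v. ?f v \<in> perp_line x y}"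
    using bij_vimage_eq_inv_image[OF \<open>bij ?f\<close>] by (auto simp: vimage_def)
  also have "\<dots> = perp_line (sqr (\<alpha> * \<gamma>) + \<alpha> * x + \<gamma> * y) (sqr (\<beta> * \<delta>) + \<beta> * x + \<delta> * y)"
    by (auto simp: perp_line_def algebra_simps)
  finally show "inv ?f ` perp_line x y =
    perp_line (sqr (\<alpha> * \<gamma>) + \<alpha> * x + \<gamma> * y) (sqr (\<beta> * \<delta>) + \<beta> * x + \<delta> * y)" .
qed

lemma GL_Gamma:
  assumes "g \<in> GL" "(l, n) \<in> Gamma a"
  shows "(g ` l, g ` n) \<in> Gamma (a::'a)"
  using image_Gamma[OF _ field_automorphism_id, of g l n a] assms by (simp add: GL_def)

text \<open>A matrix of determinant 1 turns the displacement of the two lines into (0, 1). Then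
  \<open>rho_form\<close> reduces to the square of the common first coordinate, which is therefore
  \<open>sqr a\<close>.\<close>

lemma normal_form:
  assumes "(l, n) \<in> Gamma a" "a \<noteq> 0"
  obtains g y where "g \<in> GL" "g ` l = perp_line (sqr a) y" "g ` n = perp_line (sqr a) (y + 1)"
proof -
  obtain x y z u where c: "l = perp_line x y" "n = perp_line z u" "tr (x * y) = 1" "rho_hat x y z u = a"
    using assms by (auto simp: Gamma_iff)
  define s t where "s = x + z" and "t = y + u"
  have "s \<noteq> 0 \<or> t \<noteq> 0"
    using rho_eq_0[OF c(3), of z u] c(4) assms(2) by (auto simp: s_def t_def add_eq_0)
  \<comment> \<open>With \<alpha> = t and \<gamma> = s the first coordinates differ by t s + s t =
    0; \<beta> and \<delta> complete the matrix to determinant 1, and that is the difference of the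
    second ones.\<close>
  then obtain \<beta> \<delta> where bd: "t * \<delta> + \<beta> * s = 1"
    by (metis add_0 add.right_neutral mult_zero_left mult_zero_right nonzero_eq_divide_eq mult.commute)
  obtain g where g: "g \<in> GL" "\<And>x y. g ` perp_line x y =
    perp_line (sqr (t * s) + t * x + s * y) (sqr (\<beta> * \<delta>) + \<beta> * x + \<delta> * y)"
    using GL_move[OF bd] by blast
  define c y' where "c = sqr (t * s) + t * x + s * y" and "y' = sqr (\<beta> * \<delta>) + \<beta> * x + \<delta> * y"
  have z: "z = x + s" and u: "u = y + t"
    by (simp_all add: s_def t_def char2)
  have z': "sqr (t * s) + t * z + s * u = c"
    unfolding z u c_def by (simp add: algebra_simps char2)
  have "sqr (\<beta> * \<delta>) + \<beta> * z + \<delta> * u = y' + (t * \<delta> + \<beta> * s)"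
    unfolding z u y'_def by (simp add: algebra_simps)
  then have u': "sqr (\<beta> * \<delta>) + \<beta> * z + \<delta> * u = y' + 1"
    unfolding bd .
  have gl: "g ` l = perp_line c y'" "g ` n = perp_line c (y' + 1)"
    unfolding \<open>l = _\<close> \<open>n = _\<close> g(2) z' u' by (simp_all only: c_def y'_def)
  have "(perp_line c y', perp_line c (y' + 1)) \<in> Gamma a"
    using GL_Gamma[OF g(1) assms(1)] gl by simp
  then have "a = c\<^sup>2"
    by (simp add: Gamma_perp_line_iff rho_form char2)
  then have "sqr a = c"
    by (simp add: sqr_eq_iff)
  with that g(1) gl show thesis by blast
qed

lemma GL_bij: "g \<in> GL \<Longrightarrow> bij g"
  by (auto simp: GL_def G_def semilinear_bij_def)

text \<open>The normal forms of the two pairs share \<open>sqr a\<close> and differ only in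
  \<open>y1\<close> and \<open>y2\<close>. A unipotent matrix keeps the first coordinate; the
  equation for its entry is solvable since c y1 and c y2 both have trace 1.\<close>

lemma GL_transitive:
  assumes "(l, n) \<in> Gamma a" "(l', n') \<in> Gamma a" "a \<noteq> 0"
  obtains g where "g \<in> GL" "g ` l = l'" "g ` n = n'"
proof -
  obtain g1 y1 where g1: "g1 \<in> GL" "g1 ` l = perp_line (sqr a) y1" "g1 ` n = perp_line (sqr a) (y1 + 1)"
    using normal_form[OF assms(1,3)] by blast
  obtain g2 y2 where g2: "g2 \<in> GL" "g2 ` l' = perp_line (sqr a) y2" "g2 ` n' = perp_line (sqr a) (y2 + 1)"
    using normal_form[OF assms(2,3)] by blast
  define c where "c = sqr a"
  have "c \<noteq> 0"
    using assms(3) by (simp add: c_def)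
  have "tr (c * y1) = 1" "tr (c * y2) = 1"
    using GL_Gamma[OF g1(1) assms(1)] GL_Gamma[OF g2(1) assms(2)] g1 g2
    by (simp_all add: Gamma_perp_line_iff c_def)
  then have "tr (c * (y1 + y2)) = 0"
    by (simp add: distrib_left tr_add add_self)
  then obtain h where h: "h\<^sup>2 + h = c * (y1 + y2)"
    by (rule artin_schreier)
  \<comment> \<open>Chosen so that sqr \<beta> = h / c; then sqr \<beta> + \<beta> c = y1 + y2 is,
    up to the factor c, the equation for \<open>h\<close>.\<close>
  define \<beta> where "\<beta> = (h / c)\<^sup>2"
  have sb: "sqr \<beta> = h / c"
    by (simp add: sqr_eq_iff \<beta>_def)
  have "c * (sqr \<beta> + \<beta> * c) = h + h\<^sup>2"
    unfolding sb unfolding \<beta>_def using \<open>c \<noteq> 0\<close> by (simp add: power2_eq_square algebra_simps)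
  then have "c * (sqr \<beta> + \<beta> * c) = c * (y1 + y2)"
    by (simp only: add.commute[of h] h)
  then have y2: "sqr \<beta> + \<beta> * c + y1 = y2"
    using \<open>c \<noteq> 0\<close> by (simp add: add.commute[of y1] add.assoc add_self)
  obtain g where g: "g \<in> GL" "\<And>x y. g ` perp_line x y =
    perp_line (sqr (1 * 0) + 1 * x + 0 * y) (sqr (\<beta> * 1) + \<beta> * x + 1 * y)"
    using GL_move[of 1 1 \<beta> 0] by auto
  have y2': "sqr \<beta> + \<beta> * c + (y1 + 1) = y2 + 1"
    using y2 by (metis add.assoc)
  have "g ` g1 ` l = g2 ` l'" "g ` g1 ` n = g2 ` n'"
    unfolding g1 g2 c_def[symmetric] g(2)
    by (simp_all only: mult_1 mult_1_right mult_zero_left mult_zero_right sqr_simps(3) add_0 add_0_right y2 y2')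
  then have "inv g2 ` g ` g1 ` l = l'" "inv g2 ` g ` g1 ` n = n'"
    using GL_bij[OF g2(1)] by (simp_all add: image_inv_f_f bij_is_inj)
  then show thesis
    using that[of "inv g2 \<circ> (g \<circ> g1)"] g(1) g1(1) g2(1) by (simp add: GL_comp GL_inv image_comp comp_assoc)
qed

lemma trace0_star_nonempty: "trace0_star m \<noteq> ({} :: 'a set)"
proof -
  have "CARD('a) > 2"
    using card power_strict_increasing[of 1 m "2::nat"] m_gt by simp
  then have "UNIV \<noteq> {0, 1 :: 'a}"
    by (metis card_2_iff less_irrefl zero_neq_one)
  then obtain h :: 'a where "h \<noteq> 0" "h \<noteq> 1" by auto
  then have "h * (h + 1) \<noteq> 0"
    by (simp add: add_eq_0)
  then have "h\<^sup>2 + h \<noteq> 0"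
    by (simp add: power2_eq_square algebra_simps)
  then show ?thesis
    using tr_artin_schreier[of h] by (auto simp: trace0_star_def)
qed

lemma Gamma_valency:
  assumes "l \<in> exterior_lines" "a \<in> trace0_star m"
  shows "card {n. (l, n) \<in> Gamma (a::'a)} = 2 ^ m + 1"
proof -
  obtain x y where l: "l = perp_line x y" "tr (x * y) = 1"
    using exterior_line_coords[OF assms(1)] .
  have "{n. (l, n) \<in> Gamma a} = (\<lambda>(z, u). perp_line z u) ` {(z, u). tr (z * u) = 1 \<and> rho_hat x y z u = a}"
    using l by (auto simp: Gamma_iff perp_line_inj)
  moreover have "inj_on (\<lambda>(z, u). perp_line z u) {(z, u). tr (z * u) = 1 \<and> rho_hat x y z u = a}"
    by (auto simp: inj_on_def perp_line_inj)
  moreover have "card {(z, u). tr (z * u) = 1 \<and> rho_hat x y z u = a} = 2 ^ m + 1"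
    using card_rho_eq[OF l(2)] assms(2) by (simp add: trace0_star_def)
  ultimately show ?thesis
    by (simp only: card_image)
qed

lemma Gamma_exists:
  assumes "l \<in> exterior_lines" "a \<in> trace0_star m"
  obtains n where "(l, n) \<in> Gamma (a::'a)"
proof -
  have "{n. (l, n) \<in> Gamma a} \<noteq> {}"
    using Gamma_valency[OF assms] by (metis Suc_eq_plus1 card.empty nat.distinct(1))
  with that show thesis by blast
qed

text \<open>Every exterior line is the first member of some pair in \<open>Gamma a\<close>, so
  transitivity on such pairs suffices.\<close>

lemma GL_transitive_lines:
  assumes "l \<in> exterior_lines" "l' \<in> exterior_lines"
  obtains g where "g \<in> GL" "g ` l = l'"
proof -
  obtain a :: 'a where a: "a \<in> trace0_star m"
    using trace0_star_nonempty by blast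
  then have "a \<noteq> 0"
    by (simp add: trace0_star_def)
  with that show thesis
    using Gamma_exists[OF assms(1) a] Gamma_exists[OF assms(2) a] GL_transitive by metis
qed

section \<open>Frobenius maps and transitivity on the relations \<open>Delta m a\<close>\<close>

definition frob :: "nat \<Rightarrow> 'a^3 \<Rightarrow> 'a^3" where
  "frob i v = (\<chi> j. (v $ j) ^ (2 ^ i))"

lemma frobenius_automorphism: "field_automorphism (\<lambda>x::'a. x ^ (2 ^ i))"
  unfolding field_automorphism_def
  by (simp add: power_add_pow2 power_mult_distrib bij_def finite_UNIV_inj_surj inj_def pow2_inj)

lemma frob_scale: "frob i (c *s v) = c ^ (2 ^ i) *s frob i v"
  by (simp add: frob_def vec_eq_iff power_mult_distrib)

lemma frob_G: "frob i \<in> G"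
proof (rule G_I[OF _ frobenius_automorphism frob_scale])
  show "inj (frob i)"
    by (simp add: inj_def frob_def vec_eq_iff pow2_inj)
  have "quad (frob i v) = (quad v) ^ (2 ^ i)" for v
    by (simp add: quad_def frob_def power_add_pow2 power_mult_distrib flip: power_mult) (simp add: mult.commute)
  then show "quad (frob i v) = 0" if "quad v = 0" for v
    using that by (simp add: power_0_left)
qed (simp add: frob_def vec_eq_iff power_add_pow2)

lemma frob_Gamma: "(l, n) \<in> Gamma a \<Longrightarrow> (frob i ` l, frob i ` n) \<in> Gamma (a ^ (2 ^ i))"
  using image_Gamma[OF frob_G frobenius_automorphism frob_scale] .

lemma frob_frob: "frob i (frob j v) = frob (j + i) v"
  by (simp add: frob_def vec_eq_iff pow2_pow2)

lemma frob_m: "frob m v = v"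
  by (simp add: frob_def vec_eq_iff power_card_eq)

lemma Delta_iff: "(l, n) \<in> Delta m (a::'a) \<longleftrightarrow> (\<exists>b\<in>frob_class m a. (l, n) \<in> Gamma b)"
  by (simp add: Delta_def)

lemma Delta_eq: "b \<in> frob_class m (a::'a) \<Longrightarrow> Delta m b = Delta m a"
  by (simp add: Delta_def frob_class_eq)

lemma G_image_exterior:
  assumes "f \<in> G" "l \<in> exterior_lines"
  shows "f ` l \<in> exterior_lines"
proof -
  obtain \<sigma> where \<sigma>: "field_automorphism \<sigma>" "\<And>c v. f (c *s v) = \<sigma> c *s f v"
    using assms(1) by (auto simp: G_def semilinear_bij_def)
  obtain x y where l: "l = perp_line x y" "tr (x * y) = 1"
    using exterior_line_coords[OF assms(2)] .
  \<comment> \<open>\<open>Gamma 0\<close> is the diagonal on exterior lines, so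
    \<open>image_Gamma\<close> also covers single lines.\<close>
  then have "(l, l) \<in> Gamma 0"
    by (simp add: Gamma_perp_line_iff rho_eq_0)
  then show ?thesis
    using image_Gamma[OF assms(1) \<sigma>] by (auto simp: Gamma_def)
qed

lemma G_Gamma:
  assumes "f \<in> G" "(l, n) \<in> Gamma (a::'a)"
  obtains b where "b \<in> frob_class m a" "(f ` l, f ` n) \<in> Gamma b"
proof -
  obtain \<sigma> where \<sigma>: "field_automorphism \<sigma>" "\<And>c v. f (c *s v) = \<sigma> c *s f v"
    using assms(1) by (auto simp: G_def semilinear_bij_def)
  show thesis
    using that automorphism_frob_class[OF \<sigma>(1)] image_Gamma[OF assms(1) \<sigma> assms(2)] by blast
qed

lemma G_Delta:
  assumes "f \<in> G" "(l, n) \<in> Delta m (a::'a)"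
  shows "(f ` l, f ` n) \<in> Delta m a"
proof -
  obtain b where b: "b \<in> frob_class m a" "(l, n) \<in> Gamma b"
    using assms(2) by (auto simp: Delta_iff)
  obtain c where "c \<in> frob_class m b" "(f ` l, f ` n) \<in> Gamma c"
    using G_Gamma[OF assms(1) b(2)] .
  with frob_class_eq[OF b(1)] show ?thesis
    by (auto simp: Delta_iff)
qed

text \<open>A power of Frobenius first carries the one pair into the \<open>Gamma\<close> relation
  of the other, and \<open>GL\<close> does the rest.\<close>

lemma G_transitive:
  assumes "(l, n) \<in> Delta m a" "(l', n') \<in> Delta m a" "a \<in> trace0_star m"
  obtains g where "g \<in> G" "g ` l = l'" "g ` n = n'"
proof -
  obtain b b' where b: "b \<in> frob_class m a" "(l, n) \<in> Gamma b" "b' \<in> frob_class m a" "(l', n') \<in> Gamma b'"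
    using assms by (auto simp: Delta_iff)
  then have "b' \<in> frob_class m b"
    using frob_class_eq by auto
  then obtain i where i: "b' = b ^ (2 ^ i)"
    by (auto simp: frob_class_iff)
  have "b' \<noteq> 0"
    using b(3) assms(3) trace0_star_frob_class by (auto simp: trace0_star_def)
  then obtain g where g: "g \<in> GL" "g ` frob i ` l = l'" "g ` frob i ` n = n'"
    using GL_transitive[OF frob_Gamma[OF b(2), of i, folded i] b(4)] by blast
  then have "g \<circ> frob i \<in> G"
    using G_comp frob_G by (auto simp: GL_def)
  with that g show thesis
    by (metis image_comp)
qed

section \<open>The orbitals of the projective group\<close>

lemma PGammaL2_eq: "PGammaL2 = (\<lambda>f. restrict (image f) {U. vec.subspace U}) ` G"
proof -
  have "P \<in> conic \<Longrightarrow> vec.subspace P" for P :: "('a^3) set"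
    by (auto simp: conic_def)
  then have *: "restrict (image f) {U. vec.subspace U} ` conic = image f ` conic" for f :: "'a^3 \<Rightarrow> 'a^3"
    by (intro image_cong) auto
  show ?thesis
  proof (intro equalityI subsetI)
    fix g :: "('a^3) set \<Rightarrow> ('a^3) set" assume "g \<in> PGammaL2"
    then obtain f where f: "g = restrict (image f) {U. vec.subspace U}" "semilinear_bij f" "g ` conic = conic"
      unfolding PGammaL2_def PGammaL3_def by blast
    then have "f \<in> G"
      using *[of f] by (simp only: G_def mem_Collect_eq)
    with f(1) show "g \<in> (\<lambda>f. restrict (image f) {U. vec.subspace U}) ` G" by blast
  next
    fix g assume "g \<in> (\<lambda>f. restrict (image f) {U :: ('a^3) set. vec.subspace U}) ` G"
    then obtain f where f: "g = restrict (image f) {U. vec.subspace U}" "semilinear_bij f" "image f ` conic = conic"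
      unfolding G_def by blast
    then have "g ` conic = conic"
      using *[of f] by (simp only:)
    with f show "g \<in> PGammaL2"
      unfolding PGammaL2_def PGammaL3_def by blast
  qed
qed

lemma orbital_eq:
  assumes "l \<in> exterior_lines" "n \<in> exterior_lines"
  shows "{(g l, g n) | g. g \<in> PGammaL2} = {(f ` l, f ` n) | f. f \<in> G}"
proof -
  have "vec.subspace l" "vec.subspace n"
    using assms by (auto simp: exterior_lines_def proj_lines_def)
  then have *: "restrict (image f) {U. vec.subspace U} l = f ` l" "restrict (image f) {U. vec.subspace U} n = f ` n"
    for f :: "'a^3 \<Rightarrow> 'a^3"
    by simp_all
  have "{(g l, g n) | g. g \<in> PGammaL2} = (\<lambda>g. (g l, g n)) ` PGammaL2"
    by blast
  also have "\<dots> = (\<lambda>f. (f ` l, f ` n)) ` G"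
    unfolding PGammaL2_eq image_image * ..
  also have "\<dots> = {(f ` l, f ` n) | f. f \<in> G}"
    by blast
  finally show ?thesis .
qed

lemma orbital_diagonal:
  assumes "l \<in> exterior_lines"
  shows "{(f ` l, f ` l) | f. f \<in> G} = Id_on exterior_lines"
proof (intro equalityI subsetI)
  fix p assume "p \<in> {(f ` l, f ` l) | f. f \<in> G}"
  then show "p \<in> Id_on exterior_lines"
    using G_image_exterior[OF _ assms] by auto
next
  fix p assume "p \<in> Id_on (exterior_lines :: ('a^3) set set)"
  then obtain l' where l': "p = (l', l')" "l' \<in> exterior_lines" by auto
  obtain g where "g \<in> GL" "g ` l = l'"
    using GL_transitive_lines[OF assms l'(2)] .
  with l' show "p \<in> {(f ` l, f ` l) | f. f \<in> G}"
    by (auto simp: GL_def)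
qed

lemma orbital_Delta:
  assumes "(l, n) \<in> Delta m a" "a \<in> trace0_star m"
  shows "{(f ` l, f ` n) | f. f \<in> G} = Delta m a"
proof (intro equalityI subsetI)
  fix p assume "p \<in> {(f ` l, f ` n) | f. f \<in> G}"
  then show "p \<in> Delta m a"
    using G_Delta[OF _ assms(1)] by auto
next
  fix p assume p: "p \<in> Delta m a"
  obtain l' n' where ln': "p = (l', n')" by (cases p)
  obtain g where "g \<in> G" "g ` l = l'" "g ` n = n'"
    using G_transitive[OF assms(1) p[unfolded ln'] assms(2)] .
  then show "p \<in> {(f ` l, f ` n) | f. f \<in> G}"
    unfolding ln' by blast
qed

lemma pair_cases:
  assumes "l \<in> exterior_lines" "n \<in> exterior_lines" "l \<noteq> n"
  obtains a where "(a::'a) \<in> trace0_star m" "(l, n) \<in> Gamma a"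
proof -
  obtain x y where l: "l = perp_line x y" "tr (x * y) = 1"
    using exterior_line_coords[OF assms(1)] .
  obtain z u where n: "n = perp_line z u" "tr (z * u) = 1"
    using exterior_line_coords[OF assms(2)] .
  have "rho_hat x y z u \<noteq> 0"
    using assms(3) l n by (auto simp: rho_eq_0)
  moreover have "tr (rho_hat x y z u) = 0"
    using l n by (simp add: tr_rho add_self)
  ultimately show thesis
    using that[of "rho_hat x y z u"] l n by (simp add: trace0_star_def Gamma_perp_line_iff)
qed

lemma Gamma_unique: "(l, n) \<in> Gamma a \<Longrightarrow> (l, n) \<in> Gamma b \<Longrightarrow> a = (b::'a)"
  by (auto simp: Gamma_iff perp_line_inj)

lemma Gamma_irrefl: "a \<in> trace0_star m \<Longrightarrow> (l, l) \<notin> Gamma (a::'a)"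
  by (auto simp: Gamma_iff perp_line_inj rho_eq_0 trace0_star_def)

lemma Gamma_sym: "sym (Gamma (a::'a))"
  unfolding sym_def Gamma_iff by (metis rho_commute)

lemma Gamma_exterior: "Gamma a \<subseteq> exterior_lines \<times> exterior_lines"
  by (auto simp: Gamma_def)

lemma exterior_nonempty: "exterior_lines \<noteq> ({} :: ('a^3) set set)"
  using perp_line_exterior[of 1 1] by auto

lemma orbitals_eq: "orbitals PGammaL2 (exterior_lines :: ('a^3) set set) = Delta_relations m"
proof (intro equalityI subsetI)
  fix R assume "R \<in> orbitals PGammaL2 (exterior_lines :: ('a^3) set set)"
  then obtain l n where ln: "l \<in> exterior_lines" "n \<in> exterior_lines" "R = {(g l, g n) | g. g \<in> PGammaL2}"
    by (auto simp: orbitals_def)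
  then have R: "R = {(f ` l, f ` n) | f. f \<in> G}"
    by (simp only: orbital_eq)
  show "R \<in> Delta_relations m"
  proof (cases "l = n")
    case True
    then show ?thesis
      using R orbital_diagonal[OF ln(1)] by (simp add: Delta_relations_def)
  next
    case False
    obtain a where a: "a \<in> trace0_star m" "(l, n) \<in> Gamma a"
      using pair_cases[OF ln(1,2) False] .
    then have "(l, n) \<in> Delta m a"
      using frob_class_refl Delta_iff by blast
    then show ?thesis
      using R orbital_Delta a by (simp add: Delta_relations_def)
  qed
next
  fix R :: "(('a^3) set \<times> ('a^3) set) set" assume "R \<in> Delta_relations m"
  then consider "R = Id_on exterior_lines" | a where "a \<in> trace0_star m" "R = Delta m a"
    by (auto simp: Delta_relations_def)
  then show "R \<in> orbitals PGammaL2 exterior_lines"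
  proof cases
    case 1
    obtain l :: "('a^3) set" where l: "l \<in> exterior_lines"
      using exterior_nonempty by blast
    then have "R = {(g l, g l) | g. g \<in> PGammaL2}"
      by (simp only: 1 orbital_eq orbital_diagonal)
    with l show ?thesis
      unfolding orbitals_def by blast
  next
    case (2 a)
    obtain l :: "('a^3) set" where l: "l \<in> exterior_lines"
      using exterior_nonempty by blast
    obtain n where n: "(l, n) \<in> Gamma a"
      using Gamma_exists[OF l 2(1)] .
    then have "(l, n) \<in> Delta m a"
      using frob_class_refl Delta_iff by blast
    moreover have "n \<in> exterior_lines"
      using n Gamma_exterior by blast
    ultimately have "R = {(g l, g n) | g. g \<in> PGammaL2}"
      using l 2 by (simp only: orbital_eq orbital_Delta)
    with l \<open>n \<in> exterior_lines\<close> show ?thesis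
      unfolding orbitals_def by blast
  qed
qed

end

section \<open>The schemes\<close>

text \<open>A symmetry taking (x, y) to (x', y') maps the points counted for the one pair
  bijectively onto those counted for the other. It may permute the whole type, as maps on subsets
  induced by vector bijections do.\<close>

lemma association_schemeI:
  fixes X :: "'x::finite set"
  assumes "X \<noteq> {}" "partition_on (X \<times> X) \<R>" "Id_on X \<in> \<R>" "\<And>R. R \<in> \<R> \<Longrightarrow> sym R"
    and trans: "\<And>T x y x' y'. T \<in> \<R> \<Longrightarrow> (x, y) \<in> T \<Longrightarrow> (x', y') \<in> T \<Longrightarrow>
      \<exists>g. bij g \<and> g x = x' \<and> g y = y' \<and> (\<forall>R\<in>\<R>. \<forall>u v. (g u, g v) \<in> R \<longleftrightarrow> (u, v) \<in> R)"
  shows "association_scheme X \<R>"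
proof -
  have "\<exists>p. \<forall>(x, y)\<in>T. card {z. (x, z) \<in> R \<and> (z, y) \<in> S} = p" if RST: "R \<in> \<R>" "S \<in> \<R>" "T \<in> \<R>" for R S T
  proof -
    have eq: "card {z. (x, z) \<in> R \<and> (z, y) \<in> S} = card {z. (x', z) \<in> R \<and> (z, y') \<in> S}"
      if xy: "(x, y) \<in> T" "(x', y') \<in> T" for x y x' y'
    proof -
      obtain g where g: "bij g" "g x = x'" "g y = y'" "\<And>R u v. R \<in> \<R> \<Longrightarrow> (g u, g v) \<in> R \<longleftrightarrow> (u, v) \<in> R"
        using trans[OF RST(3) xy] by blast
      have iff: "(x', g z) \<in> R \<and> (g z, y') \<in> S \<longleftrightarrow> (x, z) \<in> R \<and> (z, y) \<in> S" for z
        using g(4)[OF RST(1), of x z] g(4)[OF RST(2), of z y] g(2,3) by simp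
      have "bij_betw g {z. (x, z) \<in> R \<and> (z, y) \<in> S} {z. (x', z) \<in> R \<and> (z, y') \<in> S}"
      proof (rule bij_betw_imageI)
        show "inj_on g {z. (x, z) \<in> R \<and> (z, y) \<in> S}"
          using bij_is_inj[OF g(1)] by (rule inj_on_subset) simp
        show "g ` {z. (x, z) \<in> R \<and> (z, y) \<in> S} = {z. (x', z) \<in> R \<and> (z, y') \<in> S}"
        proof (intro equalityI subsetI)
          fix w assume w: "w \<in> {z. (x', z) \<in> R \<and> (z, y') \<in> S}"
          obtain z where z: "w = g z"
            using g(1) by (metis bij_pointE)
          with w iff[of z] show "w \<in> g ` {z. (x, z) \<in> R \<and> (z, y) \<in> S}" by simp
        qed (use iff in auto)
      qed
      then show ?thesis
        by (rule bij_betw_same_card)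
    qed
    show ?thesis
    proof (cases "T = {}")
      case False
      then obtain x0 y0 where "(x0, y0) \<in> T" by auto
      with eq show ?thesis
        by (intro exI[of _ "card {z. (x0, z) \<in> R \<and> (z, y0) \<in> S}"]) blast
    qed simp
  qed
  with assms show ?thesis
    unfolding association_scheme_def by simp
qed

lemma bij_image: assumes "bij f" shows "bij (image f)"
  using bij_betw_Pow[OF assms] by simp

definition Gamma_relations :: "nat \<Rightarrow> (('a::field^3) set \<times> ('a^3) set) set set" where
  "Gamma_relations m = insert (Id_on exterior_lines) (Gamma ` trace0_star m)"

context binary_field
begin

abbreviation X :: "('a^3) set set" where "X \<equiv> exterior_lines"
abbreviation \<R> :: "(('a^3) set \<times> ('a^3) set) set set" where "\<R> \<equiv> Gamma_relations m"
abbreviation \<S> :: "(('a^3) set \<times> ('a^3) set) set set" where "\<S> \<equiv> Delta_relations m"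

lemma Gamma_nonempty: "a \<in> trace0_star m \<Longrightarrow> Gamma (a::'a) \<noteq> {}"
  using exterior_nonempty Gamma_exists by (metis all_not_in_conv)

lemma partition_Gamma: "partition_on (X \<times> X) \<R>"
proof (rule partition_onI)
  show "\<Union>\<R> = X \<times> X"
  proof (intro equalityI subsetI)
    fix p assume "p \<in> \<Union>\<R>"
    then show "p \<in> X \<times> X"
      using Gamma_exterior by (auto simp: Gamma_relations_def)
  next
    fix p assume "p \<in> X \<times> X"
    then obtain l n where p: "p = (l, n)" "l \<in> X" "n \<in> X" by blast
    show "p \<in> \<Union>\<R>"
    proof (cases "l = n")
      case True
      with p show ?thesis by (auto simp: Gamma_relations_def)
    next
      case False
      obtain a where "a \<in> trace0_star m" "(l, n) \<in> Gamma a"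
        using pair_cases[OF p(2,3) False] .
      with p show ?thesis
        unfolding Gamma_relations_def by blast
    qed
  qed
next
  fix R S assume RS: "R \<in> \<R>" "S \<in> \<R>" "R \<noteq> S"
  have uniq: "Gamma a = Gamma b" if "(l, n) \<in> Gamma a" "(l, n) \<in> Gamma b" for l n and a b :: 'a
    using Gamma_unique[OF that] by simp
  show "disjnt R S"
    unfolding disjnt_iff
  proof (intro allI notI)
    fix p assume p: "p \<in> R \<and> p \<in> S"
    obtain l n where ln: "p = (l, n)" by (cases p)
    have "R = Id_on X \<or> (\<exists>a. a \<in> trace0_star m \<and> R = Gamma a)"
      "S = Id_on X \<or> (\<exists>a. a \<in> trace0_star m \<and> S = Gamma a)"
      using RS(1,2) by (auto simp: Gamma_relations_def)
    with RS(3) p show False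
      unfolding ln using Gamma_irrefl uniq by (elim disjE exE conjE) auto
  qed
next
  have "R \<noteq> {}" if "R \<in> \<R>" for R
  proof -
    from that consider "R = Id_on X" | a where "a \<in> trace0_star m" "R = Gamma a"
      by (auto simp: Gamma_relations_def)
    then show ?thesis
    proof cases
      case 1
      then show ?thesis
        using exterior_nonempty by (auto simp: Id_on_def)
    next
      case (2 a)
      then show ?thesis
        using Gamma_nonempty by blast
    qed
  qed
  then show "{} \<notin> \<R>"
    by blast
qed

lemma partition_Delta: "partition_on (X \<times> X) \<S>"
proof (rule partition_onI)
  show "\<Union>\<S> = X \<times> X"
  proof (intro equalityI subsetI)
    fix p assume "p \<in> \<Union>\<S>"
    then show "p \<in> X \<times> X"
      using Gamma_exterior by (auto simp: Delta_relations_def Delta_def)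
  next
    fix p assume "p \<in> X \<times> X"
    then obtain l n where p: "p = (l, n)" "l \<in> X" "n \<in> X" by blast
    show "p \<in> \<Union>\<S>"
    proof (cases "l = n")
      case True
      with p show ?thesis by (auto simp: Delta_relations_def)
    next
      case False
      obtain a where "a \<in> trace0_star m" "(l, n) \<in> Gamma a"
        using pair_cases[OF p(2,3) False] .
      moreover from this have "(l, n) \<in> Delta m a"
        using frob_class_refl Delta_iff by blast
      ultimately show ?thesis
        using p unfolding Delta_relations_def by blast
    qed
  qed
next
  fix R S assume RS: "R \<in> \<S>" "S \<in> \<S>" "R \<noteq> S"
  have irr: "(l, l) \<notin> Delta m a" if "a \<in> trace0_star m" for l and a :: 'a
    using that Gamma_irrefl trace0_star_frob_class by (auto simp: Delta_iff)
  have uniq: "Delta m a = Delta m b" if ab: "(l, n) \<in> Delta m a" "(l, n) \<in> Delta m b" for l n and a b :: 'a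
  proof -
    obtain c d where "c \<in> frob_class m a" "(l, n) \<in> Gamma c" "d \<in> frob_class m b" "(l, n) \<in> Gamma d"
      using ab by (auto simp: Delta_iff)
    then show ?thesis
      using Gamma_unique Delta_eq by metis
  qed
  show "disjnt R S"
    unfolding disjnt_iff
  proof (intro allI notI)
    fix p assume p: "p \<in> R \<and> p \<in> S"
    obtain l n where ln: "p = (l, n)" by (cases p)
    have "R = Id_on X \<or> (\<exists>a. a \<in> trace0_star m \<and> R = Delta m a)"
      "S = Id_on X \<or> (\<exists>a. a \<in> trace0_star m \<and> S = Delta m a)"
      using RS(1,2) by (auto simp: Delta_relations_def)
    with RS(3) p show False
      unfolding ln using irr uniq by (elim disjE exE conjE) auto
  qed
next
  have "R \<noteq> {}" if "R \<in> \<S>" for R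
  proof -
    from that consider "R = Id_on X" | a where "a \<in> trace0_star m" "R = Delta m a"
      by (auto simp: Delta_relations_def)
    then show ?thesis
    proof cases
      case 1
      then show ?thesis
        using exterior_nonempty by (auto simp: Id_on_def)
    next
      case (2 a)
      then show ?thesis
        using Gamma_nonempty[OF 2(1)] frob_class_refl[of a] unfolding 2(2) Delta_def by blast
    qed
  qed
  then show "{} \<notin> \<S>"
    by blast
qed

lemma G_bij: "g \<in> G \<Longrightarrow> bij g"
  by (auto simp: G_def semilinear_bij_def)

lemma G_preserves_Delta_relations:
  assumes "g \<in> G" "R \<in> \<S>" "(u, v) \<in> R"
  shows "(g ` u, g ` v) \<in> R"
  using assms G_Delta G_image_exterior by (auto simp: Delta_relations_def)

lemma GL_preserves_Gamma_relations:
  assumes "g \<in> GL" "R \<in> \<R>" "(u, v) \<in> R"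
  shows "(g ` u, g ` v) \<in> R"
  using assms GL_Gamma G_image_exterior by (auto simp: Gamma_relations_def GL_def)

lemma scheme_Gamma: "association_scheme X \<R>"
proof (rule association_schemeI[OF exterior_nonempty partition_Gamma])
  show "Id_on X \<in> \<R>"
    by (simp add: Gamma_relations_def)
next
  fix R assume "R \<in> \<R>"
  then show "sym R"
    using Gamma_sym by (auto simp: Gamma_relations_def sym_def)
next
  fix T l n l' n' assume T: "T \<in> \<R>" "(l, n) \<in> T" "(l', n') \<in> T"
  have "\<exists>g\<in>GL. g ` l = l' \<and> g ` n = n'"
  proof (cases "T = Id_on X")
    case True
    with T have "l \<in> X" "l' \<in> X" "n = l" "n' = l'" by auto
    then show ?thesis
      using GL_transitive_lines by metis
  next
    case False
    with T obtain a where a: "a \<in> trace0_star m" "T = Gamma a"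
      by (auto simp: Gamma_relations_def)
    then have "a \<noteq> 0"
      by (simp add: trace0_star_def)
    then show ?thesis
      using GL_transitive T(2,3) unfolding a(2) by metis
  qed
  then obtain g where g: "g \<in> GL" "g ` l = l'" "g ` n = n'" by blast
  have "bij g"
    using g(1) by (rule GL_bij)
  have "(g ` u, g ` v) \<in> R \<longleftrightarrow> (u, v) \<in> R" if "R \<in> \<R>" for R u v
    using GL_preserves_Gamma_relations[OF g(1) that, of u v]
      GL_preserves_Gamma_relations[OF GL_inv[OF g(1)] that, of "g ` u" "g ` v"] \<open>bij g\<close>
    by (auto simp: image_inv_f_f bij_is_inj)
  with g \<open>bij g\<close> bij_image show "\<exists>g. bij g \<and> g l = l' \<and> g n = n' \<and> (\<forall>R\<in>\<R>. \<forall>u v. (g u, g v) \<in> R \<longleftrightarrow> (u, v) \<in> R)"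
    by (intro exI[of _ "image g"]) blast
qed

lemma scheme_Delta: "association_scheme X \<S>"
proof (rule association_schemeI[OF exterior_nonempty partition_Delta])
  show "Id_on X \<in> \<S>"
    by (simp add: Delta_relations_def)
next
  fix R assume "R \<in> \<S>"
  then show "sym R"
    using Gamma_sym by (auto simp: Delta_relations_def Delta_def sym_def)
next
  fix T l n l' n' assume T: "T \<in> \<S>" "(l, n) \<in> T" "(l', n') \<in> T"
  have "\<exists>g\<in>G. g ` l = l' \<and> g ` n = n'"
  proof (cases "T = Id_on X")
    case True
    with T have "l \<in> X" "l' \<in> X" "n = l" "n' = l'" by auto
    then show ?thesis
      using GL_transitive_lines unfolding GL_def by (metis (no_types, lifting) mem_Collect_eq)
  next
    case False
    with T obtain a where a: "a \<in> trace0_star m" "T = Delta m a"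
      by (auto simp: Delta_relations_def)
    then show ?thesis
      using G_transitive T(2,3) unfolding a(2) by metis
  qed
  then obtain g where g: "g \<in> G" "g ` l = l'" "g ` n = n'" by blast
  have "bij g"
    using g(1) by (rule G_bij)
  have "(g ` u, g ` v) \<in> R \<longleftrightarrow> (u, v) \<in> R" if "R \<in> \<S>" for R u v
    using G_preserves_Delta_relations[OF g(1) that, of u v]
      G_preserves_Delta_relations[OF G_inv[OF g(1)] that, of "g ` u" "g ` v"] \<open>bij g\<close>
    by (auto simp: image_inv_f_f bij_is_inj)
  with g \<open>bij g\<close> bij_image show "\<exists>g. bij g \<and> g l = l' \<and> g n = n' \<and> (\<forall>R\<in>\<S>. \<forall>u v. (g u, g v) \<in> R \<longleftrightarrow> (u, v) \<in> R)"
    by (intro exI[of _ "image g"]) blast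
qed

text \<open>Intersection numbers depend only on the relation of (l, l'), so the pair may be replaced
  by its normal form. The sum then counts the n with equal values to both lines, as
  \<open>card_rho_equal\<close> does.\<close>

lemma Gamma_count:
  assumes "l \<in> X" "l' \<in> X" "l \<noteq> l'"
  shows "(\<Sum>R\<in>\<R> - {Id_on X}. card {n. (l, n) \<in> R \<and> (n, l') \<in> R}) = 2 ^ m"
proof -
  let ?R' = "\<R> - {Id_on X}"
  obtain a where a: "a \<in> trace0_star m" "(l, l') \<in> Gamma a"
    using pair_cases[OF assms] .
  then have "a \<noteq> 0"
    by (simp add: trace0_star_def)
  obtain g y where g: "g \<in> GL" "g ` l = perp_line (sqr a) y" "g ` l' = perp_line (sqr a) (y + 1)"
    using normal_form[OF a(2) \<open>a \<noteq> 0\<close>] .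
  define x where "x = sqr a"
  have can: "(perp_line x y, perp_line x (y + 1)) \<in> Gamma a"
    using GL_Gamma[OF g(1) a(2)] g(2,3) by (simp add: x_def)
  then have tr1: "tr (x * y) = 1" and tr2: "tr (x * (y + 1)) = 1"
    by (auto simp: Gamma_perp_line_iff)
  have aR: "Gamma a \<in> \<R>"
    using a by (simp add: Gamma_relations_def)
  have "(\<Sum>R\<in>?R'. card {n. (l, n) \<in> R \<and> (n, l') \<in> R}) =
      (\<Sum>R\<in>?R'. card {n. (perp_line x y, n) \<in> R \<and> (n, perp_line x (y + 1)) \<in> R})"
  proof (rule sum.cong[OF refl])
    fix R assume "R \<in> ?R'"
    then have "R \<in> \<R>" by blast
    then obtain p where p: "\<forall>(l, l')\<in>Gamma a. card {n. (l, n) \<in> R \<and> (n, l') \<in> R} = p"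
      using scheme_Gamma aR unfolding association_scheme_def by blast
    show "card {n. (l, n) \<in> R \<and> (n, l') \<in> R} =
        card {n. (perp_line x y, n) \<in> R \<and> (n, perp_line x (y + 1)) \<in> R}"
      using bspec[OF p a(2)] bspec[OF p can] by simp
  qed
  also have "\<dots> = card (\<Union>R\<in>?R'. {n. (perp_line x y, n) \<in> R \<and> (n, perp_line x (y + 1)) \<in> R})"
  proof (rule card_UN_disjoint[symmetric]; (intro ballI impI)?)
    fix R S assume "R \<in> ?R'" "S \<in> ?R'" "R \<noteq> S"
    then have "disjnt R S"
      using partition_Gamma by (auto simp: partition_on_def pairwise_def)
    then show "{n. (perp_line x y, n) \<in> R \<and> (n, perp_line x (y + 1)) \<in> R} \<inter>
        {n. (perp_line x y, n) \<in> S \<and> (n, perp_line x (y + 1)) \<in> S} = {}"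
      by (auto simp: disjnt_iff)
  qed auto
  also have "(\<Union>R\<in>?R'. {n. (perp_line x y, n) \<in> R \<and> (n, perp_line x (y + 1)) \<in> R}) =
      (\<lambda>(z, u). perp_line z u) ` {(z, u). tr (z * u) = 1 \<and> rho_hat x y z u = rho_hat x (y + 1) z u}"
    (is "?L = ?f ` ?A")
  proof (intro equalityI subsetI)
    fix n assume "n \<in> ?L"
    then obtain b where b: "b \<in> trace0_star m" "(perp_line x y, n) \<in> Gamma b" "(n, perp_line x (y + 1)) \<in> Gamma b"
      by (auto simp: Gamma_relations_def)
    then obtain z u where n: "n = perp_line z u"
      by (auto simp: Gamma_iff)
    have "tr (z * u) = 1" "rho_hat x y z u = rho_hat x (y + 1) z u"
      using b unfolding n Gamma_perp_line_iff by (auto simp: rho_commute)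
    with n show "n \<in> ?f ` ?A" by auto
  next
    fix n assume "n \<in> ?f ` ?A"
    then obtain z u where n: "n = perp_line z u" "tr (z * u) = 1" and eq: "rho_hat x y z u = rho_hat x (y + 1) z u"
      by auto
    define b where "b = rho_hat x y z u"
    \<comment> \<open>The value 0 would make \<open>n\<close> equal to both lines, whose second
      coordinates y and y + 1 differ.\<close>
    have "b \<noteq> 0"
    proof
      assume "b = 0"
      then have "y = u" "y + 1 = u"
        using eq rho_eq_0[OF tr1, of z u] rho_eq_0[OF tr2, of z u] by (auto simp: b_def)
      then show False by simp
    qed
    moreover have "tr b = 0"
      using tr1 n by (simp add: b_def tr_rho add_self)
    ultimately have b: "b \<in> trace0_star m"
      by (simp add: trace0_star_def)
    have "(perp_line x y, n) \<in> Gamma b" "(n, perp_line x (y + 1)) \<in> Gamma b"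
      using n tr1 tr2 eq unfolding n(1) Gamma_perp_line_iff by (auto simp: b_def rho_commute[of z u])
    moreover have "Gamma b \<in> ?R'"
    proof -
      have "Gamma b \<noteq> Id_on X"
        using Gamma_irrefl[OF b] exterior_nonempty by auto
      with b show ?thesis
        by (simp add: Gamma_relations_def)
    qed
    ultimately show "n \<in> ?L" by blast
  qed
  finally have "(\<Sum>R\<in>?R'. card {n. (l, n) \<in> R \<and> (n, l') \<in> R}) = card (?f ` ?A)" .
  moreover have "inj_on ?f ?A"
    by (auto simp: inj_on_def perp_line_inj)
  ultimately show ?thesis
    using card_rho_equal[OF tr1 tr2] by (simp only: card_image)
qed

text \<open>The choice depends on the set \<open>frob_class m a\<close> only, so conjugate elements
  select the same representative.\<close>

definition W :: "(('a^3) set \<times> ('a^3) set) set" where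
  "W = (\<Union>a\<in>trace0_star m. Gamma (SOME b. b \<in> frob_class m a))"

lemma Gamma_W:
  assumes "(l, n) \<in> Gamma (a::'a)" "a \<in> trace0_star m"
  shows "(l, n) \<in> W \<longleftrightarrow> a = (SOME b. b \<in> frob_class m a)"
proof
  assume "(l, n) \<in> W"
  then obtain c where c: "c \<in> trace0_star m" "(l, n) \<in> Gamma (SOME b. b \<in> frob_class m c)"
    by (auto simp: W_def)
  then have a: "a = (SOME b. b \<in> frob_class m c)"
    using Gamma_unique assms by blast
  have "(SOME b. b \<in> frob_class m c) \<in> frob_class m c"
    using frob_class_refl by (rule someI)
  then have "frob_class m a = frob_class m c"
    unfolding a[symmetric] by (rule frob_class_eq)
  with a show "a = (SOME b. b \<in> frob_class m a)" by simp
next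
  assume "a = (SOME b. b \<in> frob_class m a)"
  then have "Gamma a = Gamma (SOME b. b \<in> frob_class m a)"
    by (rule arg_cong)
  with assms show "(l, n) \<in> W"
    unfolding W_def by blast
qed

lemma W_exterior: "W \<subseteq> X \<times> X"
  using Gamma_exterior by (auto simp: W_def)

lemma W_irrefl: "(l, l) \<notin> W"
proof
  assume "(l, l) \<in> W"
  then obtain c where c: "c \<in> trace0_star m" "(l, l) \<in> Gamma (SOME b. b \<in> frob_class m c)"
    by (auto simp: W_def)
  have "(SOME b. b \<in> frob_class m c) \<in> frob_class m c"
    using frob_class_refl by (rule someI)
  then have "(SOME b. b \<in> frob_class m c) \<in> trace0_star m"
    using c(1) trace0_star_frob_class by blast
  with c(2) Gamma_irrefl show False by blast
qed

lemma adjacency_W: "adjacency_matrix W \<in> bose_mesner_algebra \<R>"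
  unfolding bose_mesner_iff[OF partition_Gamma]
proof (intro conjI allI ballI impI)
  fix R p p' assume R: "R \<in> \<R>" "p \<in> R" "p' \<in> R"
  have "p \<in> W \<longleftrightarrow> p' \<in> W"
  proof (cases "R = Id_on X")
    case True
    with R W_irrefl show ?thesis by auto
  next
    case False
    with R obtain a where a: "a \<in> trace0_star m" "R = Gamma a"
      by (auto simp: Gamma_relations_def)
    with R show ?thesis
      using Gamma_W[of "fst p" "snd p" a] Gamma_W[of "fst p'" "snd p'" a] by simp
  qed
  then show "adjacency_matrix W $ fst p $ snd p = adjacency_matrix W $ fst p' $ snd p'"
    by (simp add: adjacency_matrix_def)
next
  fix l n assume "(l, n) \<notin> X \<times> X"
  then have "(l, n) \<notin> W"
    using W_exterior by blast
  then show "adjacency_matrix W $ l $ n = 0"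
    by (simp add: adjacency_matrix_def)
qed

section \<open>The Frobenius permutation of the lines and its fixed matrices\<close>

abbreviation \<pi> :: "('a^3) set \<Rightarrow> ('a^3) set" where "\<pi> \<equiv> image (frob 1)"

lemma pi_pow: "(\<pi> ^^ i) l = frob i ` l"
proof (induction i arbitrary: l)
  case 0
  have "frob 0 = id"
    by (simp add: frob_def fun_eq_iff vec_eq_iff)
  then show ?case by simp
next
  case (Suc i)
  then show ?case
    by (simp add: image_image frob_frob)
qed

lemma pi_mem: "\<pi> l \<in> X \<longleftrightarrow> l \<in> X"
proof
  assume "\<pi> l \<in> X"
  then have "inv (frob 1) ` \<pi> l \<in> X"
    by (rule G_image_exterior[OF G_inv[OF frob_G]])
  then show "l \<in> X"
    using G_bij[OF frob_G] by (simp add: image_inv_f_f bij_is_inj)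
qed (rule G_image_exterior[OF frob_G])

text \<open>The i-th translate takes (l, n) from \<open>Gamma a\<close> to
  \<open>Gamma (a ^ (2 ^ i))\<close>. The m conjugates of a are distinct, and exactly one of them is
  the chosen representative.\<close>

lemma W_transversal:
  assumes "prime m" "l \<in> X" "n \<in> X" "l \<noteq> n"
  shows "\<exists>!i. i < m \<and> ((\<pi> ^^ i) l, (\<pi> ^^ i) n) \<in> W"
proof -
  obtain a where a: "a \<in> trace0_star m" "(l, n) \<in> Gamma a"
    using pair_cases[OF assms(2-)] .
  define c where "c = (SOME b. b \<in> frob_class m a)"
  have "((\<pi> ^^ i) l, (\<pi> ^^ i) n) \<in> W \<longleftrightarrow> a ^ (2 ^ i) = c" for i
    unfolding pi_pow c_def using Gamma_W[OF frob_Gamma[OF a(2), of i]] a(1)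
    by (simp add: trace0_star_pow2 frob_class_eq[OF frob_class_pow])
  moreover have "c \<in> frob_class m a"
    unfolding c_def using frob_class_refl by (rule someI)
  then obtain i where "i < m" "a ^ (2 ^ i) = c"
    by (auto simp: frob_class_def)
  ultimately show ?thesis
    using frob_distinct[OF assms(1) a(1)] by (intro ex1I[of _ i]) auto
qed

lemma permute_closed:
  assumes M: "M \<in> bose_mesner_algebra \<R>"
  shows "permute_matrix \<pi> M \<in> bose_mesner_algebra \<R>"
proof -
  interpret scheme X \<R>
    by standard (rule scheme_Gamma)
  show ?thesis
    unfolding bose_mesner_iff[OF partition_Gamma]
  proof (intro conjI allI ballI impI)
    fix R p p' assume R: "R \<in> \<R>" "p \<in> R" "p' \<in> R"
    obtain l n where p: "p = (l, n)" by (cases p)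
    obtain l' n' where p': "p' = (l', n')" by (cases p')
    have "\<exists>S\<in>\<R>. (\<pi> l, \<pi> n) \<in> S \<and> (\<pi> l', \<pi> n') \<in> S"
    proof (cases "R = Id_on X")
      case True
      with R p p' pi_mem show ?thesis
        by (intro bexI[of _ "Id_on X"]) (auto simp: Gamma_relations_def)
    next
      case False
      with R obtain a where a: "a \<in> trace0_star m" "R = Gamma a"
        by (auto simp: Gamma_relations_def)
      have "Gamma (a ^ (2 ^ 1)) \<in> \<R>"
        using a(1) trace0_star_pow2 unfolding Gamma_relations_def by blast
      moreover have "(\<pi> l, \<pi> n) \<in> Gamma (a ^ (2 ^ 1))" "(\<pi> l', \<pi> n') \<in> Gamma (a ^ (2 ^ 1))"
        using frob_Gamma[OF R(2)[unfolded a(2) p], of 1] frob_Gamma[OF R(3)[unfolded a(2) p'], of 1] .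
      ultimately show ?thesis
        by blast
    qed
    then obtain S where S: "S \<in> \<R>" "(\<pi> l, \<pi> n) \<in> S" "(\<pi> l', \<pi> n') \<in> S" by blast
    show "permute_matrix \<pi> M $ fst p $ snd p = permute_matrix \<pi> M $ fst p' $ snd p'"
      using const_on_rel[OF M S] by (simp add: p p' permute_matrix_def)
  next
    fix l n assume "(l, n) \<notin> X \<times> X"
    then have "(\<pi> l, \<pi> n) \<notin> X \<times> X"
      using pi_mem by blast
    then show "permute_matrix \<pi> M $ l $ n = 0"
      using zero_outside[OF M] by (simp add: permute_matrix_def)
  qed
qed

text \<open>\<open>Delta m a\<close> is the union of a Frobenius orbit of relations
  \<open>Gamma b\<close>, so constancy on it amounts to constancy on each \<open>Gamma b\<close>
  together with invariance under \<open>\<pi>\<close>.\<close>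

lemma bose_mesner_Delta:
  "bose_mesner_algebra \<S> = {M \<in> bose_mesner_algebra \<R>. permute_matrix \<pi> M = M}"
proof (intro equalityI subsetI)
  interpret scheme X \<S>
    by standard (rule scheme_Delta)
  fix M assume M: "M \<in> bose_mesner_algebra \<S>"
  have zero: "M $ l $ n = 0" if "(l, n) \<notin> X \<times> X" for l n
    using zero_outside[OF M that] .
  have const: "M $ l $ n = M $ l' $ n'" if "(l, n) \<in> Delta m a" "(l', n') \<in> Delta m a" "a \<in> trace0_star m" for l n l' n' and a :: 'a
  proof -
    have "Delta m a \<in> \<S>"
      using that(3) by (simp add: Delta_relations_def)
    then show ?thesis
      using that(1,2) by (rule const_on_rel[OF M])
  qed
  have diag: "M $ l $ l = M $ n $ n" if "l \<in> X" "n \<in> X" for l n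
    by (rule const_on_rel[OF M Id_mem Id_onI[OF that(1)] Id_onI[OF that(2)]])
  have Gamma_Delta: "p \<in> Delta m a" if "p \<in> Gamma a" for p and a :: 'a
    using that frob_class_refl unfolding Delta_def by blast
  have "M \<in> bose_mesner_algebra \<R>"
    unfolding bose_mesner_iff[OF partition_Gamma]
  proof (intro conjI allI ballI impI zero)
    fix R p p' assume R: "R \<in> \<R>" "p \<in> R" "p' \<in> R"
    obtain l n where p: "p = (l, n)" by (cases p)
    obtain l' n' where p': "p' = (l', n')" by (cases p')
    show "M $ fst p $ snd p = M $ fst p' $ snd p'"
    proof (cases "R = Id_on X")
      case True
      with R p p' diag show ?thesis by auto
    next
      case False
      with R obtain a where a: "a \<in> trace0_star m" "R = Gamma a"
        by (auto simp: Gamma_relations_def)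
      have "(l, n) \<in> Delta m a" "(l', n') \<in> Delta m a"
        using R(2,3) unfolding a(2) p p' by (simp_all only: Gamma_Delta)
      then show ?thesis
        unfolding p p' fst_conv snd_conv by (rule const[OF _ _ a(1)])
    qed
  qed
  moreover have "permute_matrix \<pi> M $ l $ n = M $ l $ n" for l n
  proof -
    consider "(l, n) \<notin> X \<times> X" | "l \<in> X" "l = n" | "l \<in> X" "n \<in> X" "l \<noteq> n" by blast
    then have "M $ \<pi> l $ \<pi> n = M $ l $ n"
    proof cases
      case 1
      then have "(\<pi> l, \<pi> n) \<notin> X \<times> X"
        using pi_mem by blast
      with 1 show ?thesis
        using zero by metis
    next
      case 2
      with diag pi_mem show ?thesis by metis
    next
      case 3
      obtain a where a: "a \<in> trace0_star m" "(l, n) \<in> Gamma a"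
        using pair_cases[OF 3] .
      then have "(l, n) \<in> Delta m a"
        by (simp add: Gamma_Delta)
      then show ?thesis
        using const a(1) G_Delta[OF frob_G] by blast
    qed
    then show ?thesis
      by (simp add: permute_matrix_def)
  qed
  ultimately show "M \<in> {M \<in> bose_mesner_algebra \<R>. permute_matrix \<pi> M = M}"
    by (simp add: vec_eq_iff)
next
  interpret scheme X \<R>
    by standard (rule scheme_Gamma)
  fix M assume "M \<in> {M \<in> bose_mesner_algebra \<R>. permute_matrix \<pi> M = M}"
  then have M: "M \<in> bose_mesner_algebra \<R>" and inv: "permute_matrix \<pi> M = M" by auto
  have pow: "M $ (\<pi> ^^ i) l $ (\<pi> ^^ i) n = M $ l $ n" for i l n
  proof (induction i)
    case (Suc i)
    have "M $ \<pi> l $ \<pi> n = permute_matrix \<pi> M $ l $ n" for l n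
      by (simp add: permute_matrix_def)
    then have "M $ \<pi> l $ \<pi> n = M $ l $ n" for l n
      by (simp only: inv)
    then show ?case
      by (simp only: funpow.simps comp_apply Suc)
  qed simp
  have const: "M $ l $ n = M $ l' $ n'" if "(l, n) \<in> Gamma (a ^ (2 ^ i))" "(l', n') \<in> Gamma a" "a \<in> trace0_star m" for l n l' n' i and a :: 'a
  proof -
    have "Gamma (a ^ (2 ^ i)) \<in> \<R>"
      using that(3) trace0_star_pow2 unfolding Gamma_relations_def by blast
    then have "M $ l $ n = M $ (frob i ` l') $ (frob i ` n')"
      using const_on_rel[OF M _ that(1) frob_Gamma[OF that(2)]] by blast
    then show ?thesis
      using pow[of i l' n'] by (simp only: pi_pow)
  qed
  show "M \<in> bose_mesner_algebra \<S>"
    unfolding bose_mesner_iff[OF partition_Delta]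
  proof (intro conjI allI ballI impI zero_outside[OF M])
    fix R p p' assume R: "R \<in> \<S>" "p \<in> R" "p' \<in> R"
    obtain l n where p: "p = (l, n)" by (cases p)
    obtain l' n' where p': "p' = (l', n')" by (cases p')
    show "M $ fst p $ snd p = M $ fst p' $ snd p'"
    proof (cases "R = Id_on X")
      case True
      then show ?thesis
        using const_on_rel[OF M Id_mem, of l n l' n'] R(2,3) by (simp add: p p')
    next
      case False
      with R obtain a where a: "a \<in> trace0_star m" "R = Delta m a"
        by (auto simp: Delta_relations_def)
      \<comment> \<open>\<open>const\<close> compares a conjugate relation only with
        \<open>Gamma a\<close> itself, so both pairs are compared with a fixed pair of
        \<open>Gamma a\<close>.\<close>
      obtain l0 :: "('a^3) set" where "l0 \<in> X"
        using exterior_nonempty by blast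
      then obtain n0 where 0: "(l0, n0) \<in> Gamma a"
        using Gamma_exists a(1) by blast
      obtain i where i: "(l, n) \<in> Gamma (a ^ (2 ^ i))"
        using R a p by (auto simp: Delta_iff frob_class_iff)
      obtain j where j: "(l', n') \<in> Gamma (a ^ (2 ^ j))"
        using R a p' by (auto simp: Delta_iff frob_class_iff)
      show ?thesis
        using const[OF i 0 a(1)] const[OF j 0 a(1)] by (simp add: p p')
    qed
  qed
qed

lemma pseudocyclic_Delta:
  assumes "prime m"
  shows "pseudocyclic X \<S>"
proof -
  \<comment> \<open>The valency is k = q + 1, and the q of \<open>Gamma_count\<close> is then k -
    1.\<close>
  interpret prime_fusion X \<R> \<S> \<pi> m "2 ^ m + 1" W
  proof
    show "association_scheme X \<R>" by (rule scheme_Gamma)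
    show "association_scheme X \<S>" by (rule scheme_Delta)
    show "bij \<pi>"
      by (rule bij_image[OF G_bij[OF frob_G]])
    show "\<pi> ^^ m = id"
      by (rule ext) (unfold pi_pow, simp add: frob_m)
    show "bose_mesner_algebra \<S> = {M \<in> bose_mesner_algebra \<R>. permute_matrix \<pi> M = M}"
      by (rule bose_mesner_Delta)
    show "adjacency_matrix W \<in> bose_mesner_algebra \<R>"
      by (rule adjacency_W)
    show "prime m" by fact
    show "(0::nat) < 2 ^ m + 1" by simp
  next
    fix l show "\<pi> l \<in> X \<longleftrightarrow> l \<in> X" by (rule pi_mem)
  next
    fix M assume "M \<in> bose_mesner_algebra \<R>"
    then show "permute_matrix \<pi> M \<in> bose_mesner_algebra \<R>" by (rule permute_closed)
  next
    fix l n assume "l \<in> X" "n \<in> X" "l \<noteq> n"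
    then show "\<exists>!i. i < m \<and> ((\<pi> ^^ i) l, (\<pi> ^^ i) n) \<in> W" by (rule W_transversal[OF assms])
  next
    fix l show "(l, l) \<notin> W" by (rule W_irrefl)
  next
    fix R l assume "R \<in> \<R>" "R \<noteq> Id_on X" "l \<in> X"
    then show "card {n. (l, n) \<in> R} = 2 ^ m + 1"
      using Gamma_valency by (auto simp: Gamma_relations_def)
  next
    fix l n assume "l \<in> X" "n \<in> X" "l \<noteq> n"
    then show "(\<Sum>R\<in>\<R> - {Id_on X}. card {z. (l, z) \<in> R \<and> (z, n) \<in> R}) = 2 ^ m + 1 - 1"
      using Gamma_count by simp
  qed
  show ?thesis by (rule pseudocyclic_fusion)
qed

end

theorem theorem7:
  fixes m :: nat
  assumes "prime m" and "odd m" and "CARD('a::{finite,field}) = 2 ^ m"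
  shows "association_scheme (exterior_lines :: ('a^3) set set) (Delta_relations m) \<and>
         Delta_relations m = orbitals PGammaL2 (exterior_lines :: ('a^3) set set) \<and>
         pseudocyclic (exterior_lines :: ('a^3) set set) (Delta_relations m)"
proof -
  interpret binary_field m "TYPE('a)"
    using assms prime_gt_1_nat by unfold_locales auto
  show ?thesis
    using scheme_Delta orbitals_eq pseudocyclic_Delta[OF assms(1)] by simp
qed

end
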